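(* The space $\mathsf{cf}(\mathrm{UT}_\bullet)=\bigoplus_{n\ge0}\mathsf{cf}(\mathrm{UT}_n)$ is a graded connected Hopf algebra with product and coproduct $$\mu=\bigoplus_{n\ge i\ge0}\mathrm{Inf}^{\mathrm{UT}_n}_{\mathrm{UL}_{[i]}}\circ\mathrm{st}^{-1}_{([i],[i]^c)},\qquad \Delta=\bigoplus_{n\ge0}\sum_{I\subseteq[n]}\mathrm{st}_{(I,I^c)}\circ\mathrm{Def}^{\mathrm{UP}_I}_{\mathrm{UL}_I}\circ\mathrm{Res}^{\mathrm{UT}_n}_{\mathrm{UP}_I}.$$ Moreover, there is a graded isomorphism of Hopf algebras $\mathsf{cf}(\mathrm{UT}_\bullet)\cong\overline{\mathcal{K}}(\mathbf{cf})$.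
   Context: Fix the finite field $\mathbb{F}_q$; $[n]=\{1,\dots,n\}$. $\mathrm{UT}_n$ is the group of $n\times n$ unipotent upper triangular matrices over $\mathbb{F}_q$; $\mathsf{cf}(G)$ denotes complex class functions on $G$. For $I\subseteq[n]$, $I^c=[n]\setminus I$, define subgroups of $\mathrm{UT}_n$: $\mathrm{UL}_I=\{g:(g-1_n)_{i,j}\neq0\text{ only if }(i,j)\in I\times I\cup I^c\times I^c\}$, $\mathrm{UR}_I=\{g:(g-1_n)_{i,j}\ne0\text{ only if }(i,j)\in I\times I^c\}$, $\mathrm{UP}_I=\{g:(g-1_n)_{i,j}=0\text{ whenever }(i,j)\in I^c\times I\}$. Then $\mathrm{UP}_I=\mathrm{UL}_I\ltimes\mathrm{UR}_I$, and $\mathrm{UP}_{[i]}=\mathrm{UT}_n$. $\mathrm{Inf}^{\mathrm{UT}_n}_{\mathrm{UL}_{[i]}}\psi(lr)=\psi(l)$ ($l\in\mathrm{UL}_{[i]}$, $r\in\mathrm{UR}_{[i]}$), $\mathrm{Res}$ is restriction, and $\mathrm{Def}^{\mathrm{UP}_I}_{\mathrm{UL}_I}\psi(g)=\frac1{|\mathrm{UR}_I|}\sum_{x\in\mathrm{UR}_I}\psi(gx)$. For $I\subseteq[n]$ let $\mathrm{cano}_I:I\to[|I|]$ be the order-preserving bijection; the isomorphism $\mathrm{UT}_{|I|}\times\mathrm{UT}_{|I^c|}\to\mathrm{UL}_I$, $(g_1,g_2)\mapsto$ the matrix with $(\mathrm{cano}_I^{-1}(r),\mathrm{cano}_I^{-1}(s))$-entry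 $(g_1)_{r,s}$, $(\mathrm{cano}_{I^c}^{-1}(r),\mathrm{cano}_{I^c}^{-1}(s))$-entry $(g_2)_{r,s}$, and zeros elsewhere, induces the straightening isomorphism $\mathrm{st}_{(I,I^c)}:\mathsf{cf}(\mathrm{UL}_I)\to\mathsf{cf}(\mathrm{UT}_{|I|})\otimes\mathsf{cf}(\mathrm{UT}_{|I^c|})$. $\mathbf{cf}$ is the connected Hopf monoid (in vector species over $\mathbb{C}$) with $\mathbf{cf}[I]=\bigoplus_{\tau}\mathsf{cf}(\mathrm{UT}(\tau))$ over total orders $\tau$ of the finite set $I$ (where $\mathrm{UT}(\tau)$ is the group of invertible $I\times I$ matrices $X$ with $(X-1)_{i,j}\neq0$ only if $(i,j)\in\tau$), $\mathbf{cf}[\sigma]\psi=\psi\circ\sigma^{-1}$ for bijections $\sigma$ (acting on matrices by relabelling indices), product $\mu_{(S,T)}$ on the summand $(\tau_1,\tau_2)$ given by inflation from $\mathrm{UT}(\tau_1)\oplus\mathrm{UT}(\tau_2)$ to $\mathrm{UT}(\tau_1\sqcup\tau_2\sqcup S\times T)$, and coproduct $\Delta_{(S,T)}$ on the summand $\mathsf{cf}(\mathrm{UT}(\phi))$ given by restriction to the subgroup of $\mathrm{UT}(\phi)$ with no nonzero entries in $T\times S$, followed by deflation to $\mathrm{UT}(\phi|_S)\oplus\mathrm{UT}(\phi|_T)$ (averaging over the normal complement with nonzero off-diagonal entries only in $\phi\cap(S\times T)$). The Fock functor $\overline{\mathcal{K}}$ sends a connected Hopf monoid $\mathbf{h}$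 to $\overline{\mathcal{K}}(\mathbf{h})=\bigoplus_{n\ge0}(\mathbf{h}[n])_{S_n}$ (coinvariants $\mathbf{h}[n]/\langle v-\mathbf{h}[\sigma]v\rangle$), a graded connected Hopf algebra with product $\bigoplus_{n\ge i\ge0}\mu_{([i],[i]^c)}\circ\mathrm{st}^{-1}_{([i],[i]^c)}$ and coproduct $\bigoplus_n\sum_{I\subseteq[n]}\mathrm{st}_{(I,I^c)}\circ\Delta_{(I,I^c)}$, where $\mathrm{st}_{(I,I^c)}=\mathbf{h}[\mathrm{cano}_I]\otimes\mathbf{h}[\mathrm{cano}_{I^c}]$ on coinvariants. *)

theory Defs
  imports Complex_Main "HOL-Combinatorics.Permutations"
begin

text \<open>A graded piece is a set of functions 'x => complex.  The tensor product of two
(finite-dimensional) function spaces is modelled, as usual, inside the functions on the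
product: the span of the pure tensors (x,y) |-> f x * g y.\<close>

definition subsp :: "('x \<Rightarrow> complex) set \<Rightarrow> bool" where
  "subsp V \<longleftrightarrow> (\<lambda>x. 0) \<in> V \<and> (\<forall>f\<in>V. \<forall>g\<in>V. (\<lambda>x. f x + g x) \<in> V)
     \<and> (\<forall>c. \<forall>f\<in>V. (\<lambda>x. c * f x) \<in> V)"

definition lin_on :: "('x \<Rightarrow> complex) set \<Rightarrow> (('x \<Rightarrow> complex) \<Rightarrow> ('y \<Rightarrow> complex)) \<Rightarrow> bool" where
  "lin_on V L \<longleftrightarrow> (\<forall>f\<in>V. \<forall>g\<in>V. \<forall>c d.
      L (\<lambda>x. c * f x + d * g x) = (\<lambda>y. c * L f y + d * L g y))"

definition tensor2 :: "('x \<Rightarrow> complex) set \<Rightarrow> ('y \<Rightarrow> complex) set \<Rightarrow> ('x \<times> 'y \<Rightarrow> complex) set" where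
  "tensor2 A B = {F. \<exists>(m::nat) fs gs. (\<forall>k<m. fs k \<in> A \<and> gs k \<in> B) \<and>
      F = (\<lambda>(x,y). \<Sum>k<m. fs k x * gs k y)}"

definition tensor3 :: "('x \<Rightarrow> complex) set \<Rightarrow> ('y \<Rightarrow> complex) set \<Rightarrow> ('z \<Rightarrow> complex) set
    \<Rightarrow> ('x \<times> 'y \<times> 'z \<Rightarrow> complex) set" where
  "tensor3 A B C = {F. \<exists>(m::nat) fs gs hs. (\<forall>k<m. fs k \<in> A \<and> gs k \<in> B \<and> hs k \<in> C) \<and>
      F = (\<lambda>(x,y,z). \<Sum>k<m. fs k x * gs k y * hs k z)}"

definition tmap :: "(('x \<Rightarrow> complex) \<Rightarrow> ('u \<Rightarrow> complex)) \<Rightarrow> (('y \<Rightarrow> complex) \<Rightarrow> ('v \<Rightarrow> complex))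
    \<Rightarrow> ('x \<times> 'y \<Rightarrow> complex) \<Rightarrow> ('u \<times> 'v \<Rightarrow> complex)" where
  "tmap L M F = (\<lambda>(u,v). M (\<lambda>b. L (\<lambda>a. F (a,b)) u) v)"

definition lft_mu :: "(('x \<times> 'x \<Rightarrow> complex) \<Rightarrow> ('x \<Rightarrow> complex)) \<Rightarrow> ('x \<times> 'x \<times> 'x \<Rightarrow> complex)
    \<Rightarrow> ('x \<times> 'x \<Rightarrow> complex)" where
  "lft_mu m F = (\<lambda>(z,c). m (\<lambda>(x,y). F (x,y,c)) z)"

definition rgt_mu :: "(('x \<times> 'x \<Rightarrow> complex) \<Rightarrow> ('x \<Rightarrow> complex)) \<Rightarrow> ('x \<times> 'x \<times> 'x \<Rightarrow> complex)
    \<Rightarrow> ('x \<times> 'x \<Rightarrow> complex)" where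
  "rgt_mu m F = (\<lambda>(a,z). m (\<lambda>(y,c). F (a,y,c)) z)"

definition lft_D :: "(('x \<Rightarrow> complex) \<Rightarrow> ('x \<times> 'x \<Rightarrow> complex)) \<Rightarrow> ('x \<times> 'x \<Rightarrow> complex)
    \<Rightarrow> ('x \<times> 'x \<times> 'x \<Rightarrow> complex)" where
  "lft_D D G = (\<lambda>(a,b,c). D (\<lambda>z. G (z,c)) (a,b))"

definition rgt_D :: "(('x \<Rightarrow> complex) \<Rightarrow> ('x \<times> 'x \<Rightarrow> complex)) \<Rightarrow> ('x \<times> 'x \<Rightarrow> complex)
    \<Rightarrow> ('x \<times> 'x \<times> 'x \<Rightarrow> complex)" where
  "rgt_D D G = (\<lambda>(a,b,c). D (\<lambda>z. G (a,z)) (b,c))"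

text \<open>Graded connected Hopf algebra H = (+)_n A n over C, given by its graded components:
  mu i j : A i (x) A j -> A (i+j),  Delta k l : A (k+l) -> A k (x) A l,
  unit u (in degree 0), counit eps (on degree 0; zero in positive degrees).\<close>

definition graded_connected_hopf ::
  "(nat \<Rightarrow> ('x \<Rightarrow> complex) set)
   \<Rightarrow> (nat \<Rightarrow> nat \<Rightarrow> ('x \<times> 'x \<Rightarrow> complex) \<Rightarrow> ('x \<Rightarrow> complex))
   \<Rightarrow> (nat \<Rightarrow> nat \<Rightarrow> ('x \<Rightarrow> complex) \<Rightarrow> ('x \<times> 'x \<Rightarrow> complex))
   \<Rightarrow> ('x \<Rightarrow> complex) \<Rightarrow> (('x \<Rightarrow> complex) \<Rightarrow> complex) \<Rightarrow> bool" where
  "graded_connected_hopf A mu Delta u eps \<longleftrightarrow>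
     \<comment> \<open>graded vector space, well-defined linear structure maps\<close>
     (\<forall>n. subsp (A n)) \<and>
     (\<forall>i j. lin_on (tensor2 (A i) (A j)) (mu i j) \<and>
            (\<forall>F\<in>tensor2 (A i) (A j). mu i j F \<in> A (i+j))) \<and>
     (\<forall>k l. lin_on (A (k+l)) (Delta k l) \<and>
            (\<forall>f\<in>A (k+l). Delta k l f \<in> tensor2 (A k) (A l))) \<and>
     \<comment> \<open>connected: degree 0 is spanned by the unit\<close>
     u \<in> A 0 \<and> u \<noteq> (\<lambda>x. 0) \<and> (\<forall>f\<in>A 0. \<exists>c. f = (\<lambda>x. c * u x)) \<and>
     lin_on (A 0) (\<lambda>f. (\<lambda>_::unit. eps f)) \<and> eps u = 1 \<and>
     \<comment> \<open>associativity and unit\<close>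
     (\<forall>i j k. \<forall>F\<in>tensor3 (A i) (A j) (A k).
        mu (i+j) k (lft_mu (mu i j) F) = mu i (j+k) (rgt_mu (mu j k) F)) \<and>
     (\<forall>n. \<forall>f\<in>A n. mu 0 n (\<lambda>(x,y). u x * f y) = f \<and> mu n 0 (\<lambda>(x,y). f x * u y) = f) \<and>
     \<comment> \<open>coassociativity and counit\<close>
     (\<forall>i j k. \<forall>f\<in>A (i+j+k).
        lft_D (Delta i j) (Delta (i+j) k f) = rgt_D (Delta j k) (Delta i (j+k) f)) \<and>
     (\<forall>n. \<forall>f\<in>A n. (\<lambda>y. eps (\<lambda>x. Delta 0 n f (x,y))) = f \<and>
                   (\<lambda>x. eps (\<lambda>y. Delta n 0 f (x,y))) = f) \<and>
     \<comment> \<open>bialgebra: Delta and eps are algebra maps\<close>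
     (\<forall>i j k l. i + j = k + l \<longrightarrow> (\<forall>F\<in>tensor2 (A i) (A j).
        Delta k l (mu i j F) =
          (\<lambda>(X,Y). \<Sum>a\<in>{a. a \<le> i \<and> a \<le> k \<and> k - a \<le> j}.
             mu (i - a) (j - (k - a))
               (\<lambda>(r,s). mu a (k - a)
                  (\<lambda>(p,q). Delta (k - a) (j - (k - a))
                      (\<lambda>y. Delta a (i - a) (\<lambda>x. F (x,y)) (p,r)) (q,s)) X) Y))) \<and>
     Delta 0 0 u = (\<lambda>(x,y). u x * u y) \<and>
     (\<forall>F\<in>tensor2 (A 0) (A 0). eps (mu 0 0 F) = eps (\<lambda>y. eps (\<lambda>x. F (x,y)))) \<and>
     \<comment> \<open>antipode\<close>
     (\<exists>S. \<forall>n. lin_on (A n) (S n) \<and> (\<forall>f\<in>A n. S n f \<in> A n) \<and>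
        (\<forall>f\<in>A n.
          (\<lambda>z. \<Sum>k\<le>n. mu k (n-k) (tmap (S k) (\<lambda>g. g) (Delta k (n-k) f)) z)
             = (\<lambda>z. (if n = 0 then eps f else 0) * u z) \<and>
          (\<lambda>z. \<Sum>k\<le>n. mu k (n-k) (tmap (\<lambda>g. g) (S (n-k)) (Delta k (n-k) f)) z)
             = (\<lambda>z. (if n = 0 then eps f else 0) * u z)))"

text \<open>Matrices with rows/columns indexed by a finite set S of naturals are functions
nat => nat => 'a vanishing outside S x S.\<close>
type_synonym 'a mat = "nat \<Rightarrow> nat \<Rightarrow> 'a"

definition mmul :: "nat set \<Rightarrow> 'a::field mat \<Rightarrow> 'a mat \<Rightarrow> 'a mat" where
  "mmul S g h = (\<lambda>i j. \<Sum>k\<in>S. g i k * h k j)"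

definition idm :: "nat set \<Rightarrow> 'a::field mat" where
  "idm S = (\<lambda>i j. if i = j \<and> i \<in> S then 1 else 0)"

definition supp_in :: "nat set \<Rightarrow> 'a::field mat \<Rightarrow> bool" where
  "supp_in S X \<longleftrightarrow> (\<forall>i j. i \<notin> S \<or> j \<notin> S \<longrightarrow> X i j = 0)"

definition UTo :: "nat set \<Rightarrow> (nat \<times> nat) set \<Rightarrow> 'a::field mat set" where
  "UTo S \<tau> = {X. supp_in S X \<and> (\<forall>i\<in>S. \<forall>j\<in>S. X i j - idm S i j \<noteq> 0 \<longrightarrow> (i,j) \<in> \<tau>) \<and>
      (\<exists>Y. supp_in S Y \<and> mmul S X Y = idm S \<and> mmul S Y X = idm S)}"

definition std_ord :: "nat \<Rightarrow> (nat \<times> nat) set" where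
  "std_ord n = {(i,j). i \<in> {1..n} \<and> j \<in> {1..n} \<and> i < j}"

definition UT :: "nat \<Rightarrow> 'a::field mat set" where
  "UT n = UTo {1..n} (std_ord n)"

definition UL :: "nat \<Rightarrow> nat set \<Rightarrow> 'a::field mat set" where
  "UL n I = {g\<in>UT n. \<forall>i\<in>{1..n}. \<forall>j\<in>{1..n}. g i j - idm {1..n} i j \<noteq> 0 \<longrightarrow>
       (i,j) \<in> I \<times> I \<union> ({1..n} - I) \<times> ({1..n} - I)}"

definition UR :: "nat \<Rightarrow> nat set \<Rightarrow> 'a::field mat set" where
  "UR n I = {g\<in>UT n. \<forall>i\<in>{1..n}. \<forall>j\<in>{1..n}. g i j - idm {1..n} i j \<noteq> 0 \<longrightarrow>
       (i,j) \<in> I \<times> ({1..n} - I)}"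

definition UP :: "nat \<Rightarrow> nat set \<Rightarrow> 'a::field mat set" where
  "UP n I = {g\<in>UT n. \<forall>i\<in>{1..n} - I. \<forall>j\<in>I. g i j - idm {1..n} i j = 0}"

definition cf_of :: "'a::field mat set \<Rightarrow> nat set \<Rightarrow> ('a mat \<Rightarrow> complex) \<Rightarrow> bool" where
  "cf_of G S f \<longleftrightarrow> (\<forall>x. x \<notin> G \<longrightarrow> f x = 0) \<and>
     (\<forall>g\<in>G. \<forall>h\<in>G. \<forall>h'\<in>G. mmul S h h' = idm S \<longrightarrow> f (mmul S (mmul S h g) h') = f g)"

definition cfUT :: "nat \<Rightarrow> ('a::field mat \<Rightarrow> complex) set" where
  "cfUT n = {f. cf_of (UT n) {1..n} f}"

definition Infl :: "nat set \<Rightarrow> 'a::field mat set \<Rightarrow> 'a mat set \<Rightarrow> 'a mat set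
    \<Rightarrow> ('a mat \<Rightarrow> complex) \<Rightarrow> ('a mat \<Rightarrow> complex)" where
  "Infl S G L N \<psi> = (\<lambda>g. if g \<in> G then \<psi> (THE l. l \<in> L \<and> (\<exists>r\<in>N. g = mmul S l r)) else 0)"

definition Restr :: "'a mat set \<Rightarrow> ('a mat \<Rightarrow> complex) \<Rightarrow> ('a mat \<Rightarrow> complex)" where
  "Restr H \<psi> = (\<lambda>g. if g \<in> H then \<psi> g else 0)"

definition Defl :: "nat set \<Rightarrow> 'a::field mat set \<Rightarrow> 'a mat set
    \<Rightarrow> ('a mat \<Rightarrow> complex) \<Rightarrow> ('a mat \<Rightarrow> complex)" where
  "Defl S L N \<psi> = (\<lambda>g. if g \<in> L then (\<Sum>x\<in>N. \<psi> (mmul S g x)) / of_nat (card N) else 0)"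

definition cano :: "nat set \<Rightarrow> nat \<Rightarrow> nat" where
  "cano I i = card {k\<in>I. k \<le> i}"

definition canoinv :: "nat set \<Rightarrow> nat \<Rightarrow> nat" where
  "canoinv I r = sorted_list_of_set I ! (r - 1)"

text \<open>The isomorphism UT_{|I|} x UT_{|I^c|} -> UL_I (entries placed via cano^{-1}).\<close>
definition emb :: "nat \<Rightarrow> nat set \<Rightarrow> 'a::field mat \<Rightarrow> 'a mat \<Rightarrow> 'a mat" where
  "emb n I g1 g2 = (\<lambda>i j.
     if i \<in> I \<and> j \<in> I then g1 (cano I i) (cano I j)
     else if i \<in> {1..n} - I \<and> j \<in> {1..n} - I
       then g2 (cano ({1..n} - I) i) (cano ({1..n} - I) j)
     else 0)"

text \<open>The I-block of a matrix, relabelled to [|I|] (inverse of emb componentwise).\<close>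
definition blk :: "nat set \<Rightarrow> 'a::field mat \<Rightarrow> 'a mat" where
  "blk I l = (\<lambda>r s. if r \<in> {1..card I} \<and> s \<in> {1..card I}
                    then l (canoinv I r) (canoinv I s) else 0)"

definition stUT :: "nat \<Rightarrow> nat set \<Rightarrow> ('a::field mat \<Rightarrow> complex) \<Rightarrow> ('a mat \<times> 'a mat \<Rightarrow> complex)" where
  "stUT n I \<psi> = (\<lambda>(g1,g2). if g1 \<in> UT (card I) \<and> g2 \<in> UT (n - card I)
                            then \<psi> (emb n I g1 g2) else 0)"

definition stinvUT :: "nat \<Rightarrow> nat set \<Rightarrow> ('a::field mat \<times> 'a mat \<Rightarrow> complex) \<Rightarrow> ('a mat \<Rightarrow> complex)" where
  "stinvUT n I F = (\<lambda>l. if l \<in> UL n I then F (blk I l, blk ({1..n} - I) l) else 0)"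

definition muUT :: "nat \<Rightarrow> nat \<Rightarrow> ('a::field mat \<times> 'a mat \<Rightarrow> complex) \<Rightarrow> ('a mat \<Rightarrow> complex)" where
  "muUT i j F = Infl {1..i+j} (UT (i+j)) (UL (i+j) {1..i}) (UR (i+j) {1..i})
                  (stinvUT (i+j) {1..i} F)"

definition DeltaUT :: "nat \<Rightarrow> nat \<Rightarrow> ('a::field mat \<Rightarrow> complex) \<Rightarrow> ('a mat \<times> 'a mat \<Rightarrow> complex)" where
  "DeltaUT k l f = (\<lambda>p. \<Sum>I\<in>{I. I \<subseteq> {1..k+l} \<and> card I = k}.
       stUT (k+l) I (Defl {1..k+l} (UL (k+l) I) (UR (k+l) I) (Restr (UP (k+l) I) f)) p)"

definition uUT :: "'a::field mat \<Rightarrow> complex" where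
  "uUT = (\<lambda>g. if g \<in> UT 0 then 1 else 0)"

definition epsUT :: "('a::field mat \<Rightarrow> complex) \<Rightarrow> complex" where
  "epsUT f = f (idm {})"

definition sord :: "nat set \<Rightarrow> (nat \<times> nat) set \<Rightarrow> bool" where
  "sord S \<tau> \<longleftrightarrow> strict_linear_order_on S \<tau> \<and> \<tau> \<subseteq> S \<times> S"

definition relab :: "(nat \<Rightarrow> nat) \<Rightarrow> (nat \<times> nat) set \<Rightarrow> (nat \<times> nat) set" where
  "relab f \<tau> = (\<lambda>(a,b). (f a, f b)) ` \<tau>"

type_synonym 'a omat = "(nat \<times> nat) set \<times> 'a mat"

text \<open>cf[[n]] = (+)_{tau total order on [n]} cf(UT(tau)), an element being the function
(tau, X) |-> v_tau(X).\<close>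
definition Rsp :: "nat \<Rightarrow> ('a::field omat \<Rightarrow> complex) set" where
  "Rsp n = {v. (\<forall>\<tau> X. \<not> sord {1..n} \<tau> \<longrightarrow> v (\<tau>, X) = 0) \<and>
              (\<forall>\<tau>. sord {1..n} \<tau> \<longrightarrow> cf_of (UTo {1..n} \<tau>) {1..n} (\<lambda>X. v (\<tau>, X)))}"

text \<open>cf[sigma] v : psi |-> psi o sigma^{-1}, moving the tau-summand to the sigma(tau)-summand.\<close>
definition act :: "(nat \<Rightarrow> nat) \<Rightarrow> ('a::field omat \<Rightarrow> complex) \<Rightarrow> ('a omat \<Rightarrow> complex)" where
  "act \<sigma> v = (\<lambda>(\<tau>, Y). v ({(a,b). (\<sigma> a, \<sigma> b) \<in> \<tau>}, (\<lambda>i j. Y (\<sigma> i) (\<sigma> j))))"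

text \<open>The span of {v - cf[sigma] v}; the coinvariants are Rsp n modulo this subspace.\<close>
definition relK :: "nat \<Rightarrow> ('a::field omat \<Rightarrow> complex) set" where
  "relK n = {w. \<exists>(m::nat) vs \<sigma>s. (\<forall>k<m. vs k \<in> Rsp n \<and> \<sigma>s k permutes {1..n}) \<and>
       w = (\<lambda>p. \<Sum>k<m. vs k p - act (\<sigma>s k) (vs k) p)}"

text \<open>Product of the Fock functor on representatives:
 mu_{([i],[i]^c)} o st^{-1}_{([i],[i]^c)} : cf[[i]] (x) cf[[j]] -> cf[[i+j]].\<close>
definition muK :: "nat \<Rightarrow> nat \<Rightarrow> ('a::field omat \<times> 'a omat \<Rightarrow> complex) \<Rightarrow> ('a omat \<Rightarrow> complex)" where
  "muK i j F = (\<lambda>(\<tau>, X).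
     (let S = {1..i}; T = {i+1..i+j} in
      \<Sum>(\<tau>1,\<tau>2)\<in>{(\<tau>1,\<tau>2). sord {1..i} \<tau>1 \<and> sord {1..j} \<tau>2 \<and>
                         \<tau> = \<tau>1 \<union> relab (canoinv T) \<tau>2 \<union> S \<times> T}.
        Infl {1..i+j} (UTo {1..i+j} \<tau>)
          {Z\<in>UTo {1..i+j} \<tau>. \<forall>a b. a \<noteq> b \<and> Z a b \<noteq> 0 \<longrightarrow> (a,b) \<in> S \<times> S \<union> T \<times> T}
          {Z\<in>UTo {1..i+j} \<tau>. \<forall>a b. a \<noteq> b \<and> Z a b \<noteq> 0 \<longrightarrow> (a,b) \<in> S \<times> T}
          (\<lambda>l. F ((\<tau>1, blk S l), (\<tau>2, blk T l))) X))"

definition DeltaMon :: "nat \<Rightarrow> (nat \<times> nat) set \<Rightarrow> nat set \<Rightarrow> nat set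
    \<Rightarrow> ('a::field mat \<Rightarrow> complex) \<Rightarrow> ('a mat \<Rightarrow> complex)" where
  "DeltaMon n \<phi> S T \<psi> =
     Defl {1..n}
       {Z\<in>UTo {1..n} \<phi>. \<forall>a b. a \<noteq> b \<and> Z a b \<noteq> 0 \<longrightarrow> (a,b) \<in> S \<times> S \<union> T \<times> T}
       {Z\<in>UTo {1..n} \<phi>. \<forall>a b. a \<noteq> b \<and> Z a b \<noteq> 0 \<longrightarrow> (a,b) \<in> \<phi> \<inter> (S \<times> T)}
       (Restr {Z\<in>UTo {1..n} \<phi>. \<forall>a\<in>T. \<forall>b\<in>S. Z a b = 0} \<psi>)"

text \<open>Coproduct of the Fock functor on representatives:
 sum_{I subset [n], |I| = k} st_{(I,I^c)} o Delta_{(I,I^c)} : cf[[k+l]] -> cf[[k]] (x) cf[[l]].\<close>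
definition DeltaK :: "nat \<Rightarrow> nat \<Rightarrow> ('a::field omat \<Rightarrow> complex) \<Rightarrow> ('a omat \<times> 'a omat \<Rightarrow> complex)" where
  "DeltaK k l v = (\<lambda>((\<tau>1, x), (\<tau>2, y)).
     \<Sum>I\<in>{I. I \<subseteq> {1..k+l} \<and> card I = k}.
       \<Sum>\<phi>\<in>{\<phi>. sord {1..k+l} \<phi> \<and> relab (cano I) (\<phi> \<inter> I \<times> I) = \<tau>1 \<and>
               relab (cano ({1..k+l} - I)) (\<phi> \<inter> ({1..k+l} - I) \<times> ({1..k+l} - I)) = \<tau>2}.
         (if x \<in> UTo {1..k} \<tau>1 \<and> y \<in> UTo {1..l} \<tau>2
          then DeltaMon (k+l) \<phi> I ({1..k+l} - I) (\<lambda>X. v (\<phi>, X)) (emb (k+l) I x y)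
          else 0))"

definition uK :: "'a::field omat \<Rightarrow> complex" where
  "uK = (\<lambda>(\<tau>, X). if \<tau> = {} \<and> X = idm {} then 1 else 0)"

definition epsK :: "('a::field omat \<Rightarrow> complex) \<Rightarrow> complex" where
  "epsK v = v ({}, idm {})"

text \<open>Phi induces a graded isomorphism of Hopf algebras from Kbar(h) = (+)_n (R n)_{S_n}
(coinvariants = R n modulo rel n) onto (+)_n A n: each Phi n is linear, onto A n, with
kernel exactly rel n, and the induced maps intertwine units, counits, products, coproducts.\<close>
definition fock_iso ::
  "(nat \<Rightarrow> ('y \<Rightarrow> complex) set) \<Rightarrow> (nat \<Rightarrow> ('y \<Rightarrow> complex) set)
   \<Rightarrow> (nat \<Rightarrow> nat \<Rightarrow> ('y \<times> 'y \<Rightarrow> complex) \<Rightarrow> ('y \<Rightarrow> complex))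
   \<Rightarrow> (nat \<Rightarrow> nat \<Rightarrow> ('y \<Rightarrow> complex) \<Rightarrow> ('y \<times> 'y \<Rightarrow> complex))
   \<Rightarrow> ('y \<Rightarrow> complex) \<Rightarrow> (('y \<Rightarrow> complex) \<Rightarrow> complex)
   \<Rightarrow> (nat \<Rightarrow> ('x \<Rightarrow> complex) set)
   \<Rightarrow> (nat \<Rightarrow> nat \<Rightarrow> ('x \<times> 'x \<Rightarrow> complex) \<Rightarrow> ('x \<Rightarrow> complex))
   \<Rightarrow> (nat \<Rightarrow> nat \<Rightarrow> ('x \<Rightarrow> complex) \<Rightarrow> ('x \<times> 'x \<Rightarrow> complex))
   \<Rightarrow> ('x \<Rightarrow> complex) \<Rightarrow> (('x \<Rightarrow> complex) \<Rightarrow> complex)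
   \<Rightarrow> (nat \<Rightarrow> ('y \<Rightarrow> complex) \<Rightarrow> ('x \<Rightarrow> complex)) \<Rightarrow> bool" where
  "fock_iso R rel muR DeltaR uR epsR A mu Delta u eps \<Phi> \<longleftrightarrow>
     (\<forall>n. lin_on (R n) (\<Phi> n) \<and> \<Phi> n ` R n = A n \<and>
          (\<forall>v\<in>R n. \<Phi> n v = (\<lambda>x. 0) \<longleftrightarrow> v \<in> rel n)) \<and>
     \<Phi> 0 uR = u \<and> (\<forall>v\<in>R 0. eps (\<Phi> 0 v) = epsR v) \<and>
     (\<forall>i j. \<forall>F\<in>tensor2 (R i) (R j). \<Phi> (i+j) (muR i j F) = mu i j (tmap (\<Phi> i) (\<Phi> j) F)) \<and>
     (\<forall>k l. \<forall>v\<in>R (k+l). tmap (\<Phi> k) (\<Phi> l) (DeltaR k l v) = Delta k l (\<Phi> (k+l) v))"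

end

theory Submission
  imports Defs
begin

text \<open>For \<open>I \<subseteq> {1..n}\<close>, the summand of the coproduct indexed by \<open>I\<close>, evaluated at \<open>(x, y)\<close>, is the average of
  \<open>f\<close> over all unitriangular matrices that vanish on \<open>I\<^sup>c \<times> I\<close> and have diagonal blocks \<open>x\<close> on \<open>I\<close> and \<open>y\<close> on
  \<open>I\<^sup>c\<close>; the product evaluates its argument at the two diagonal blocks.  Coassociativity and
  compatibility with the product then say that averaging over a finite affine space may be
  carried out along the fibres of an affine map.  A graded connected bialgebra has an antipode,
  given by recursion on the degree.  For the Fock functor, every total order of \<open>{1..n}\<close> is carried to
  the standard one by a unique permutation; adding up the components of a vector after this
  relabelling has kernel exactly the coinvariance relations, and it commutes with passing to diagonal
  blocks because restricting an order and then ranking agrees with ranking first.\<close>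

text \<open>Deflation divides by the order of the radical, so iterating it gives the right
  normalisation as soon as the fibres of the map that forgets part of a matrix are equinumerous.
  They are, because every set averaged over is affine: over a finite field membership in
  \<open>UTo\<close> amounts to prescribing the entries off the order, and the further conditions
  (vanishing entries, prescribed blocks) are affine in the entries. Associativity, coassociativity,
  compatibility and the intertwining properties of the isomorphism are proved as identities between
  arbitrary functions on matrices; conjugation invariance serves to show that the maps land in the
  correct spaces. For the coproduct this means exhibiting a finite sum of pure tensors, since tensor
  products are modelled as spans of such. The product and coproduct of the Fock functor use the same
  subgroups for other total orders, so Levi part, radical and parabolic are treated once for every
  order.\<close>

declare One_nat_def [simp del]

section \<open>Averages over finite sets\<close>

text \<open>Division by zero being 0, the average over an empty set is 0; formulas for iterated
  averages thus include empty fibres.\<close>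

definition avg :: "'b set \<Rightarrow> ('b \<Rightarrow> complex) \<Rightarrow> complex" where
  "avg A f = (\<Sum>x\<in>A. f x) / of_nat (card A)"

lemma avg_cong: "A = B \<Longrightarrow> (\<And>x. x \<in> B \<Longrightarrow> f x = g x) \<Longrightarrow> avg A f = avg B g"
  by (simp add: avg_def)

lemma avg_bij_betw: "bij_betw g A B \<Longrightarrow> avg B f = avg A (\<lambda>x. f (g x))"
  by (simp add: avg_def bij_betw_same_card sum.reindex_bij_betw)

lemma avg_lincomb: "avg A (\<lambda>x. c * f x + d * g x) = c * avg A f + d * avg A g"
  by (simp add: avg_def sum.distrib sum_distrib_left add_divide_distrib)

lemma avg_sum: "avg A (\<lambda>x. \<Sum>i\<in>I. f i x) = (\<Sum>i\<in>I. avg A (f i))"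
  unfolding avg_def by (subst sum.swap) (simp add: sum_divide_distrib)

lemma avg_singleton [simp]: "avg {x} f = f x"
  by (simp add: avg_def)

lemma avg_const: "finite A \<Longrightarrow> A \<noteq> {} \<Longrightarrow> avg A (\<lambda>_. c) = c"
  by (simp add: avg_def)

lemma avg_Times: "avg (A \<times> B) f = avg A (\<lambda>a. avg B (\<lambda>b. f (a, b)))"
  by (simp add: avg_def sum.cartesian_product' card_cartesian_product sum_divide_distrib mult.commute)

text \<open>If all fibres have \<open>c\<close> elements, then \<open>card H\<close> is
  \<open>c\<close> times the number of fibres, so the inner and outer normalisations multiply to the
  correct one.\<close>

lemma avg_fibres:
  assumes fin: "finite H"
    and card: "\<And>p q. p \<in> f ` H \<Longrightarrow> q \<in> f ` H \<Longrightarrow> card {h\<in>H. f h = p} = card {h\<in>H. f h = q}"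
  shows "avg H F = avg (f ` H) (\<lambda>p. avg {h\<in>H. f h = p} F)"
proof (cases "H = {}")
  case True
  then show ?thesis by (simp add: avg_def)
next
  case False
  then obtain h0 where h0: "h0 \<in> H" by auto
  define c where "c = card {h\<in>H. f h = f h0}"
  have c: "card {h\<in>H. f h = p} = c" if "p \<in> f ` H" for p
    using card[OF that] h0 by (auto simp: c_def)
  have "card H = (\<Sum>p\<in>f ` H. card {h\<in>H. f h = p})"
    using sum.image_gen[OF fin, of "\<lambda>_. 1::nat" f] by simp
  also have "\<dots> = card (f ` H) * c" using c by simp
  finally have cH: "card H = card (f ` H) * c" .
  have "avg (f ` H) (\<lambda>p. avg {h\<in>H. f h = p} F) =
      (\<Sum>p\<in>f ` H. (\<Sum>h\<in>{h\<in>H. f h = p}. F h) / of_nat c) / of_nat (card (f ` H))"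
    unfolding avg_def by (simp add: c)
  also have "\<dots> = (\<Sum>p\<in>f ` H. \<Sum>h\<in>{h\<in>H. f h = p}. F h) / of_nat (card H)"
    by (simp add: cH sum_divide_distrib[symmetric] mult.commute)
  also have "\<dots> = avg H F"
    using sum.image_gen[OF fin, of F f] by (simp add: avg_def)
  finally show ?thesis by simp
qed

text \<open>The fibres of an affine map on a finite affine space are translates of each other, hence
  equinumerous.\<close>

definition affcomb :: "'a::field mat \<Rightarrow> 'a mat \<Rightarrow> 'a mat \<Rightarrow> 'a mat" where
  "affcomb x y z = (\<lambda>i j. x i j - y i j + z i j)"

text \<open>Affineness of \<open>f\<close> is expressed through its kernel pairs: if
  \<open>f\<close> agrees at \<open>x\<close> and \<open>y\<close>, then translating
  \<open>z\<close> by \<open>x - y\<close> does not change its value. This form asks no linear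
  structure of the codomain, which is later a set of pairs of matrices.\<close>

lemma avg_fibres_affine:
  fixes H :: "'a::field mat set"
  assumes fin: "finite H"
    and aff: "\<And>x y z. x \<in> H \<Longrightarrow> y \<in> H \<Longrightarrow> z \<in> H \<Longrightarrow> affcomb x y z \<in> H"
    and f: "\<And>x y z. x \<in> H \<Longrightarrow> y \<in> H \<Longrightarrow> z \<in> H \<Longrightarrow> f x = f y \<Longrightarrow> f (affcomb x y z) = f z"
  shows "avg H F = avg (f ` H) (\<lambda>p. avg {h\<in>H. f h = p} F)"
proof (rule avg_fibres[OF fin])
  have le: "card {h\<in>H. f h = p} \<le> card {h\<in>H. f h = q}" if p: "p \<in> f ` H" and q: "q \<in> f ` H" for p q
  proof -
    obtain a b where ab: "a \<in> H" "b \<in> H" "p = f a" "q = f b" using p q by auto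
    \<comment> \<open>Translation by \<open>b - a\<close> maps the fibre through \<open>a\<close>
      into the fibre through \<open>b\<close>.\<close>
    have "inj (\<lambda>x. affcomb x a b)"
      by (rule injI) (simp add: affcomb_def fun_eq_iff)
    then have "inj_on (\<lambda>x. affcomb x a b) {h\<in>H. f h = p}" by (rule inj_on_subset) simp
    then show ?thesis
      by (rule card_inj_on_le) (use ab aff f fin in auto)
  qed
  show "card {h\<in>H. f h = p} = card {h\<in>H. f h = q}" if "p \<in> f ` H" "q \<in> f ` H" for p q
    using le[OF that] le[OF that(2,1)] by simp
qed

lemma avg_pushforward:
  fixes H :: "'a::field mat set"
  assumes fin: "finite H"
    and aff: "\<And>x y z. x \<in> H \<Longrightarrow> y \<in> H \<Longrightarrow> z \<in> H \<Longrightarrow> affcomb x y z \<in> H"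
    and f: "\<And>x y z. x \<in> H \<Longrightarrow> y \<in> H \<Longrightarrow> z \<in> H \<Longrightarrow> f x = f y \<Longrightarrow> f (affcomb x y z) = f z"
  shows "avg H (\<lambda>h. F (f h)) = avg (f ` H) F"
proof -
  have "avg H (\<lambda>h. F (f h)) = avg (f ` H) (\<lambda>p. avg {h\<in>H. f h = p} (\<lambda>h. F (f h)))"
    by (rule avg_fibres_affine[OF assms])
  also have "\<dots> = avg (f ` H) F"
  proof (rule avg_cong[OF refl])
    fix p assume p: "p \<in> f ` H"
    have "avg {h\<in>H. f h = p} (\<lambda>h. F (f h)) = avg {h\<in>H. f h = p} (\<lambda>h. F p)"
      by (rule avg_cong) auto
    then show "avg {h\<in>H. f h = p} (\<lambda>h. F (f h)) = F p"
      using p fin by (subst (asm) avg_const) auto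
  qed
  finally show ?thesis .
qed

section \<open>Unitriangular groups of total orders\<close>

lemma sordD:
  assumes "sord S \<tau>"
  shows "\<tau> \<subseteq> S \<times> S" "trans \<tau>" "(i,i) \<notin> \<tau>" "i \<in> S \<Longrightarrow> j \<in> S \<Longrightarrow> i \<noteq> j \<Longrightarrow> (i,j) \<in> \<tau> \<or> (j,i) \<in> \<tau>"
    "(i,j) \<in> \<tau> \<Longrightarrow> (j,k) \<in> \<tau> \<Longrightarrow> (i,k) \<in> \<tau>" "(i,j) \<in> \<tau> \<Longrightarrow> (j,i) \<notin> \<tau>"
  using assms unfolding sord_def strict_linear_order_on_def
  by (auto simp: irrefl_def total_on_def dest: transD)

lemma sord_std_ord: "sord {1..n} (std_ord n)"
  unfolding sord_def strict_linear_order_on_def std_ord_def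
  by (auto simp: trans_def irrefl_def total_on_def)

lemma mmul_assoc: "finite S \<Longrightarrow> mmul S (mmul S X Y) Z = mmul S X (mmul S Y Z)"
  unfolding mmul_def
  by (auto simp: fun_eq_iff sum_distrib_left sum_distrib_right mult.assoc intro: sum.swap)

lemma mmul_idm_left: "finite S \<Longrightarrow> supp_in S X \<Longrightarrow> mmul S (idm S) X = X"
  unfolding mmul_def idm_def supp_in_def
  by (auto simp: fun_eq_iff if_distrib[where f="\<lambda>x. x * _"] sum.delta cong: if_cong conj_cong)

lemma mmul_idm_right:
  assumes "finite S" "supp_in S X"
  shows "mmul S X (idm S) = X"
proof (intro ext)
  fix i j
  have "mmul S X (idm S) i j = (\<Sum>k\<in>S. if k = j then X i k else 0)"
    unfolding mmul_def idm_def by (rule sum.cong) auto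
  also have "\<dots> = X i j" using assms by (auto simp: sum.delta supp_in_def)
  finally show "mmul S X (idm S) i j = X i j" .
qed

text \<open>One free field entry for each pair of \<tau>: this is the description of
  \<open>UTo\<close> with which all later computations work, see
  \<open>UTo_eq_unitri\<close>.\<close>

definition unitri :: "nat set \<Rightarrow> (nat \<times> nat) set \<Rightarrow> 'a::field mat set" where
  "unitri S \<tau> = {X. \<forall>i j. (i,j) \<notin> \<tau> \<longrightarrow> X i j = idm S i j}"

lemma finite_unitri:
  assumes "finite \<tau>"
  shows "finite (unitri S \<tau> :: 'a::{field,finite} mat set)"
proof -
  have "unitri S \<tau> \<subseteq> (\<lambda>f i j. if (i,j) \<in> \<tau> then f (i,j) else idm S i j) ` (PiE \<tau> (\<lambda>_. UNIV :: 'a set))"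
  proof
    fix X :: "'a mat" assume X: "X \<in> unitri S \<tau>"
    show "X \<in> (\<lambda>f i j. if (i,j) \<in> \<tau> then f (i,j) else idm S i j) ` (PiE \<tau> (\<lambda>_. UNIV :: 'a set))"
      by (rule image_eqI[where x="restrict (\<lambda>(i,j). X i j) \<tau>"])
        (use X in \<open>auto simp: unitri_def fun_eq_iff\<close>)
  qed
  then show ?thesis
    by (rule finite_subset) (intro finite_imageI finite_PiE assms finite)
qed

context
  fixes S :: "nat set" and \<tau>
  assumes fin: "finite S" and ord: "sord S \<tau>"
begin

lemma finite_ord: "finite \<tau>"
  using fin sordD(1)[OF ord] by (auto intro: finite_subset)


lemma unitri_nz: "X \<in> unitri S \<tau> \<Longrightarrow> X i j \<noteq> 0 \<Longrightarrow> i = j \<and> i \<in> S \<or> (i,j) \<in> \<tau>"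
  unfolding unitri_def idm_def by (smt (verit) mem_Collect_eq)

lemma unitri_supp: "X \<in> unitri S \<tau> \<Longrightarrow> supp_in S X"
  using sordD(1)[OF ord] unitri_nz[of X] unfolding supp_in_def by blast

lemma unitri_diag: "X \<in> unitri S \<tau> \<Longrightarrow> i \<in> S \<Longrightarrow> X i i = 1"
  using sordD(3)[OF ord] by (auto simp: unitri_def idm_def)

text \<open>Splitting off the diagonal entry 1 leaves rows of \<open>Y\<close> that come strictly
  later in \<tau>; this is the recursion behind cancellation.\<close>

lemma mmul_unitri_row:
  assumes "X \<in> unitri S \<tau>" "i \<in> S"
  shows "mmul S X Y i j = Y i j + (\<Sum>k\<in>{k. (i,k) \<in> \<tau>}. X i k * Y k j)"
proof -
  have sub: "{k. (i,k) \<in> \<tau>} \<subseteq> S - {i}" using sordD(1,3)[OF ord] by auto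
  have "mmul S X Y i j = X i i * Y i j + (\<Sum>k\<in>S-{i}. X i k * Y k j)"
    unfolding mmul_def using fin assms(2) by (simp add: sum.remove)
  also have "(\<Sum>k\<in>S-{i}. X i k * Y k j) = (\<Sum>k\<in>{k. (i,k) \<in> \<tau>}. X i k * Y k j)"
    by (rule sum.mono_neutral_right) (use fin sub unitri_nz[OF assms(1), of i] in auto)
  finally show ?thesis using unitri_diag[OF assms] by simp
qed

lemma mmul_unitri:
  assumes X: "X \<in> unitri S \<tau>" and Y: "Y \<in> unitri S \<tau>"
  shows "mmul S X Y \<in> unitri S \<tau>"
proof -
  have "mmul S X Y i j = idm S i j" if ij: "(i,j) \<notin> \<tau>" for i j
  proof (cases "i \<in> S")
    case True
    have "X i k * Y k j = 0" if "(i,k) \<in> \<tau>" for k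
    proof -
      have "\<not> (k = j \<and> k \<in> S \<or> (k,j) \<in> \<tau>)" using that ij sordD(5)[OF ord] by blast
      then have "Y k j = 0" using unitri_nz[OF Y] by blast
      then show ?thesis by simp
    qed
    then have "(\<Sum>k\<in>{k. (i,k) \<in> \<tau>}. X i k * Y k j) = 0" by (intro sum.neutral) auto
    then have "mmul S X Y i j = Y i j"
      using mmul_unitri_row[OF X True, of Y j] by simp
    then show ?thesis using Y ij by (simp add: unitri_def)
  next
    case False
    then have "X i k = 0" for k
      using unitri_supp[OF X] by (simp add: supp_in_def)
    then show ?thesis using False by (simp add: mmul_def idm_def)
  qed
  then show ?thesis by (simp add: unitri_def)
qed

text \<open>Back substitution: row \<open>i\<close> of \<open>Y\<close> is determined by row
  \<open>i\<close> of the product and by the rows after \<open>i\<close>, so the induction descends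
  along the converse of \<tau>, which is well-founded because \<tau> is finite and acyclic.\<close>

lemma mmul_unitri_cancel:
  assumes X: "X \<in> unitri S \<tau>" and Y: "Y \<in> unitri S \<tau>" and Z: "Z \<in> unitri S \<tau>"
    and eq: "mmul S X Y = mmul S X Z"
  shows "Y = Z"
proof -
  have "acyclic \<tau>" using sordD(2,3)[OF ord] by (simp add: acyclic_irrefl irrefl_def)
  then have wf: "wf (\<tau>\<inverse>)" using finite_ord by (simp add: finite_acyclic_wf_converse)
  have "\<forall>j. Y i j = Z i j" for i
  proof (induction i rule: wf_induct_rule[OF wf])
    case (1 i)
    show ?case
    proof (cases "i \<in> S")
      case True
      show ?thesis
      proof
        fix j
        have "(\<Sum>k\<in>{k. (i,k) \<in> \<tau>}. X i k * Y k j) = (\<Sum>k\<in>{k. (i,k) \<in> \<tau>}. X i k * Z k j)"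
          using 1 by (intro sum.cong) auto
        then show "Y i j = Z i j"
          using mmul_unitri_row[OF X True, of Y j] mmul_unitri_row[OF X True, of Z j] eq by simp
      qed
    next
      case False
      then show ?thesis using unitri_supp[OF Y] unitri_supp[OF Z] by (simp add: supp_in_def)
    qed
  qed
  then show ?thesis by (simp add: fun_eq_iff)
qed

lemma idm_unitri: "idm S \<in> unitri S \<tau>"
  by (simp add: unitri_def)

end

section \<open>Inverses over a finite field\<close>

context
  fixes S :: "nat set" and \<tau> and dummy :: "'a::{field,finite} itself"
  assumes fin: "finite S" and ord: "sord S \<tau>"
begin

text \<open>A finite cancellative monoid is a group.\<close>

lemma unitri_right_inverse:
  assumes X: "(X :: 'a mat) \<in> unitri S \<tau>"
  shows "\<exists>Y\<in>unitri S \<tau>. mmul S X Y = idm S"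
proof -
  have "inj_on (mmul S X) (unitri S \<tau>)"
    by (rule inj_onI) (rule mmul_unitri_cancel[OF fin ord X])
  then have "mmul S X ` unitri S \<tau> = unitri S \<tau>"
    by (intro endo_inj_surj finite_unitri finite_ord[OF fin ord])
      (auto intro: mmul_unitri[OF fin ord X])
  then show ?thesis using idm_unitri[OF fin ord, where 'a='a] by (metis imageE)
qed

lemma unitri_inverse:
  assumes X: "(X :: 'a mat) \<in> unitri S \<tau>"
  shows "\<exists>Y\<in>unitri S \<tau>. mmul S X Y = idm S \<and> mmul S Y X = idm S"
proof -
  obtain Y where Y: "Y \<in> unitri S \<tau>" "mmul S X Y = idm S" using unitri_right_inverse[OF X] by auto
  obtain Z where Z: "Z \<in> unitri S \<tau>" "mmul S Y Z = idm S" using unitri_right_inverse[OF Y(1)] by auto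
  have "X = mmul S X (mmul S Y Z)"
    using Z(2) mmul_idm_right[OF fin unitri_supp[OF fin ord X]] by simp
  also have "\<dots> = Z"
    using Y(2) mmul_idm_left[OF fin unitri_supp[OF fin ord Z(1)]] by (simp add: mmul_assoc[OF fin, symmetric])
  finally show ?thesis using Y Z by auto
qed

text \<open>The inverse demanded by \<open>UTo\<close> is supplied by \<open>unitri_inverse\<close>;
  membership becomes an entrywise, hence affine, condition.\<close>

lemma UTo_eq_unitri: "(UTo S \<tau> :: 'a mat set) = unitri S \<tau>"
proof (rule set_eqI)
  fix X :: "'a mat"
  have "(supp_in S X \<and> (\<forall>i\<in>S. \<forall>j\<in>S. X i j - idm S i j \<noteq> 0 \<longrightarrow> (i,j) \<in> \<tau>)) \<longleftrightarrow> X \<in> unitri S \<tau>"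
    using sordD(1)[OF ord] by (auto simp: supp_in_def unitri_def idm_def split: if_splits) blast+
  moreover have "\<exists>Y. supp_in S Y \<and> mmul S X Y = idm S \<and> mmul S Y X = idm S" if "X \<in> unitri S \<tau>"
    using unitri_inverse[OF that] unitri_supp[OF fin ord] by blast
  ultimately show "X \<in> UTo S \<tau> \<longleftrightarrow> X \<in> unitri S \<tau>" unfolding UTo_def by blast
qed

lemma finite_UTo: "finite (UTo S \<tau> :: 'a mat set)"
  by (simp add: UTo_eq_unitri finite_unitri finite_ord[OF fin ord])

lemma mmul_UTo: "(X :: 'a mat) \<in> UTo S \<tau> \<Longrightarrow> Y \<in> UTo S \<tau> \<Longrightarrow> mmul S X Y \<in> UTo S \<tau>"
  by (simp add: UTo_eq_unitri mmul_unitri[OF fin ord])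

lemma idm_UTo: "(idm S :: 'a mat) \<in> UTo S \<tau>"
  by (simp add: UTo_eq_unitri idm_unitri[OF fin ord])

lemma UTo_inverse:
  "(X :: 'a mat) \<in> UTo S \<tau> \<Longrightarrow> \<exists>Y\<in>UTo S \<tau>. mmul S X Y = idm S \<and> mmul S Y X = idm S"
  by (simp add: UTo_eq_unitri unitri_inverse)

lemma UTo_supp: "(X :: 'a mat) \<in> UTo S \<tau> \<Longrightarrow> supp_in S X"
  by (simp add: UTo_def)

lemma UTo_affcomb:
  "(X :: 'a mat) \<in> UTo S \<tau> \<Longrightarrow> Y \<in> UTo S \<tau> \<Longrightarrow> Z \<in> UTo S \<tau> \<Longrightarrow> affcomb X Y Z \<in> UTo S \<tau>"
  by (simp add: UTo_eq_unitri unitri_def affcomb_def)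

end

section \<open>Blocks of matrices\<close>

lemma canoinv_bij_betw:
  assumes "finite I"
  shows "bij_betw (canoinv I) {1..card I} I"
proof -
  have 1: "bij_betw (\<lambda>r. r - 1) {1..card I} {..<card I}"
    by (rule bij_betw_byWitness[where f'=Suc]) auto
  have 2: "bij_betw ((!) (sorted_list_of_set I)) {..<card I} I"
    by (rule bij_betw_nth) (use assms in auto)
  show ?thesis using bij_betw_trans[OF 1 2] by (simp add: canoinv_def comp_def cong: bij_betw_cong)
qed

lemma canoinv_in: "finite I \<Longrightarrow> r \<in> {1..card I} \<Longrightarrow> canoinv I r \<in> I"
  using canoinv_bij_betw bij_betwE by blast

lemma canoinv_less:
  assumes "finite I" "r < s" "1 \<le> r" "s \<le> card I"
  shows "canoinv I r < canoinv I s"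
  unfolding canoinv_def
  by (rule sorted_wrt_nth_less[OF strict_sorted_list_of_set]) (use assms in auto)

text \<open>For an increasing enumeration \<open>f\<close> of \<open>K\<close>, the elements of
  \<open>K\<close> up to \<open>f r\<close> are exactly the first \<open>r\<close> values of
  \<open>f\<close>.\<close>

lemma cano_strict_mono:
  assumes f: "\<And>r s. r < s \<Longrightarrow> 1 \<le> r \<Longrightarrow> s \<le> m \<Longrightarrow> f r < f s"
    and K: "f ` {1..m} = K" and r: "r \<in> {1..m}"
  shows "cano K (f r) = r"
proof -
  have le: "f s \<le> f r \<longleftrightarrow> s \<le> r" if "s \<in> {1..m}" for s
    using f[of s r] f[of r s] r that by (metis atLeastAtMost_iff leD leI nat_less_le)
  have "{k\<in>K. k \<le> f r} = f ` {1..r}"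
    unfolding K[symmetric] using le r by (auto simp: image_iff)
  moreover have "inj_on f {1..r}"
    using f r by (intro linorder_inj_onI) (auto, fastforce)
  ultimately show ?thesis by (simp add: cano_def card_image)
qed

lemma cano_canoinv: "finite I \<Longrightarrow> r \<in> {1..card I} \<Longrightarrow> cano I (canoinv I r) = r"
  by (rule cano_strict_mono[where f="canoinv I" and m="card I"])
    (simp_all only: canoinv_less bij_betw_imp_surj_on[OF canoinv_bij_betw])

lemma cano_in: "finite I \<Longrightarrow> a \<in> I \<Longrightarrow> cano I a \<in> {1..card I}"
  using canoinv_bij_betw[of I] cano_canoinv[of I] by (metis bij_betw_imp_surj_on imageE)

lemma canoinv_cano: "finite I \<Longrightarrow> a \<in> I \<Longrightarrow> canoinv I (cano I a) = a"
  using canoinv_bij_betw[of I] cano_canoinv[of I] by (metis bij_betw_imp_surj_on imageE)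

text \<open>Increasing enumerations are unique. Every later formula for \<open>canoinv\<close> of an
  interval, an image or a union is obtained by exhibiting one.\<close>

lemma canoinv_unique:
  assumes f: "\<And>r s. r < s \<Longrightarrow> 1 \<le> r \<Longrightarrow> s \<le> m \<Longrightarrow> f r < f s"
    and K: "f ` {1..m} = K" and r: "r \<in> {1..m}"
  shows "canoinv K r = f r"
  using cano_strict_mono[OF assms] canoinv_cano[of K "f r"] K r by auto

lemma canoinv_atLeastAtMost: "r \<in> {1..j} \<Longrightarrow> canoinv {i+1..i+j} r = i + r"
  by (rule canoinv_unique[where m=j]) (auto simp: image_add_atLeastAtMost)

lemma canoinv_from_1: "r \<in> {1..j} \<Longrightarrow> canoinv {1..j} r = r"
  using canoinv_atLeastAtMost[of r j 0] by simp

lemma canoinv_image: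
  assumes K: "finite K" and J: "J \<subseteq> {1..card K}" and r: "r \<in> {1..card J}"
  shows "canoinv (canoinv K ` J) r = canoinv K (canoinv J r)"
proof (rule canoinv_unique[where m="card J"])
  have fJ: "finite J" using J finite_subset by blast
  show "canoinv K (canoinv J a) < canoinv K (canoinv J b)" if "a < b" "1 \<le> a" "b \<le> card J" for a b
    using that canoinv_in[OF fJ, of a] canoinv_in[OF fJ, of b] J
    by (intro canoinv_less K fJ) auto
  show "(\<lambda>r. canoinv K (canoinv J r)) ` {1..card J} = canoinv K ` J"
    using bij_betw_imp_surj_on[OF canoinv_bij_betw[OF fJ]] by (metis image_image)
qed (rule r)

text \<open>Names the expression by which \<open>DeltaK\<close> determines the order carried by a
  tensor factor.\<close>

definition ordr :: "nat set \<Rightarrow> (nat \<times> nat) set \<Rightarrow> (nat \<times> nat) set" where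
  "ordr I \<phi> = relab (cano I) (\<phi> \<inter> I \<times> I)"

lemma ordr_iff:
  assumes "finite I"
  shows "(r,s) \<in> ordr I \<phi> \<longleftrightarrow> r \<in> {1..card I} \<and> s \<in> {1..card I} \<and> (canoinv I r, canoinv I s) \<in> \<phi>"
proof
  assume "(r,s) \<in> ordr I \<phi>"
  then show "r \<in> {1..card I} \<and> s \<in> {1..card I} \<and> (canoinv I r, canoinv I s) \<in> \<phi>"
    using assms cano_in by (auto simp: ordr_def relab_def canoinv_cano)
next
  assume "r \<in> {1..card I} \<and> s \<in> {1..card I} \<and> (canoinv I r, canoinv I s) \<in> \<phi>"
  then show "(r,s) \<in> ordr I \<phi>"
    using canoinv_in[OF assms, of r] canoinv_in[OF assms, of s] cano_canoinv[OF assms]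
    unfolding ordr_def relab_def by (force intro!: image_eqI[where x="(canoinv I r, canoinv I s)"])
qed

lemma ordr_cano_iff:
  "finite I \<Longrightarrow> a \<in> I \<Longrightarrow> b \<in> I \<Longrightarrow> (cano I a, cano I b) \<in> ordr I \<phi> \<longleftrightarrow> (a,b) \<in> \<phi>"
  using cano_in by (auto simp: ordr_iff canoinv_cano)

lemma sord_ordr:
  assumes "finite I" "sord S \<phi>" "I \<subseteq> S"
  shows "sord {1..card I} (ordr I \<phi>)"
proof -
  have inj: "canoinv I r = canoinv I s \<longleftrightarrow> r = s" if "r \<in> {1..card I}" "s \<in> {1..card I}" for r s
    using canoinv_bij_betw[OF assms(1)] that by (metis cano_canoinv assms(1))
  have tot: "(r, s) \<in> ordr I \<phi> \<or> (s, r) \<in> ordr I \<phi>"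
    if rs: "r \<in> {1..card I}" "s \<in> {1..card I}" "r \<noteq> s" for r s
    using sordD(4)[OF assms(2), of "canoinv I r" "canoinv I s"] canoinv_in[OF assms(1)] assms(3) inj rs
    by (auto simp: ordr_iff[OF assms(1)] subset_iff)
  show ?thesis
    unfolding sord_def strict_linear_order_on_def trans_def irrefl_def total_on_def
    using sordD(3,5)[OF assms(2)] tot by (auto simp: ordr_iff[OF assms(1)])
qed

lemma ordr_std_ord:
  assumes "I \<subseteq> {1..n}"
  shows "ordr I (std_ord n) = std_ord (card I)"
proof -
  have fin: "finite I" using assms finite_subset by blast
  have lt: "canoinv I r < canoinv I s \<longleftrightarrow> r < s" if "r \<in> {1..card I}" "s \<in> {1..card I}" for r s
    using canoinv_less[OF fin, of r s] canoinv_less[OF fin, of s r] that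
    by (metis atLeastAtMost_iff less_asym less_irrefl_nat nat_neq_iff)
  have "(r,s) \<in> ordr I (std_ord n) \<longleftrightarrow> (r,s) \<in> std_ord (card I)" for r s
    using canoinv_in[OF fin, of r] canoinv_in[OF fin, of s] assms lt
    unfolding ordr_iff[OF fin] std_ord_def by blast
  then show ?thesis by auto
qed

section \<open>Diagonal blocks and block diagonal matrices\<close>

lemma blk_cano: "finite I \<Longrightarrow> a \<in> I \<Longrightarrow> b \<in> I \<Longrightarrow> blk I h (cano I a) (cano I b) = h a b"
  using cano_in by (simp add: blk_def canoinv_cano)

lemma blk_eq_iff:
  assumes "finite I"
  shows "blk I h = blk I h' \<longleftrightarrow> (\<forall>a\<in>I. \<forall>b\<in>I. h a b = h' a b)"
proof
  assume "blk I h = blk I h'"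
  then show "\<forall>a\<in>I. \<forall>b\<in>I. h a b = h' a b" by (metis blk_cano[OF assms])
next
  assume "\<forall>a\<in>I. \<forall>b\<in>I. h a b = h' a b"
  then show "blk I h = blk I h'"
    using canoinv_in[OF assms] by (auto simp: blk_def fun_eq_iff)
qed

lemma blk_supp: "supp_in {1..card I} (blk I h)"
  by (simp add: supp_in_def blk_def)

lemma blk_affcomb: "blk I (affcomb x y z) = affcomb (blk I x) (blk I y) (blk I z)"
  by (simp add: blk_def affcomb_def fun_eq_iff)

lemma blk_idm:
  assumes "finite I" "I \<subseteq> S"
  shows "blk I (idm S) = idm {1..card I}"
  using canoinv_in[OF assms(1)] assms(2) bij_betw_imp_inj_on[OF canoinv_bij_betw[OF assms(1)]]
  by (auto simp: blk_def idm_def fun_eq_iff dest: inj_onD)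

lemma blk_blk:
  assumes "finite K" "J \<subseteq> {1..card K}"
  shows "blk J (blk K h) = blk (canoinv K ` J) h"
proof -
  have fJ: "finite J" using assms finite_subset by blast
  have "card (canoinv K ` J) = card J"
    by (rule card_image) (rule inj_on_subset[OF bij_betw_imp_inj_on[OF canoinv_bij_betw[OF assms(1)]] assms(2)])
  moreover have "canoinv J r \<in> {1..card K}" if "r \<in> {1..card J}" for r
    using canoinv_in[OF fJ that] assms(2) by blast
  ultimately show ?thesis
    using canoinv_image[OF assms] by (simp add: blk_def fun_eq_iff)
qed

lemma blk_UTo:
  assumes "finite S" "I \<subseteq> S" "sord S \<phi>" "(h :: 'a::{field,finite} mat) \<in> UTo S \<phi>"
  shows "blk I h \<in> UTo {1..card I} (ordr I \<phi>)"
proof -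
  have fI: "finite I" using assms finite_subset by blast
  have "blk I h r s = idm {1..card I} r s" if "(r,s) \<notin> ordr I \<phi>" for r s
  proof -
    have "blk I h r s = blk I (idm S) r s"
      using that assms(4) UTo_eq_unitri[OF assms(1,3), where 'a='a]
      by (auto simp: blk_def ordr_iff[OF fI] unitri_def)
    then show ?thesis by (simp add: blk_idm[OF fI assms(2)])
  qed
  then show ?thesis
    by (simp add: UTo_eq_unitri[OF _ sord_ordr[OF fI assms(3,2)]] unitri_def)
qed

text \<open>A product term leaving \<open>I\<close> at the intermediate index \<open>k\<close> has a
  zero factor. The disjunction serves both diagonal blocks of block triangular matrices: for one
  block the second factor vanishes, for the complementary one the first.\<close>

lemma blk_mmul:
  assumes "finite S" "I \<subseteq> S"
    and z: "\<And>a k b. a \<in> I \<Longrightarrow> b \<in> I \<Longrightarrow> k \<in> S - I \<Longrightarrow> g a k = 0 \<or> h k b = 0"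
  shows "blk I (mmul S g h) = mmul {1..card I} (blk I g) (blk I h)"
proof (intro ext)
  fix r s
  have fI: "finite I" using assms finite_subset by blast
  show "blk I (mmul S g h) r s = mmul {1..card I} (blk I g) (blk I h) r s"
  proof (cases "r \<in> {1..card I} \<and> s \<in> {1..card I}")
    case True
    have "(\<Sum>k\<in>S. g (canoinv I r) k * h k (canoinv I s)) = (\<Sum>k\<in>I. g (canoinv I r) k * h k (canoinv I s))"
      using True canoinv_in[OF fI] z by (intro sum.mono_neutral_right assms) auto
    also have "\<dots> = (\<Sum>t\<in>{1..card I}. g (canoinv I r) (canoinv I t) * h (canoinv I t) (canoinv I s))"
      by (rule sum.reindex_bij_betw[OF canoinv_bij_betw[OF fI], symmetric])
    also have "\<dots> = mmul {1..card I} (blk I g) (blk I h) r s"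
      unfolding mmul_def by (rule sum.cong) (use True in \<open>auto simp: blk_def\<close>)
    finally show ?thesis using True by (simp add: blk_def mmul_def)
  next
    case False
    then show ?thesis by (auto simp: blk_def mmul_def intro!: sum.neutral)
  qed
qed

lemma card_compl: "I \<subseteq> {1..n::nat} \<Longrightarrow> card ({1..n} - I) = n - card I"
  by (simp add: card_Diff_subset finite_subset)

lemma blk_emb1:
  assumes "I \<subseteq> {1..n}" "supp_in {1..card I} x"
  shows "blk I (emb n I x y) = x"
proof -
  have fI: "finite I" using assms finite_subset by blast
  show ?thesis
    using assms(2) canoinv_in[OF fI] cano_canoinv[OF fI]
    by (auto simp: blk_def emb_def fun_eq_iff supp_in_def)
qed

lemma blk_emb2:
  assumes "I \<subseteq> {1..n}" "supp_in {1..n - card I} y"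
  shows "blk ({1..n} - I) (emb n I x y) = y"
proof -
  have f: "finite ({1..n} - I)" by simp
  show ?thesis
    using assms(2) canoinv_in[OF f] cano_canoinv[OF f] card_compl[OF assms(1)]
    by (auto simp: blk_def emb_def fun_eq_iff supp_in_def)
qed

lemma emb_blk:
  assumes "I \<subseteq> {1..n}" "supp_in {1..n} l"
    and "\<And>a b. l a b \<noteq> 0 \<Longrightarrow> (a,b) \<in> I \<times> I \<union> ({1..n} - I) \<times> ({1..n} - I)"
  shows "emb n I (blk I l) (blk ({1..n} - I) l) = l"
proof (intro ext)
  fix a b
  have fI: "finite I" using assms finite_subset by blast
  show "emb n I (blk I l) (blk ({1..n} - I) l) a b = l a b"
    using assms(2) assms(3)[of a b] blk_cano[OF fI, of a b l] blk_cano[of "{1..n} - I" a b l]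
    by (auto simp: emb_def)
qed

lemma emb_UTo:
  assumes I: "I \<subseteq> {1..n}" and \<phi>: "sord {1..n} \<phi>"
    and x: "(x :: 'a::{field,finite} mat) \<in> UTo {1..card I} (ordr I \<phi>)"
    and y: "y \<in> UTo {1..n - card I} (ordr ({1..n} - I) \<phi>)"
  shows "emb n I x y \<in> UTo {1..n} \<phi>"
proof -
  have fI: "finite I" using I finite_subset by blast
  have x': "x r s = idm {1..card I} r s" if "(r,s) \<notin> ordr I \<phi>" for r s
    using x that by (simp add: UTo_eq_unitri[OF _ sord_ordr[OF fI \<phi> I]] unitri_def)
  have y': "y r s = idm {1..n - card I} r s" if "(r,s) \<notin> ordr ({1..n} - I) \<phi>" for r s
    using y that sord_ordr[OF _ \<phi>, of "{1..n} - I"]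
    by (simp add: UTo_eq_unitri unitri_def card_compl[OF I])
  have inj: "cano J a = cano J b \<longleftrightarrow> a = b" if "finite J" "a \<in> J" "b \<in> J" for J a b
    using canoinv_cano that by metis
  have "emb n I x y a b = idm {1..n} a b" if ab: "(a,b) \<notin> \<phi>" for a b
  proof -
    consider "a \<in> I \<and> b \<in> I" | "a \<in> {1..n} - I \<and> b \<in> {1..n} - I"
      | "\<not> (a \<in> I \<and> b \<in> I)" "\<not> (a \<in> {1..n} - I \<and> b \<in> {1..n} - I)" by blast
    then show ?thesis
    proof cases
      case 1
      then have "emb n I x y a b = idm {1..card I} (cano I a) (cano I b)"
        using x'[of "cano I a" "cano I b"] ab by (simp add: emb_def ordr_cano_iff[OF fI])
      then show ?thesis using 1 I inj[OF fI] cano_in[OF fI] by (auto simp: idm_def)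
    next
      case 2
      then have "emb n I x y a b = idm {1..n - card I} (cano ({1..n} - I) a) (cano ({1..n} - I) b)"
        using y'[of "cano ({1..n} - I) a" "cano ({1..n} - I) b"] ab by (auto simp: emb_def ordr_cano_iff)
      then show ?thesis
        using 2 inj[of "{1..n} - I" a b] cano_in[of "{1..n} - I" a] card_compl[OF I] by (auto simp: idm_def)
    next
      case 3
      then show ?thesis using I by (auto simp: emb_def idm_def)
    qed
  qed
  then show ?thesis by (simp add: UTo_eq_unitri[OF _ \<phi>] unitri_def)
qed

section \<open>Inflation and deflation in terms of blocks\<close>

text \<open>\<open>levi\<close>, \<open>radical\<close> and \<open>parab\<close> generalise
  \<open>UL\<close>, \<open>UR\<close> and \<open>UP\<close> to an arbitrary total order, so that
  one treatment of inflation and deflation covers the class functions on UT and the summands of the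
  Hopf monoid.\<close>

definition levi :: "nat \<Rightarrow> (nat \<times> nat) set \<Rightarrow> nat set \<Rightarrow> 'a::field mat set" where
  "levi n \<phi> I = {Z\<in>UTo {1..n} \<phi>. \<forall>a b. a \<noteq> b \<and> Z a b \<noteq> 0 \<longrightarrow>
     (a,b) \<in> I \<times> I \<union> ({1..n} - I) \<times> ({1..n} - I)}"

definition radical :: "nat \<Rightarrow> (nat \<times> nat) set \<Rightarrow> nat set \<Rightarrow> 'a::field mat set" where
  "radical n \<phi> I = {Z\<in>UTo {1..n} \<phi>. \<forall>a b. a \<noteq> b \<and> Z a b \<noteq> 0 \<longrightarrow> (a,b) \<in> I \<times> ({1..n} - I)}"

definition parab :: "nat \<Rightarrow> (nat \<times> nat) set \<Rightarrow> nat set \<Rightarrow> 'a::field mat set" where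
  "parab n \<phi> I = {Z\<in>UTo {1..n} \<phi>. \<forall>a\<in>{1..n} - I. \<forall>b\<in>I. Z a b = 0}"

text \<open>If \<open>l\<close> is the block diagonal matrix with blocks \<open>x\<close> and
  \<open>y\<close>, this is the coset of \<open>l\<close> modulo the radical
  (\<open>bij_betw_radical_fibr\<close>). Described by entries instead of products, it is visibly
  affine.\<close>

definition fibr :: "nat \<Rightarrow> (nat \<times> nat) set \<Rightarrow> nat set \<Rightarrow> 'a::field mat \<Rightarrow> 'a mat \<Rightarrow> 'a mat set" where
  "fibr n \<phi> I x y = {h\<in>parab n \<phi> I. blk I h = x \<and> blk ({1..n} - I) h = y}"

lemma levi_nz:
  "l \<in> levi n \<phi> I \<Longrightarrow> a \<noteq> b \<Longrightarrow> l a b \<noteq> 0 \<Longrightarrow>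
    (a,b) \<in> I \<times> I \<union> ({1..n} - I) \<times> ({1..n} - I)"
  unfolding levi_def by blast

context
  fixes n :: nat and \<phi> and dummy :: "'a::{field,finite} itself"
  assumes \<phi>: "sord {1..n} \<phi>"
begin

lemma UTo_iff': "(Z :: 'a mat) \<in> UTo {1..n} \<phi> \<longleftrightarrow> (\<forall>i j. (i,j) \<notin> \<phi> \<longrightarrow> Z i j = idm {1..n} i j)"
  by (simp add: UTo_eq_unitri[OF _ \<phi>] unitri_def)

lemma UTo_diag: "(Z :: 'a mat) \<in> UTo {1..n} \<phi> \<Longrightarrow> a \<in> {1..n} \<Longrightarrow> Z a a = 1"
  using sordD(3)[OF \<phi>] by (simp add: UTo_iff' idm_def)

lemma UTo_off: "(Z :: 'a mat) \<in> UTo {1..n} \<phi> \<Longrightarrow> a \<notin> {1..n} \<or> b \<notin> {1..n} \<Longrightarrow> Z a b = 0"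
  using UTo_supp[OF finite_atLeastAtMost \<phi>, of Z] unfolding supp_in_def by blast

lemma UTo_neq_idm:
  "(Z :: 'a mat) \<in> UTo {1..n} \<phi> \<Longrightarrow> Z a b \<noteq> idm {1..n} a b \<longleftrightarrow> a \<noteq> b \<and> Z a b \<noteq> 0"
  using UTo_diag[of Z a] UTo_off[of Z a b] by (cases "a = b"; cases "a \<in> {1..n}") (simp_all add: idm_def)

lemma finite_parab: "finite (parab n \<phi> I :: 'a mat set)"
  by (rule finite_subset[OF _ finite_UTo[OF finite_atLeastAtMost \<phi>]]) (auto simp: parab_def)

lemma finite_fibr: "finite (fibr n \<phi> I x y :: 'a mat set)"
  unfolding fibr_def using finite_parab by simp

end

context
  fixes n :: nat and \<phi> and I :: "nat set" and dummy :: "'a::{field,finite} itself"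
  assumes \<phi>: "sord {1..n} \<phi>" and I: "I \<subseteq> {1..n}"
begin

text \<open>A term with intermediate index \<open>k\<close> different from \<open>b\<close> needs
  \<open>k\<close> in \<open>I\<close> and \<open>b\<close> outside \<open>I\<close>; a nonzero
  entry of \<open>l\<close> at \<open>(a,k)\<close> then puts \<open>a\<close> into
  \<open>I\<close>. So multiplication by \<open>r\<close> changes entries in the upper right block
  alone.\<close>

lemma levi_radical_entry:
  assumes l: "(l :: 'a mat) \<in> levi n \<phi> I" and r: "r \<in> radical n \<phi> I"
    and ab: "(a,b) \<notin> I \<times> ({1..n} - I)"
  shows "mmul {1..n} l r a b = l a b"
proof (cases "b \<in> {1..n}")
  case True
  have lU: "l \<in> UTo {1..n} \<phi>" and rU: "r \<in> UTo {1..n} \<phi>" using l r by (auto simp: levi_def radical_def)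
  have z: "l a k * r k b = 0" if "k \<in> {1..n} - {b}" for k
  proof (rule ccontr)
    assume nz: "l a k * r k b \<noteq> 0"
    then have "(k,b) \<in> I \<times> ({1..n} - I)" using r that by (auto simp: radical_def)
    moreover have "a \<in> {1..n}" using UTo_off[OF \<phi> lU, of a k] nz by auto
    ultimately show False using levi_nz[OF l, of a k] nz ab by auto
  qed
  have "mmul {1..n} l r a b = l a b * r b b + (\<Sum>k\<in>{1..n} - {b}. l a k * r k b)"
    unfolding mmul_def using True by (simp add: sum.remove)
  also have "(\<Sum>k\<in>{1..n} - {b}. l a k * r k b) = 0" by (rule sum.neutral) (use z in blast)
  finally show ?thesis using UTo_diag[OF \<phi> rU True] by simp
next
  case False
  have "l \<in> UTo {1..n} \<phi>" "r \<in> UTo {1..n} \<phi>" using l r by (auto simp: levi_def radical_def)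
  then have "l a b = 0" "r k b = 0" for k using UTo_off[OF \<phi>] False by blast+
  then show ?thesis by (simp add: mmul_def)
qed

lemma fibr_levi_iff:
  assumes l: "(l :: 'a mat) \<in> levi n \<phi> I"
  shows "h \<in> fibr n \<phi> I (blk I l) (blk ({1..n} - I) l) \<longleftrightarrow>
    h \<in> UTo {1..n} \<phi> \<and> (\<forall>a b. (a,b) \<notin> I \<times> ({1..n} - I) \<longrightarrow> h a b = l a b)"
proof -
  have fI: "finite I" using I finite_subset by blast
  have lU: "l \<in> UTo {1..n} \<phi>" using l by (auto simp: levi_def)
  have lz: "l a b = 0" if "a \<in> {1..n} - I" "b \<in> I" for a b using levi_nz[OF l, of a b] that by auto
  have "(\<forall>a b. (a,b) \<notin> I \<times> ({1..n} - I) \<longrightarrow> h a b = l a b) \<longleftrightarrow>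
    (\<forall>a\<in>{1..n} - I. \<forall>b\<in>I. h a b = 0) \<and> (\<forall>a\<in>I. \<forall>b\<in>I. h a b = l a b)
      \<and> (\<forall>a\<in>{1..n} - I. \<forall>b\<in>{1..n} - I. h a b = l a b)" (is "?L \<longleftrightarrow> ?R")
    if hU: "h \<in> UTo {1..n} \<phi>"
  proof
    show "?L \<Longrightarrow> ?R" using lz by auto
  next
    assume R: ?R
    show ?L
    proof (intro allI impI)
      fix a b assume "(a,b) \<notin> I \<times> ({1..n} - I)"
      then consider "a \<notin> {1..n} \<or> b \<notin> {1..n}" | "a \<in> {1..n} - I" "b \<in> I" | "a \<in> I" "b \<in> I"
        | "a \<in> {1..n} - I" "b \<in> {1..n} - I" by blast
      then show "h a b = l a b"
        using R lz UTo_off[OF \<phi> hU, of a b] UTo_off[OF \<phi> lU, of a b] by cases auto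
    qed
  qed
  moreover have "h \<in> fibr n \<phi> I (blk I l) (blk ({1..n} - I) l) \<longleftrightarrow> h \<in> UTo {1..n} \<phi> \<and>
    (\<forall>a\<in>{1..n} - I. \<forall>b\<in>I. h a b = 0) \<and> (\<forall>a\<in>I. \<forall>b\<in>I. h a b = l a b)
      \<and> (\<forall>a\<in>{1..n} - I. \<forall>b\<in>{1..n} - I. h a b = l a b)"
    unfolding fibr_def parab_def mem_Collect_eq blk_eq_iff[OF fI] blk_eq_iff[OF finite_Diff[OF finite_atLeastAtMost]]
    by (simp only: conj_assoc)
  ultimately show ?thesis by (simp only: cong: conj_cong)
qed

text \<open>Left multiplication by \<open>l\<close> is injective by cancellation and lands in the
  fibre. Surjectivity is obtained by counting: the translation \<open>r - 1 + l\<close> is another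
  bijection from the radical to the fibre, so both have the same size.\<close>

lemma bij_betw_radical_fibr:
  assumes l: "(l :: 'a mat) \<in> levi n \<phi> I"
  shows "bij_betw (mmul {1..n} l) (radical n \<phi> I) (fibr n \<phi> I (blk I l) (blk ({1..n} - I) l))"
proof -
  let ?F = "fibr n \<phi> I (blk I l) (blk ({1..n} - I) l)"
  have lU: "l \<in> UTo {1..n} \<phi>" using l by (auto simp: levi_def)
  have inj: "inj_on (mmul {1..n} l) (radical n \<phi> I)"
    using mmul_unitri_cancel[OF _ \<phi>, of l] lU
    by (intro inj_onI) (auto simp: radical_def UTo_eq_unitri[OF _ \<phi>])
  have sub: "mmul {1..n} l ` radical n \<phi> I \<subseteq> ?F"
  proof
    fix h assume "h \<in> mmul {1..n} l ` radical n \<phi> I"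
    then obtain r where r: "r \<in> radical n \<phi> I" "h = mmul {1..n} l r" by auto
    then have "h \<in> UTo {1..n} \<phi>" using mmul_UTo[OF _ \<phi> lU] by (simp add: radical_def)
    then show "h \<in> ?F" using levi_radical_entry[OF l r(1)] r(2) by (simp add: fibr_levi_iff[OF l])
  qed
  have rad: "r \<in> radical n \<phi> I \<longleftrightarrow> r \<in> UTo {1..n} \<phi> \<and>
      (\<forall>a b. (a,b) \<notin> I \<times> ({1..n} - I) \<longrightarrow> r a b = idm {1..n} a b)" for r :: "'a mat"
  proof -
    have "(\<forall>a b. a \<noteq> b \<and> r a b \<noteq> 0 \<longrightarrow> (a,b) \<in> I \<times> ({1..n} - I)) \<longleftrightarrow>
      (\<forall>a b. (a,b) \<notin> I \<times> ({1..n} - I) \<longrightarrow> r a b = idm {1..n} a b)" if "r \<in> UTo {1..n} \<phi>"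
      unfolding UTo_neq_idm[OF \<phi> that, symmetric] by blast
    then show ?thesis unfolding radical_def by blast
  qed
  have idU: "(idm {1..n} :: 'a mat) \<in> UTo {1..n} \<phi>"
    by (rule idm_UTo[OF _ \<phi>]) simp
  have aff: "affcomb X Y Z \<in> UTo {1..n} \<phi>"
    if "X \<in> UTo {1..n} \<phi>" "Y \<in> UTo {1..n} \<phi>" "Z \<in> UTo {1..n} \<phi>" for X Y Z :: "'a mat"
    by (rule UTo_affcomb[OF _ \<phi>]) (use that in auto)
  have "bij_betw (\<lambda>r. affcomb r (idm {1..n}) l) (radical n \<phi> I) ?F"
  proof (rule bij_betw_byWitness[where f'="\<lambda>h. affcomb h l (idm {1..n})"])
    show "(\<lambda>r. affcomb r (idm {1..n}) l) ` radical n \<phi> I \<subseteq> ?F"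
    proof (rule image_subsetI)
      fix r :: "'a mat" assume "r \<in> radical n \<phi> I"
      then show "affcomb r (idm {1..n}) l \<in> ?F"
        using aff[OF _ idU lU] unfolding fibr_levi_iff[OF l] rad by (simp add: affcomb_def)
    qed
    show "(\<lambda>h. affcomb h l (idm {1..n})) ` ?F \<subseteq> radical n \<phi> I"
    proof (rule image_subsetI)
      fix h :: "'a mat" assume "h \<in> ?F"
      then show "affcomb h l (idm {1..n}) \<in> radical n \<phi> I"
        using aff[OF _ lU idU] unfolding fibr_levi_iff[OF l] rad by (simp add: affcomb_def)
    qed
  qed (simp_all add: affcomb_def)
  then have "card ?F = card (radical n \<phi> I :: 'a mat set)" by (simp add: bij_betw_same_card)
  then have "mmul {1..n} l ` radical n \<phi> I = ?F"
    using sub inj by (intro card_subset_eq finite_fibr[OF \<phi>]) (simp_all add: card_image)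
  then show ?thesis using inj by (simp add: bij_betw_def)
qed

lemma Defl_Restr:
  assumes l: "(l :: 'a mat) \<in> levi n \<phi> I"
  shows "Defl {1..n} (levi n \<phi> I) (radical n \<phi> I) (Restr (parab n \<phi> I) \<psi>) l =
    avg (fibr n \<phi> I (blk I l) (blk ({1..n} - I) l)) \<psi>"
proof -
  have "avg (fibr n \<phi> I (blk I l) (blk ({1..n} - I) l)) \<psi> =
      avg (fibr n \<phi> I (blk I l) (blk ({1..n} - I) l)) (Restr (parab n \<phi> I) \<psi>)"
    by (rule avg_cong) (auto simp: Restr_def fibr_def)
  also have "\<dots> = avg (radical n \<phi> I) (\<lambda>x. Restr (parab n \<phi> I) \<psi> (mmul {1..n} l x))"
    by (rule avg_bij_betw[OF bij_betw_radical_fibr[OF l]])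
  finally show ?thesis using l by (simp add: Defl_def avg_def)
qed

lemma emb_levi:
  assumes "(x :: 'a mat) \<in> UTo {1..card I} (ordr I \<phi>)"
    and "y \<in> UTo {1..n - card I} (ordr ({1..n} - I) \<phi>)"
  shows "emb n I x y \<in> levi n \<phi> I"
  using emb_UTo[OF I \<phi> assms] by (auto simp: levi_def emb_def split: if_splits)

lemma levi_emb_blk:
  assumes l: "(l :: 'a mat) \<in> levi n \<phi> I"
  shows "emb n I (blk I l) (blk ({1..n} - I) l) = l"
proof (rule emb_blk[OF I])
  have lU: "l \<in> UTo {1..n} \<phi>" using l by (auto simp: levi_def)
  then show "supp_in {1..n} l" using UTo_supp[OF _ \<phi>] by simp
  show "(a,b) \<in> I \<times> I \<union> ({1..n} - I) \<times> ({1..n} - I)" if "l a b \<noteq> 0" for a b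
    using levi_nz[OF l, of a b] that UTo_off[OF \<phi> lU, of a b] by (cases "a = b") (auto simp: levi_def)
qed

lemma emb_blk_levi:
  assumes g: "(g :: 'a mat) \<in> UTo {1..n} \<phi>"
  shows "emb n I (blk I g) (blk ({1..n} - I) g) \<in> levi n \<phi> I"
proof (rule emb_levi)
  show "blk I g \<in> UTo {1..card I} (ordr I \<phi>)" by (rule blk_UTo[OF _ I \<phi> g]) simp
  have "blk ({1..n} - I) g \<in> UTo {1..card ({1..n} - I)} (ordr ({1..n} - I) \<phi>)"
    by (rule blk_UTo[OF _ _ \<phi> g]) auto
  then show "blk ({1..n} - I) g \<in> UTo {1..n - card I} (ordr ({1..n} - I) \<phi>)"
    by (simp only: card_compl[OF I])
qed

lemma blk_emb_blk:
  "blk I (emb n I (blk I g) (blk ({1..n} - I) g)) = blk I g"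
  "blk ({1..n} - I) (emb n I (blk I g) (blk ({1..n} - I) g)) = blk ({1..n} - I) g"
  using blk_supp[of "{1..n} - I" g]
  by (auto simp: blk_emb1[OF I] blk_emb2[OF I] card_compl[OF I] blk_supp)

text \<open>As \<phi> contains all pairs from \<open>I\<close> to its complement, every group
  element vanishes on the opposite block and lies in the coset of the block diagonal matrix with the
  same blocks. That matrix is the unique Levi factor chosen by \<open>Infl\<close>; \<open>G\<close>
  is \<psi> read off on blocks.\<close>

lemma Infl_blocks:
  assumes IT: "I \<times> ({1..n} - I) \<subseteq> \<phi>"
    and \<psi>: "\<And>l. l \<in> levi n \<phi> I \<Longrightarrow> \<psi> l = G (blk I l) (blk ({1..n} - I) l)"
  shows "Infl {1..n} (UTo {1..n} \<phi>) (levi n \<phi> I) (radical n \<phi> I) \<psi> (g :: 'a mat) =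
    (if g \<in> UTo {1..n} \<phi> then G (blk I g) (blk ({1..n} - I) g) else 0)"
proof (cases "g \<in> UTo {1..n} \<phi>")
  case g: True
  let ?l = "emb n I (blk I g) (blk ({1..n} - I) g)"
  have l: "?l \<in> levi n \<phi> I" by (rule emb_blk_levi[OF g])
  have gz: "g a b = 0" if "a \<in> {1..n} - I" "b \<in> I" for a b
  proof -
    have "(b,a) \<in> \<phi>" using IT that by auto
    then have "(a,b) \<notin> \<phi>" using sordD(6)[OF \<phi>] by blast
    then show ?thesis using g that by (auto simp: UTo_iff'[OF \<phi>] idm_def)
  qed
  have "g \<in> fibr n \<phi> I (blk I ?l) (blk ({1..n} - I) ?l)"
    using g gz by (simp add: blk_emb_blk fibr_def parab_def)
  then obtain r where r: "r \<in> radical n \<phi> I" "g = mmul {1..n} ?l r"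
    using bij_betw_imp_surj_on[OF bij_betw_radical_fibr[OF l]] by (metis imageE)
  have "(THE l. l \<in> levi n \<phi> I \<and> (\<exists>r\<in>radical n \<phi> I. g = mmul {1..n} l r)) = ?l"
  proof (rule the_equality)
    show "?l \<in> levi n \<phi> I \<and> (\<exists>r\<in>radical n \<phi> I. g = mmul {1..n} ?l r)" using l r by blast
    fix l assume "l \<in> levi n \<phi> I \<and> (\<exists>r\<in>radical n \<phi> I. g = mmul {1..n} l r)"
    then have l: "l \<in> levi n \<phi> I" and "g \<in> fibr n \<phi> I (blk I l) (blk ({1..n} - I) l)"
      using bij_betwE[OF bij_betw_radical_fibr] by auto
    then show "l = ?l" using levi_emb_blk[OF l] by (simp add: fibr_def)
  qed
  then show ?thesis using g \<psi>[OF l] by (simp add: Infl_def blk_emb_blk)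
qed (simp add: Infl_def)

end

section \<open>Closed formulas for the product and coproduct of class functions\<close>

lemma UL_eq_levi:
  assumes "I \<subseteq> {1..n}"
  shows "(UL n I :: 'a::{field,finite} mat set) = levi n (std_ord n) I"
proof -
  have "(\<forall>i\<in>{1..n}. \<forall>j\<in>{1..n}. g i j - idm {1..n} i j \<noteq> 0 \<longrightarrow>
       (i,j) \<in> I \<times> I \<union> ({1..n} - I) \<times> ({1..n} - I)) \<longleftrightarrow>
     (\<forall>a b. a \<noteq> b \<and> g a b \<noteq> 0 \<longrightarrow> (a,b) \<in> I \<times> I \<union> ({1..n} - I) \<times> ({1..n} - I))"
    if "g \<in> UTo {1..n} (std_ord n)" for g :: "'a mat"
    unfolding UTo_neq_idm[OF sord_std_ord that, symmetric] right_minus_eq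
    using UTo_off[OF sord_std_ord that] by (metis idm_def)
  then show ?thesis unfolding UL_def levi_def UT_def by blast
qed

lemma UR_eq_radical:
  assumes "I \<subseteq> {1..n}"
  shows "(UR n I :: 'a::{field,finite} mat set) = radical n (std_ord n) I"
proof -
  have "(\<forall>i\<in>{1..n}. \<forall>j\<in>{1..n}. g i j - idm {1..n} i j \<noteq> 0 \<longrightarrow> (i,j) \<in> I \<times> ({1..n} - I)) \<longleftrightarrow>
     (\<forall>a b. a \<noteq> b \<and> g a b \<noteq> 0 \<longrightarrow> (a,b) \<in> I \<times> ({1..n} - I))"
    if "g \<in> UTo {1..n} (std_ord n)" for g :: "'a mat"
    unfolding UTo_neq_idm[OF sord_std_ord that, symmetric] right_minus_eq
    using UTo_off[OF sord_std_ord that] by (metis idm_def)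
  then show ?thesis unfolding UR_def radical_def UT_def by blast
qed

lemma UP_eq_parab:
  assumes "I \<subseteq> {1..n}"
  shows "UP n I = parab n (std_ord n) I"
  unfolding UP_def parab_def UT_def using assms by (auto simp: idm_def)

lemma muUT_apply:
  "muUT i j F (g :: 'a::{field,finite} mat) =
    (if g \<in> UT (i+j) then F (blk {1..i} g, blk {i+1..i+j} g) else 0)"
proof -
  have T: "{1..i+j} - {1..i} = {i+1..i+j}" and S: "{1..i} \<subseteq> {1..i+j}" by auto
  show ?thesis
    unfolding muUT_def UT_def UL_eq_levi[OF S] UR_eq_radical[OF S]
    by (subst Infl_blocks[OF sord_std_ord S, where G="\<lambda>x y. F (x,y)"])
      (auto simp: std_ord_def stinvUT_def UL_eq_levi[OF S] T)
qed

lemma DeltaUT_apply: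
  "DeltaUT k l f ((x :: 'a::{field,finite} mat), y) =
    (if x \<in> UT k \<and> y \<in> UT l
     then \<Sum>I\<in>{I. I \<subseteq> {1..k+l} \<and> card I = k}. avg (fibr (k+l) (std_ord (k+l)) I x y) f else 0)"
proof -
  have "stUT (k+l) I (Defl {1..k+l} (UL (k+l) I) (UR (k+l) I) (Restr (UP (k+l) I) f)) (x,y) =
     avg (fibr (k+l) (std_ord (k+l)) I x y) f"
    if xy: "x \<in> UT k" "y \<in> UT l" and I: "I \<subseteq> {1..k+l}" "card I = k" for I
  proof -
    have x: "x \<in> UTo {1..card I} (ordr I (std_ord (k+l)))"
      using xy(1) by (simp add: ordr_std_ord[OF I(1)] UT_def I(2))
    have y: "y \<in> UTo {1..k + l - card I} (ordr ({1..k+l} - I) (std_ord (k+l)))"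
      using xy(2) card_compl[OF I(1)] by (simp add: ordr_std_ord UT_def I(2))
    have "supp_in {1..card I} x" "supp_in {1..k + l - card I} y"
      using x y by (auto simp: UTo_def)
    then show ?thesis
      using xy I(2) Defl_Restr[OF sord_std_ord I(1) emb_levi[OF sord_std_ord I(1) x y], of f]
      by (simp add: stUT_def UL_eq_levi[OF I(1)] UR_eq_radical[OF I(1)] UP_eq_parab[OF I(1)]
          blk_emb1[OF I(1)] blk_emb2[OF I(1)])
  qed
  then have "x \<in> UT k \<Longrightarrow> y \<in> UT l \<Longrightarrow> ?thesis" unfolding DeltaUT_def by auto
  moreover have "stUT (k+l) I \<psi> (x,y) = 0" if "card I = k" "\<not> (x \<in> UT k \<and> y \<in> UT l)" for I \<psi>
    using that by (auto simp: stUT_def)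
  then have "\<not> (x \<in> UT k \<and> y \<in> UT l) \<Longrightarrow> ?thesis" unfolding DeltaUT_def by auto
  ultimately show ?thesis by blast
qed

section \<open>Antipodes of graded connected bialgebras\<close>

lemma lin_onD:
  "lin_on V L \<Longrightarrow> f \<in> V \<Longrightarrow> g \<in> V \<Longrightarrow> L (\<lambda>x. c * f x + d * g x) = (\<lambda>y. c * L f y + d * L g y)"
  by (simp add: lin_on_def)

lemma lin_on_sum:
  assumes L: "lin_on UNIV L"
  shows "finite K \<Longrightarrow> L (\<lambda>x. \<Sum>k\<in>K. c k * f k x) = (\<lambda>y. \<Sum>k\<in>K. c k * L (f k) y)"
proof (induction K rule: finite_induct)
  case empty
  show ?case using lin_onD[OF L, of "\<lambda>_. 0" "\<lambda>_. 0" 0 0] by simp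
next
  case (insert k K)
  then show ?case
    using lin_onD[OF L, of "f k" "\<lambda>x. \<Sum>k\<in>K. c k * f k x" "c k" 1] by simp
qed

lemma lin_on_sum_right:
  "lin_on UNIV L \<Longrightarrow> finite K \<Longrightarrow> L (\<lambda>x. \<Sum>k\<in>K. f k x * c k) = (\<lambda>y. \<Sum>k\<in>K. L (f k) y * c k)"
  using lin_on_sum[of L K c f] by (simp add: mult.commute)

lemma lin_on_neg_sum:
  assumes L: "lin_on UNIV L" and K: "finite K"
  shows "L (\<lambda>x. - (\<Sum>k\<in>K. f k x)) = (\<lambda>y. - (\<Sum>k\<in>K. L (f k) y))"
  using lin_on_sum[OF L K, of "\<lambda>_. - 1" f] by (simp add: sum_negf)

lemma lin_on_scale: "lin_on UNIV L \<Longrightarrow> L (\<lambda>x. f x * c) = (\<lambda>y. L f y * c)"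
  using lin_onD[of UNIV L f f c 0] by (simp add: mult.commute)

lemma subsp_sum:
  assumes V: "subsp V"
  shows "finite K \<Longrightarrow> (\<And>k. k \<in> K \<Longrightarrow> f k \<in> V) \<Longrightarrow> (\<lambda>x. \<Sum>k\<in>K. c k * f k x) \<in> V"
proof (induction K rule: finite_induct)
  case empty
  show ?case using V by (simp add: subsp_def)
next
  case (insert k K)
  have "(\<lambda>x. c k * f k x) \<in> V" using V insert by (simp add: subsp_def)
  moreover have "(\<lambda>x. \<Sum>k\<in>K. c k * f k x) \<in> V" using insert by simp
  ultimately have "(\<lambda>x. c k * f k x + (\<Sum>k\<in>K. c k * f k x)) \<in> V" using V by (simp add: subsp_def)
  then show ?case using insert by simp
qed

lemma tensor2I:
  fixes m :: nat
  assumes "F = (\<lambda>(x,y). \<Sum>k<m. fs k x * gs k y)" "\<And>k. fs k \<in> A" "\<And>k. gs k \<in> B"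
  shows "F \<in> tensor2 A B"
  unfolding tensor2_def mem_Collect_eq
  by (rule exI[of _ m], rule exI[of _ fs], rule exI[of _ gs]) (use assms in simp)

lemma tensor2_slices:
  assumes F: "F \<in> tensor2 A B"
  shows "subsp A \<Longrightarrow> (\<lambda>x. F (x, y)) \<in> A" "subsp B \<Longrightarrow> (\<lambda>y. F (x, y)) \<in> B"
proof -
  obtain m :: nat and fs gs where fg: "\<forall>k<m. fs k \<in> A \<and> gs k \<in> B"
    and F: "F = (\<lambda>(x,y). \<Sum>k<m. fs k x * gs k y)"
    using F by (auto simp: tensor2_def)
  show "(\<lambda>x. F (x, y)) \<in> A" if "subsp A"
    using subsp_sum[OF that, of "{..<m}" fs "\<lambda>k. gs k y"] fg by (simp add: F mult.commute)
  show "(\<lambda>y. F (x, y)) \<in> B" if "subsp B"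
    using subsp_sum[OF that, of "{..<m}" gs "\<lambda>k. fs k x"] fg by (simp add: F)
qed

lemma tensor2_tmap_left:
  assumes F: "F \<in> tensor2 A B" and L: "lin_on UNIV L" and LA: "\<And>f. f \<in> A \<Longrightarrow> L f \<in> A'"
  shows "tmap L (\<lambda>g. g) F \<in> tensor2 A' B"
proof -
  obtain m :: nat and fs gs where fg: "\<forall>k<m. fs k \<in> A \<and> gs k \<in> B"
    and F: "F = (\<lambda>(x,y). \<Sum>k<m. fs k x * gs k y)"
    using F by (auto simp: tensor2_def)
  have "tmap L (\<lambda>g. g) F = (\<lambda>(x,y). \<Sum>k<m. L (fs k) x * gs k y)"
    by (simp add: tmap_def F lin_on_sum_right[OF L])
  then show ?thesis
    unfolding tensor2_def using fg LA
    by (auto intro!: exI[of _ m] exI[of _ "\<lambda>k. L (fs k)"] exI[of _ gs])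
qed

text \<open>The left antipode equation in positive degree \<open>n\<close>, solved for its term
  \<open>k = n\<close>; that term is the antipode of \<open>f\<close> itself, because the component
  of the coproduct in degrees \<open>n\<close> and 0 is \<open>f\<close> tensor the unit.\<close>

fun antip :: "(nat \<Rightarrow> nat \<Rightarrow> ('x \<times> 'x \<Rightarrow> complex) \<Rightarrow> ('x \<Rightarrow> complex))
    \<Rightarrow> (nat \<Rightarrow> nat \<Rightarrow> ('x \<Rightarrow> complex) \<Rightarrow> ('x \<times> 'x \<Rightarrow> complex))
    \<Rightarrow> nat \<Rightarrow> ('x \<Rightarrow> complex) \<Rightarrow> ('x \<Rightarrow> complex)" where
  "antip mu D n f = (if n = 0 then f
     else (\<lambda>z. - (\<Sum>k<n. mu k (n-k) (tmap (antip mu D k) (\<lambda>g. g) (D k (n-k) f)) z)))"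

declare antip.simps [simp del]

text \<open>Linearity, associativity and coassociativity are required on all functions, as is the
  case for \<open>muUT\<close> and \<open>DeltaUT\<close>; this spares carrying membership through
  partial applications. \<open>D_left\<close> and \<open>D_right\<close> are the form that the
  counit axiom takes when degree 0 is spanned by \<open>u\<close>.\<close>

context
  fixes A :: "nat \<Rightarrow> ('x \<Rightarrow> complex) set"
    and mu :: "nat \<Rightarrow> nat \<Rightarrow> ('x \<times> 'x \<Rightarrow> complex) \<Rightarrow> ('x \<Rightarrow> complex)"
    and D :: "nat \<Rightarrow> nat \<Rightarrow> ('x \<Rightarrow> complex) \<Rightarrow> ('x \<times> 'x \<Rightarrow> complex)"
    and u :: "'x \<Rightarrow> complex"
  assumes subsp_A: "\<And>n. subsp (A n)"
    and lin_mu: "\<And>i j. lin_on UNIV (mu i j)" and lin_D: "\<And>i j. lin_on UNIV (D i j)"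
    and mu_A: "\<And>i j F. F \<in> tensor2 (A i) (A j) \<Longrightarrow> mu i j F \<in> A (i+j)"
    and D_A: "\<And>k l f. f \<in> A (k+l) \<Longrightarrow> D k l f \<in> tensor2 (A k) (A l)"
    and assoc: "\<And>i j k F. mu (i+j) k (lft_mu (mu i j) F) = mu i (j+k) (rgt_mu (mu j k) F)"
    and coassoc: "\<And>i j k f. lft_D (D i j) (D (i+j) k f) = rgt_D (D j k) (D i (j+k) f)"
    and unit_left: "\<And>n f. f \<in> A n \<Longrightarrow> mu 0 n (\<lambda>(x,y). u x * f y) = f"
    and unit_right: "\<And>n f. f \<in> A n \<Longrightarrow> mu n 0 (\<lambda>(x,y). f x * u y) = f"
    and D_left: "\<And>n f. f \<in> A n \<Longrightarrow> D 0 n f = (\<lambda>(x,y). u x * f y)"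
    and D_right: "\<And>n f. f \<in> A n \<Longrightarrow> D n 0 f = (\<lambda>(x,y). f x * u y)"
begin

lemma antip_0: "antip mu D 0 f = f"
  by (subst antip.simps) simp

lemma lin_antip: "lin_on UNIV (antip mu D n)"
proof (induction n rule: less_induct)
  case (less n)
  show ?case
  proof (cases "n = 0")
    case True
    then show ?thesis by (simp add: lin_on_def antip_0)
  next
    case False
    have "mu k (n-k) (tmap (antip mu D k) (\<lambda>g. g) (D k (n-k) (\<lambda>x. c * f x + d * g x))) =
      (\<lambda>z. c * mu k (n-k) (tmap (antip mu D k) (\<lambda>g. g) (D k (n-k) f)) z
         + d * mu k (n-k) (tmap (antip mu D k) (\<lambda>g. g) (D k (n-k) g)) z)"
      if "k < n" for k f g c d
    proof -
      have "tmap (antip mu D k) (\<lambda>g. g) (D k (n-k) (\<lambda>x. c * f x + d * g x)) =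
        (\<lambda>p. c * tmap (antip mu D k) (\<lambda>g. g) (D k (n-k) f) p
          + d * tmap (antip mu D k) (\<lambda>g. g) (D k (n-k) g) p)"
        using lin_onD[OF less[OF that], OF UNIV_I UNIV_I]
        by (simp add: tmap_def lin_onD[OF lin_D] fun_eq_iff)
      then show ?thesis by (simp add: lin_onD[OF lin_mu])
    qed
    then show ?thesis
      using False unfolding lin_on_def
      by (simp add: antip.simps[of mu D n] sum.distrib sum_distrib_left fun_eq_iff)
  qed
qed

lemma antip_A: "f \<in> A n \<Longrightarrow> antip mu D n f \<in> A n"
proof (induction n arbitrary: f rule: less_induct)
  case (less n)
  show ?case
  proof (cases "n = 0")
    case True
    then show ?thesis using less.prems by (simp add: antip_0)
  next
    case False
    have "mu k (n-k) (tmap (antip mu D k) (\<lambda>g. g) (D k (n-k) f)) \<in> A n" if "k < n" for k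
    proof -
      have "D k (n-k) f \<in> tensor2 (A k) (A (n-k))" using D_A less.prems that by simp
      then have "tmap (antip mu D k) (\<lambda>g. g) (D k (n-k) f) \<in> tensor2 (A k) (A (n-k))"
        by (rule tensor2_tmap_left) (use lin_antip less.IH that in auto)
      then show ?thesis using mu_A[of _ k "n-k"] that by simp
    qed
    then show ?thesis
      using False subsp_sum[OF subsp_A, of "{..<n}" "\<lambda>k. mu k (n-k) (tmap (antip mu D k) (\<lambda>g. g) (D k (n-k) f))"
          n "\<lambda>_. - 1"]
      by (subst antip.simps) (simp add: sum_negf)
  qed
qed

lemma tmap_right_unit:
  assumes f: "f \<in> A n"
  shows "mu n 0 (tmap (antip mu D n) (\<lambda>g. g) (D n 0 f)) = antip mu D n f"
  using unit_right[OF antip_A[OF f]]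
  by (simp add: D_right[OF f] tmap_def lin_on_scale[OF lin_antip])

lemma antip_left:
  assumes f: "f \<in> A n" and n: "n \<noteq> 0"
  shows "(\<Sum>k\<le>n. mu k (n-k) (tmap (antip mu D k) (\<lambda>g. g) (D k (n-k) f)) z) = 0"
proof -
  have "(\<Sum>k\<le>n. mu k (n-k) (tmap (antip mu D k) (\<lambda>g. g) (D k (n-k) f)) z) =
     antip mu D n f z + (\<Sum>k<n. mu k (n-k) (tmap (antip mu D k) (\<lambda>g. g) (D k (n-k) f)) z)"
    by (simp add: lessThan_Suc_atMost[symmetric] tmap_right_unit[OF f])
  then show ?thesis using n by (simp add: antip.simps[of mu D n])
qed

text \<open>A left convolution inverse of the identity is a right one: both sides of the recursion expand
  to the same threefold convolution, by associativity and coassociativity.\<close>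

lemma antip_rec_right:
  assumes "f \<in> A n" and "n \<noteq> 0"
  shows "antip mu D n f = (\<lambda>z. - (\<Sum>k\<in>{1..n}. mu k (n-k) (tmap (\<lambda>g. g) (antip mu D (n-k)) (D k (n-k) f)) z))"
  using assms
proof (induction n arbitrary: f rule: less_induct)
  case (less n)
  note f = less.prems(1)
  \<comment> \<open>\<open>H a b c\<close> is the iterated coproduct of \<open>f\<close> in degrees
    \<open>a\<close>, \<open>b\<close>, \<open>c\<close> with the antipode applied to the middle
    factor; \<open>T a b c\<close> is its threefold product.\<close>
  define H where "H a b c = (\<lambda>(x,y,v). antip mu D b (\<lambda>w. lft_D (D a b) (D (a+b) c f) (x,w,v)) y)" for a b c
  define T where "T a b c = mu (a+b) c (lft_mu (mu a b) (H a b c))" for a b c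
  \<comment> \<open>The induction hypothesis, the right-hand recursion in degree
    \<open>k < n\<close>, is applied to each slice of the coproduct in its first variable.\<close>
  have L: "mu k (n-k) (tmap (antip mu D k) (\<lambda>g. g) (D k (n-k) f)) = (\<lambda>z. - (\<Sum>a\<in>{1..k}. T a (k-a) (n-k) z))"
    if k: "0 < k" "k < n" for k
  proof -
    have slice: "(\<lambda>a. D k (n-k) f (a,v)) \<in> A k" for v
      using tensor2_slices(1)[OF D_A subsp_A, of f k "n-k"] f k by simp
    have eq: "tmap (antip mu D k) (\<lambda>g. g) (D k (n-k) f) = (\<lambda>p. - (\<Sum>a\<in>{1..k}. lft_mu (mu a (k-a)) (H a (k-a) (n-k)) p))"
      using less.IH[OF k(2) slice] k(1)
      by (auto simp: tmap_def lft_mu_def H_def lft_D_def fun_eq_iff intro!: sum.cong)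
    show ?thesis
      unfolding eq by (subst lin_on_neg_sum[OF lin_mu]) (simp_all add: T_def)
  qed
  \<comment> \<open>Here the defining recursion is unfolded in degree \<open>n - a\<close>;
    coassociativity rewrites the coproducts and associativity the products, so that the same
    \<open>T\<close> appears.\<close>
  have R: "mu a (n-a) (tmap (\<lambda>g. g) (antip mu D (n-a)) (D a (n-a) f)) = (\<lambda>z. - (\<Sum>b<n-a. T a b (n-a-b) z))"
    if a: "0 < a" "a < n" for a
  proof -
    have "tmap (\<lambda>g. g) (antip mu D (n-a)) (D a (n-a) f) (p, q) = - (\<Sum>b<n-a. rgt_mu (mu b (n-a-b)) (H a b (n-a-b)) (p, q))" for p q
    proof -
      have "mu b (n-a-b) (tmap (antip mu D b) (\<lambda>g. g) (D b (n-a-b) (\<lambda>y. D a (n-a) f (p,y)))) q =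
          rgt_mu (mu b (n-a-b)) (H a b (n-a-b)) (p, q)" if "b < n-a" for b
      proof -
        have "D a (n-a) f = D a (b + (n-a-b)) f" using that by simp
        then have "H a b (n-a-b) = (\<lambda>(x,y,v). antip mu D b (\<lambda>w. rgt_D (D b (n-a-b)) (D a (n-a) f) (x,w,v)) y)"
          unfolding H_def by (simp only: coassoc)
        then show ?thesis by (simp add: rgt_mu_def tmap_def rgt_D_def)
      qed
      then show ?thesis using a by (simp add: tmap_def antip.simps[of mu D "n-a"])
    qed
    then have eq: "tmap (\<lambda>g. g) (antip mu D (n-a)) (D a (n-a) f) = (\<lambda>p. - (\<Sum>b<n-a. rgt_mu (mu b (n-a-b)) (H a b (n-a-b)) p))"
      by auto
    have T': "T a b (n-a-b) = mu a (n-a) (rgt_mu (mu b (n-a-b)) (H a b (n-a-b)))" if "b < n-a" for b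
      using assoc[of a b "n-a-b"] that unfolding T_def by simp
    show ?thesis
      unfolding eq by (subst lin_on_neg_sum[OF lin_mu]) (auto simp: T' simp del: diff_diff_left intro!: sum.cong)
  qed
  \<comment> \<open>The boundary terms, \<open>k = 0\<close> of the left recursion and
    \<open>k = n\<close> of the right one, both equal \<open>f\<close> because the antipode is the
    identity in degree 0.\<close>
  have L0: "mu 0 n (tmap (antip mu D 0) (\<lambda>g. g) (D 0 n f)) = f"
    using unit_left[OF f] by (simp add: D_left[OF f] tmap_def antip_0)
  have Rn: "mu n 0 (tmap (\<lambda>g. g) (antip mu D 0) (D n 0 f)) = f"
    using unit_right[OF f] by (simp add: D_right[OF f] tmap_def antip_0)
  show ?case
  proof
    fix z
    have "{..<n} = insert 0 {0<..<n}" "{1..n} = insert n {0<..<n}" using less.prems(2) by auto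
    then have "antip mu D n f z = - (f z) - (\<Sum>k\<in>{0<..<n}. - (\<Sum>a\<in>{1..k}. T a (k-a) (n-k) z))"
      and Rs: "- (\<Sum>k\<in>{1..n}. mu k (n-k) (tmap (\<lambda>g. g) (antip mu D (n-k)) (D k (n-k) f)) z) =
        - (f z) - (\<Sum>a\<in>{0<..<n}. - (\<Sum>b<n-a. T a b (n-a-b) z))"
      using less.prems(2) by (simp_all add: antip.simps[of mu D n] L R L0 Rn)
    \<comment> \<open>Both double sums run over all \<open>(a, b, c)\<close> with
      \<open>a + b + c = n\<close> and \<open>a\<close>, \<open>c\<close> positive, where
      \<open>k = a + b\<close>.\<close>
    moreover have "(\<Sum>k\<in>{0<..<n}. \<Sum>a\<in>{1..k}. T a (k-a) (n-k) z) = (\<Sum>a\<in>{0<..<n}. \<Sum>b<n-a. T a b (n-a-b) z)"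
      unfolding sum.Sigma[OF finite_greaterThanLessThan ballI[OF finite_atLeastAtMost]]
        sum.Sigma[OF finite_greaterThanLessThan ballI[OF finite_lessThan]]
      by (rule sum.reindex_bij_witness[where i="\<lambda>(a,b). (a+b,a)" and j="\<lambda>(k,a). (a,k-a)"]) auto
    ultimately show "antip mu D n f z = - (\<Sum>k\<in>{1..n}. mu k (n-k) (tmap (\<lambda>g. g) (antip mu D (n-k)) (D k (n-k) f)) z)"
      by (simp add: sum_negf)
  qed
qed

lemma antip_right:
  assumes f: "f \<in> A n" and n: "n \<noteq> 0"
  shows "(\<Sum>k\<le>n. mu k (n-k) (tmap (\<lambda>g. g) (antip mu D (n-k)) (D k (n-k) f)) z) = 0"
proof -
  have 0: "mu 0 n (tmap (\<lambda>g. g) (antip mu D n) (D 0 n f)) = antip mu D n f"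
  proof -
    have "antip mu D n (\<lambda>y. c * f y) = (\<lambda>y. c * antip mu D n f y)" for c
      using lin_on_scale[OF lin_antip, of n f c] by (simp add: mult.commute)
    then show ?thesis
      using unit_left[OF antip_A[OF f]] by (simp add: D_left[OF f] tmap_def)
  qed
  have "{..n} = insert 0 {1..n}" by auto
  then have "(\<Sum>k\<le>n. mu k (n-k) (tmap (\<lambda>g. g) (antip mu D (n-k)) (D k (n-k) f)) z) =
     antip mu D n f z + (\<Sum>k\<in>{1..n}. mu k (n-k) (tmap (\<lambda>g. g) (antip mu D (n-k)) (D k (n-k) f)) z)"
    by (simp add: 0)
  then show ?thesis using antip_rec_right[OF f n] by simp
qed

end

section \<open>Class functions on unitriangular groups\<close>

lemma UT_iff: "(Z :: 'a::{field,finite} mat) \<in> UT n \<longleftrightarrow> (\<forall>i j. (i,j) \<notin> std_ord n \<longrightarrow> Z i j = idm {1..n} i j)"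
  unfolding UT_def by (rule UTo_iff'[OF sord_std_ord])

lemma UT_lower: "(Z :: 'a::{field,finite} mat) \<in> UT n \<Longrightarrow> b < a \<Longrightarrow> Z a b = 0"
  by (simp add: UT_iff std_ord_def idm_def)

lemma UT_supp: "(Z :: 'a::{field,finite} mat) \<in> UT n \<Longrightarrow> supp_in {1..n} Z"
  by (simp add: UT_def UTo_def)

lemma finite_UT: "finite (UT n :: 'a::{field,finite} mat set)"
  by (simp add: UT_def finite_UTo sord_std_ord)

lemma mmul_UT: "(X :: 'a::{field,finite} mat) \<in> UT n \<Longrightarrow> Y \<in> UT n \<Longrightarrow> mmul {1..n} X Y \<in> UT n"
  by (simp add: UT_def mmul_UTo sord_std_ord)

lemma idm_UT: "(idm {1..n} :: 'a::{field,finite} mat) \<in> UT n"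
  by (simp add: UT_def idm_UTo sord_std_ord)

lemma blk_UT: "I \<subseteq> {1..n} \<Longrightarrow> (h :: 'a::{field,finite} mat) \<in> UT n \<Longrightarrow> blk I h \<in> UT (card I)"
  using blk_UTo[OF finite_atLeastAtMost _ sord_std_ord, of I n h]
  by (simp add: UT_def ordr_std_ord)

lemma emb_UT:
  "I \<subseteq> {1..n} \<Longrightarrow> (x :: 'a::{field,finite} mat) \<in> UT (card I) \<Longrightarrow> y \<in> UT (n - card I) \<Longrightarrow>
    emb n I x y \<in> UT n"
  using emb_UTo[OF _ sord_std_ord, of I n x y]
  by (simp add: UT_def ordr_std_ord card_compl)

lemma emb_levi_std:
  "I \<subseteq> {1..n} \<Longrightarrow> (x :: 'a::{field,finite} mat) \<in> UT (card I) \<Longrightarrow> y \<in> UT (n - card I) \<Longrightarrow>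
    emb n I x y \<in> levi n (std_ord n) I"
  using emb_levi[OF sord_std_ord, of I n x y]
  by (simp add: UT_def ordr_std_ord card_compl)

lemma levi_UT: "l \<in> levi n (std_ord n) I \<Longrightarrow> l \<in> UT n"
  by (simp add: levi_def UT_def)

lemma UT_0: "(UT 0 :: 'a::{field,finite} mat set) = {idm {}}"
  by (auto simp: UT_iff std_ord_def intro!: ext)

lemma blk_empty: "blk {} h = idm {}"
  by (simp add: blk_def idm_def fun_eq_iff)

lemma blk_full: "supp_in {1..n} h \<Longrightarrow> blk {1..n} h = h"
  by (auto simp: blk_def fun_eq_iff supp_in_def canoinv_from_1)

lemma cfUT_iff:
  "f \<in> cfUT n \<longleftrightarrow> (\<forall>x. x \<notin> UT n \<longrightarrow> f x = 0) \<and> (\<forall>g\<in>UT n. \<forall>h\<in>UT n. \<forall>h'\<in>UT n.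
     mmul {1..n} h h' = idm {1..n} \<longrightarrow> f (mmul {1..n} (mmul {1..n} h g) h') = f g)"
  by (simp add: cfUT_def cf_of_def)

lemma cfUT_conj:
  "f \<in> cfUT n \<Longrightarrow> g \<in> UT n \<Longrightarrow> h \<in> UT n \<Longrightarrow> h' \<in> UT n \<Longrightarrow> mmul {1..n} h h' = idm {1..n} \<Longrightarrow>
    f (mmul {1..n} (mmul {1..n} h g) h') = f g"
  by (simp add: cfUT_iff)

lemma subsp_cfUT: "subsp (cfUT n)"
  by (simp add: subsp_def cfUT_iff)

text \<open>Points that are not separated by class functions form the conjugacy classes, whose indicator
  functions are used to split off the first tensor factor.\<close>

lemma tensor2_cfUT:
  fixes F :: "'a::{field,finite} mat \<times> 'a mat \<Rightarrow> complex"
  assumes F1: "\<And>y. (\<lambda>x. F (x,y)) \<in> cfUT k" and F2: "\<And>x. (\<lambda>y. F (x,y)) \<in> cfUT l"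
  shows "F \<in> tensor2 (cfUT k) (cfUT l)"
proof -
  define cl where "cl x = restrict (\<lambda>f. f x) (cfUT k)" for x :: "'a mat"
  define e where "e p x = (if x \<in> UT k \<and> cl x = p then 1 else (0::complex))" for p x
  define r where "r p = (SOME x. x \<in> UT k \<and> cl x = p)" for p
  have cl: "cl x = cl x' \<longleftrightarrow> (\<forall>f\<in>cfUT k. f x = f x')" for x x'
    by (auto simp: cl_def restrict_def fun_eq_iff)
  have e: "e p \<in> cfUT k" for p
  proof -
    have "cl (mmul {1..k} (mmul {1..k} h g) h') = cl g"
      if "g \<in> UT k" "h \<in> UT k" "h' \<in> UT k" "mmul {1..k} h h' = idm {1..k}" for g h h'
      unfolding cl using cfUT_conj that by blast
    then show ?thesis unfolding cfUT_iff by (auto simp: e_def mmul_UT)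
  qed
  let ?P = "cl ` UT k"
  have fP: "finite ?P" using finite_UT by blast
  have r: "r (cl x) \<in> UT k \<and> cl (r (cl x)) = cl x" if "x \<in> UT k" for x
    \<comment> \<open>The representative \<open>r (cl x)\<close> cannot be separated from
      \<open>x\<close> by class functions; hence each slice \<open>F (_, y)\<close> has the same
      value at both, and \<open>F\<close> is a sum over classes of indicator times slice.\<close>
    unfolding r_def by (rule someI[of _ x]) (use that in simp)
  have eq: "F (x,y) = (\<Sum>p\<in>?P. e p x * F (r p, y))" for x y
  proof (cases "x \<in> UT k")
    case True
    have "(\<Sum>p\<in>?P. e p x * F (r p, y)) = (\<Sum>p\<in>?P. if p = cl x then F (r p, y) else 0)"
      by (rule sum.cong) (auto simp: e_def True)
    also have "\<dots> = F (r (cl x), y)" using fP True by simp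
    also have "\<dots> = F (x, y)"
    proof -
      have "\<forall>f\<in>cfUT k. f (r (cl x)) = f x" using r[OF True] cl by blast
      from bspec[OF this F1[of y]] show ?thesis .
    qed
    finally show ?thesis by simp
  next
    case False
    then show ?thesis using F1[of y] by (simp add: e_def cfUT_iff)
  qed
  obtain b where b: "bij_betw b {0..<card ?P} ?P" using ex_bij_betw_nat_finite[OF fP] by blast
  then have b: "bij_betw b {..<card ?P} ?P" by (simp add: lessThan_atLeast0)
  have "F = (\<lambda>(x,y). \<Sum>i<card ?P. e (b i) x * F (r (b i), y))"
  proof (rule ext, clarify)
    fix x y
    show "F (x,y) = (\<Sum>i<card ?P. e (b i) x * F (r (b i), y))"
      by (rule trans[OF eq sum.reindex_bij_betw[OF b, symmetric]])
  qed
  then show ?thesis by (rule tensor2I) (use e F2 in auto)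
qed

lemma cfUT_tensor2:
  assumes "F \<in> tensor2 (cfUT i) (cfUT j)"
  shows "(\<lambda>x. F (x,y)) \<in> cfUT i" "(\<lambda>y. F (x,y)) \<in> cfUT j"
  using tensor2_slices[OF assms] subsp_cfUT by auto

lemma blk_idm_UT: "I \<subseteq> {1..n} \<Longrightarrow> blk I (idm {1..n}) = idm {1..card I}"
  by (rule blk_idm) (auto intro: finite_subset)

lemma blk_mmul_UT:
  assumes "(g :: 'a::{field,finite} mat) \<in> UT (i+j)" "h \<in> UT (i+j)"
  shows "blk {1..i} (mmul {1..i+j} g h) = mmul {1..i} (blk {1..i} g) (blk {1..i} h)"
    and "blk {i+1..i+j} (mmul {1..i+j} g h) = mmul {1..j} (blk {i+1..i+j} g) (blk {i+1..i+j} h)"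
proof -
  show "blk {1..i} (mmul {1..i+j} g h) = mmul {1..i} (blk {1..i} g) (blk {1..i} h)"
  proof -
    have "blk {1..i} (mmul {1..i+j} g h) = mmul {1..card {1..i}} (blk {1..i} g) (blk {1..i} h)"
      by (rule blk_mmul) (use UT_lower[OF assms(2)] in auto)
    then show ?thesis by simp
  qed
  have "blk {i+1..i+j} (mmul {1..i+j} g h) =
      mmul {1..card {i+1..i+j}} (blk {i+1..i+j} g) (blk {i+1..i+j} h)"
  proof (rule blk_mmul)
    show "g a k = 0 \<or> h k b = 0" if "a \<in> {i+1..i+j}" "k \<in> {1..i+j} - {i+1..i+j}" for a k b
      using that UT_lower[OF assms(1), of k a] by auto
  qed auto
  then show "blk {i+1..i+j} (mmul {1..i+j} g h) = mmul {1..j} (blk {i+1..i+j} g) (blk {i+1..i+j} h)"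
    by simp
qed

lemma blk_UT_split:
  assumes "(g :: 'a::{field,finite} mat) \<in> UT (i+j)"
  shows "blk {1..i} g \<in> UT i" "blk {i+1..i+j} g \<in> UT j"
  using blk_UT[OF _ assms, of "{1..i}"] blk_UT[OF _ assms, of "{i+1..i+j}"] by auto

text \<open>Taking either diagonal block is multiplicative on upper triangular matrices, so
  conjugation in the large group induces conjugation in each tensor factor.\<close>

lemma muUT_cfUT:
  assumes F: "F \<in> tensor2 (cfUT i) (cfUT j)"
  shows "(muUT i j F :: 'a::{field,finite} mat \<Rightarrow> complex) \<in> cfUT (i+j)"
  unfolding cfUT_iff
proof (intro conjI allI ballI impI)
  fix g h h' :: "'a mat"
  assume g: "g \<in> UT (i+j)" and h: "h \<in> UT (i+j)" and h': "h' \<in> UT (i+j)"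
    and eq: "mmul {1..i+j} h h' = idm {1..i+j}"
  let ?S = "{1..i}" and ?T = "{i+1..i+j}"
  note hg = mmul_UT[OF h g]
  have 1: "mmul {1..i} (blk ?S h) (blk ?S h') = idm {1..i}"
    using blk_mmul_UT(1)[OF h h'] unfolding eq by (simp add: blk_idm_UT)
  have 2: "mmul {1..j} (blk ?T h) (blk ?T h') = idm {1..j}"
    using blk_mmul_UT(2)[OF h h'] unfolding eq by (simp add: blk_idm_UT)
  have F1: "F (mmul {1..i} (mmul {1..i} (blk ?S h) (blk ?S g)) (blk ?S h'), y) = F (blk ?S g, y)" for y
    by (rule cfUT_conj[OF cfUT_tensor2(1)[OF F] blk_UT_split(1)[OF g] blk_UT_split(1)[OF h] blk_UT_split(1)[OF h'] 1])
  have F2: "F (y, mmul {1..j} (mmul {1..j} (blk ?T h) (blk ?T g)) (blk ?T h')) = F (y, blk ?T g)" for y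
    by (rule cfUT_conj[OF cfUT_tensor2(2)[OF F] blk_UT_split(2)[OF g] blk_UT_split(2)[OF h] blk_UT_split(2)[OF h'] 2])
  show "muUT i j F (mmul {1..i+j} (mmul {1..i+j} h g) h') = muUT i j F g"
    using g hg h' F1 F2 by (simp add: muUT_apply mmul_UT blk_mmul_UT[OF hg h'] blk_mmul_UT[OF h g])
qed (simp add: muUT_apply)

section \<open>Conjugation invariance of the coproduct\<close>

lemma mmul_conj_cancel:
  assumes "supp_in {1..m} (x :: 'a::{field,finite} mat)" and "mmul {1..m} u' u = idm {1..m}"
  shows "mmul {1..m} (mmul {1..m} u' (mmul {1..m} (mmul {1..m} u x) u')) u = x"
proof -
  note A = mmul_assoc[OF finite_atLeastAtMost]
  have "mmul {1..m} (mmul {1..m} u' (mmul {1..m} (mmul {1..m} u x) u')) u =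
      mmul {1..m} (mmul {1..m} (mmul {1..m} u' u) x) (mmul {1..m} u' u)"
    by (simp only: A)
  then show ?thesis
    using assms by (simp add: mmul_idm_left mmul_idm_right)
qed

text \<open>\<open>cf_of\<close> provides \<open>h'\<close> as a right inverse of \<open>h\<close>;
  undoing a conjugation needs the other side as well.\<close>

lemma UT_left_inverse:
  assumes "(u :: 'a::{field,finite} mat) \<in> UT m" "u' \<in> UT m" "mmul {1..m} u u' = idm {1..m}"
  shows "mmul {1..m} u' u = idm {1..m}"
proof -
  obtain w where w: "w \<in> UT m" "mmul {1..m} w u = idm {1..m}" "mmul {1..m} u w = idm {1..m}"
    using UTo_inverse[OF _ sord_std_ord] assms(1) unfolding UT_def by (metis finite_atLeastAtMost)
  have "w = mmul {1..m} (mmul {1..m} w u) u'"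
    using mmul_idm_right[OF _ UT_supp[OF w(1)]] assms(3) by (simp add: mmul_assoc)
  also have "\<dots> = u'" using w(2) mmul_idm_left[OF _ UT_supp[OF assms(2)]] by simp
  finally show ?thesis using w by simp
qed

context
  fixes n :: nat and I :: "nat set" and dummy :: "'a::{field,finite} itself"
  assumes I: "I \<subseteq> {1..n}"
begin

lemma fibr_UT: "h \<in> fibr n (std_ord n) I x y \<Longrightarrow> (h :: 'a mat) \<in> UT n"
  by (simp add: fibr_def parab_def UT_def)

lemma parab_mmul:
  assumes g: "(g :: 'a mat) \<in> parab n (std_ord n) I" and h: "h \<in> parab n (std_ord n) I"
  shows "mmul {1..n} g h \<in> parab n (std_ord n) I"
    and "blk I (mmul {1..n} g h) = mmul {1..card I} (blk I g) (blk I h)"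
    and "blk ({1..n} - I) (mmul {1..n} g h) = mmul {1..n - card I} (blk ({1..n} - I) g) (blk ({1..n} - I) h)"
proof -
  have g0: "g a b = 0" and h0: "h a b = 0" if "a \<in> {1..n} - I" "b \<in> I" for a b
    using g h that by (auto simp: parab_def)
  have "mmul {1..n} g h a b = 0" if "a \<in> {1..n} - I" "b \<in> I" for a b
    unfolding mmul_def
  proof (rule sum.neutral, rule ballI)
    fix k assume "k \<in> {1..n}"
    then show "g a k * h k b = 0" using g0[of a k] h0[of k b] that by (cases "k \<in> I") auto
  qed
  then show "mmul {1..n} g h \<in> parab n (std_ord n) I"
    using g h mmul_UT[of g n h] by (simp add: parab_def UT_def)
  show "blk I (mmul {1..n} g h) = mmul {1..card I} (blk I g) (blk I h)"
    by (rule blk_mmul) (use h0 I in auto)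
  have "blk ({1..n} - I) (mmul {1..n} g h) = mmul {1..card ({1..n} - I)} (blk ({1..n} - I) g) (blk ({1..n} - I) h)"
    by (rule blk_mmul) (use g0 in auto)
  then show "blk ({1..n} - I) (mmul {1..n} g h) = mmul {1..n - card I} (blk ({1..n} - I) g) (blk ({1..n} - I) h)"
    by (simp only: card_compl[OF I])
qed

lemma levi_parab:
  assumes l: "(l :: 'a mat) \<in> levi n (std_ord n) I"
  shows "l \<in> parab n (std_ord n) I"
proof -
  have "l a b = 0" if "a \<in> {1..n} - I" "b \<in> I" for a b
    using levi_nz[OF l, of a b] that by auto
  moreover have "l \<in> UTo {1..n} (std_ord n)" using l by (simp add: levi_def)
  ultimately show ?thesis by (simp add: parab_def)
qed

lemma levi_mmul:
  assumes g: "(g :: 'a mat) \<in> levi n (std_ord n) I" and h: "h \<in> levi n (std_ord n) I"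
  shows "mmul {1..n} g h \<in> levi n (std_ord n) I"
proof -
  have "(a,b) \<in> I \<times> I \<union> ({1..n} - I) \<times> ({1..n} - I)" if ab: "a \<noteq> b" "mmul {1..n} g h a b \<noteq> 0" for a b
  proof -
    obtain k where nz: "g a k \<noteq> 0" "h k b \<noteq> 0"
      using sum.not_neutral_contains_not_neutral[OF ab(2)[unfolded mmul_def]] by auto
    have "a = k \<or> (a,k) \<in> I \<times> I \<union> ({1..n} - I) \<times> ({1..n} - I)"
      using levi_nz[OF g _ nz(1)] by blast
    moreover have "k = b \<or> (k,b) \<in> I \<times> I \<union> ({1..n} - I) \<times> ({1..n} - I)"
      using levi_nz[OF h _ nz(2)] by blast
    ultimately show ?thesis using ab(1) by blast
  qed
  moreover have "mmul {1..n} g h \<in> UTo {1..n} (std_ord n)"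
    using mmul_UT[OF levi_UT[OF g] levi_UT[OF h]] by (simp add: UT_def)
  ultimately show ?thesis unfolding levi_def by blast
qed

text \<open>A product of block diagonal matrices is block diagonal, hence determined by its blocks,
  which here are \<open>u u'\<close> and \<open>v v'\<close>.\<close>

lemma emb_inverse:
  assumes u: "(u :: 'a mat) \<in> UT (card I)" and u': "u' \<in> UT (card I)"
    and v: "v \<in> UT (n - card I)" and v': "v' \<in> UT (n - card I)"
    and uu: "mmul {1..card I} u u' = idm {1..card I}"
    and vv: "mmul {1..n - card I} v v' = idm {1..n - card I}"
  shows "mmul {1..n} (emb n I u v) (emb n I u' v') = idm {1..n}"
proof -
  note L = emb_levi_std[OF I u v] and L' = emb_levi_std[OF I u' v']
  note P = parab_mmul[OF levi_parab[OF L] levi_parab[OF L']]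
  note S = UT_supp[OF u] UT_supp[OF u'] UT_supp[OF v] UT_supp[OF v']
  have "blk I (mmul {1..n} (emb n I u v) (emb n I u' v')) = idm {1..card I}"
    using P(2) S by (simp add: blk_emb1[OF I] uu)
  moreover have "blk ({1..n} - I) (mmul {1..n} (emb n I u v) (emb n I u' v')) = idm {1..n - card I}"
    using P(3) S by (simp add: blk_emb2[OF I] vv)
  ultimately have "mmul {1..n} (emb n I u v) (emb n I u' v') = emb n I (idm {1..card I}) (idm {1..n - card I})"
    using levi_emb_blk[OF sord_std_ord I levi_mmul[OF L L']] by simp
  also have "\<dots> = emb n I (blk I (idm {1..n})) (blk ({1..n} - I) (idm {1..n}))"
    by (simp add: blk_idm_UT[OF I] blk_idm_UT[OF Diff_subset] card_compl[OF I])
  also have "\<dots> = (idm {1..n} :: 'a mat)"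
  proof (rule levi_emb_blk[OF sord_std_ord I])
    show "(idm {1..n} :: 'a mat) \<in> levi n (std_ord n) I"
      using idm_UT[of n, where 'a='a] by (auto simp: levi_def UT_def idm_def)
  qed
  finally show ?thesis .
qed

lemma fibr_conj:
  assumes h: "(h :: 'a mat) \<in> fibr n (std_ord n) I x y"
    and U: "U \<in> parab n (std_ord n) I" and U': "U' \<in> parab n (std_ord n) I"
  shows "mmul {1..n} (mmul {1..n} U h) U' \<in> fibr n (std_ord n) I
    (mmul {1..card I} (mmul {1..card I} (blk I U) x) (blk I U'))
    (mmul {1..n - card I} (mmul {1..n - card I} (blk ({1..n} - I) U) y) (blk ({1..n} - I) U'))"
proof -
  have hp: "h \<in> parab n (std_ord n) I" and xy: "blk I h = x" "blk ({1..n} - I) h = y"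
    using h by (auto simp: fibr_def)
  note P = parab_mmul[OF U hp] and Q = parab_mmul[OF parab_mmul(1)[OF U hp] U']
  show ?thesis using P Q xy by (simp add: fibr_def)
qed

text \<open>Conjugation by the block diagonal matrix with blocks \<open>u\<close> and
  \<open>v\<close> maps the fibre over \<open>(x, y)\<close> bijectively to the fibre over the
  conjugated pair, and \<open>f\<close> is invariant under it.\<close>

lemma avg_fibr_conj:
  assumes f: "f \<in> cfUT n"
    and x: "(x :: 'a mat) \<in> UT (card I)" and y: "y \<in> UT (n - card I)"
    and u: "u \<in> UT (card I)" and u': "u' \<in> UT (card I)"
    and v: "v \<in> UT (n - card I)" and v': "v' \<in> UT (n - card I)"
    and uu: "mmul {1..card I} u u' = idm {1..card I}"
    and vv: "mmul {1..n - card I} v v' = idm {1..n - card I}"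
  shows "avg (fibr n (std_ord n) I (mmul {1..card I} (mmul {1..card I} u x) u')
      (mmul {1..n - card I} (mmul {1..n - card I} v y) v')) f = avg (fibr n (std_ord n) I x y) f"
    (is "avg ?B f = avg ?A f")
proof -
  let ?U = "emb n I u v" and ?U' = "emb n I u' v'"
  note L = emb_levi_std[OF I u v] and L' = emb_levi_std[OF I u' v']
  note bl = blk_emb1[OF I UT_supp[OF u]] blk_emb1[OF I UT_supp[OF u']]
    blk_emb2[OF I UT_supp[OF v]] blk_emb2[OF I UT_supp[OF v']]
  have uu': "mmul {1..card I} u' u = idm {1..card I}" by (rule UT_left_inverse[OF u u' uu])
  have vv': "mmul {1..n - card I} v' v = idm {1..n - card I}" by (rule UT_left_inverse[OF v v' vv])
  have UU: "mmul {1..n} ?U ?U' = idm {1..n}" by (rule emb_inverse[OF u u' v v' uu vv])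
  have UU': "mmul {1..n} ?U' ?U = idm {1..n}" by (rule emb_inverse[OF u' u v' v uu' vv'])
  have "bij_betw (\<lambda>h. mmul {1..n} (mmul {1..n} ?U h) ?U') ?A ?B"
  proof (rule bij_betw_byWitness[where f'="\<lambda>h. mmul {1..n} (mmul {1..n} ?U' h) ?U"])
    show "\<forall>h\<in>?A. mmul {1..n} (mmul {1..n} ?U' (mmul {1..n} (mmul {1..n} ?U h) ?U')) ?U = h"
      using mmul_conj_cancel[OF UT_supp[OF fibr_UT] UU'] by blast
    show "\<forall>h\<in>?B. mmul {1..n} (mmul {1..n} ?U (mmul {1..n} (mmul {1..n} ?U' h) ?U)) ?U' = h"
      using mmul_conj_cancel[OF UT_supp[OF fibr_UT] UU] by blast
    show "(\<lambda>h. mmul {1..n} (mmul {1..n} ?U h) ?U') ` ?A \<subseteq> ?B"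
      using fibr_conj[OF _ levi_parab[OF L] levi_parab[OF L']] by (auto simp: bl)
    show "(\<lambda>h. mmul {1..n} (mmul {1..n} ?U' h) ?U) ` ?B \<subseteq> ?A"
    proof (rule image_subsetI)
      fix h assume "h \<in> ?B"
      from fibr_conj[OF this levi_parab[OF L'] levi_parab[OF L]]
      show "mmul {1..n} (mmul {1..n} ?U' h) ?U \<in> ?A"
        by (simp only: bl mmul_conj_cancel[OF UT_supp[OF x] uu'] mmul_conj_cancel[OF UT_supp[OF y] vv'])
    qed
  qed
  then have "avg ?B f = avg ?A (\<lambda>h. f (mmul {1..n} (mmul {1..n} ?U h) ?U'))"
    by (rule avg_bij_betw)
  also have "\<dots> = avg ?A f"
    by (rule avg_cong) (use f fibr_UT levi_UT[OF L] levi_UT[OF L'] UU in \<open>auto simp: cfUT_iff\<close>)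
  finally show ?thesis .
qed

end

lemma mmul_idm_conj:
  "(x :: 'a::{field,finite} mat) \<in> UT m \<Longrightarrow> mmul {1..m} (mmul {1..m} (idm {1..m}) x) (idm {1..m}) = x"
  by (simp add: mmul_idm_left mmul_idm_right UT_supp)

lemma DeltaUT_cfUT:
  assumes f: "(f :: 'a::{field,finite} mat \<Rightarrow> complex) \<in> cfUT (k+l)"
  shows "DeltaUT k l f \<in> tensor2 (cfUT k) (cfUT l)"
proof (rule tensor2_cfUT)
  have conj: "DeltaUT k l f (mmul {1..k} (mmul {1..k} u x) u', mmul {1..l} (mmul {1..l} v y) v') = DeltaUT k l f (x,y)"
    if "x \<in> UT k" "y \<in> UT l" "u \<in> UT k" "u' \<in> UT k" "v \<in> UT l" "v' \<in> UT l"
      "mmul {1..k} u u' = idm {1..k}" "mmul {1..l} v v' = idm {1..l}" for x y u u' v v'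
  proof -
    have "avg (fibr (k+l) (std_ord (k+l)) I (mmul {1..k} (mmul {1..k} u x) u') (mmul {1..l} (mmul {1..l} v y) v')) f =
        avg (fibr (k+l) (std_ord (k+l)) I x y) f" if I: "I \<subseteq> {1..k+l}" "card I = k" for I
      using avg_fibr_conj[OF I(1) f, of x y u u' v v'] \<open>x \<in> UT k\<close> \<open>y \<in> UT l\<close> \<open>u \<in> UT k\<close> \<open>u' \<in> UT k\<close>
        \<open>v \<in> UT l\<close> \<open>v' \<in> UT l\<close> \<open>mmul {1..k} u u' = idm {1..k}\<close> \<open>mmul {1..l} v v' = idm {1..l}\<close>
      by (simp add: I(2))
    then show ?thesis unfolding DeltaUT_apply using that by (simp add: mmul_UT)
  qed
  have z: "DeltaUT k l f (x,y) = 0" if "x \<notin> UT k \<or> y \<notin> UT l" for x y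
    using that by (auto simp: DeltaUT_apply)
  \<comment> \<open>Conjugating in one variable is conjugation in both with the identity matrix in
    the other.\<close>
  have id: "mmul {1..m} (idm {1..m}) (idm {1..m}) = (idm {1..m} :: 'a mat)" for m
    by (rule mmul_idm_left) (simp_all add: supp_in_def idm_def)
  show "(\<lambda>x. DeltaUT k l f (x,y)) \<in> cfUT k" for y
    unfolding cfUT_iff
    using conj[of _ y _ _ "idm {1..l}" "idm {1..l}"] z id idm_UT[where 'a='a] mmul_idm_conj[of y l]
    by (cases "y \<in> UT l") auto
  show "(\<lambda>y. DeltaUT k l f (x,y)) \<in> cfUT l" for x
    unfolding cfUT_iff
    using conj[of x _ "idm {1..k}" "idm {1..k}"] z id idm_UT[where 'a='a] mmul_idm_conj[of x k]
    by (cases "x \<in> UT k") auto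
qed

section \<open>Coassociativity\<close>

lemma affcomb_same [simp]: "affcomb x x z = z"
  by (simp add: affcomb_def)

lemma UT_affcomb:
  "(X :: 'a::{field,finite} mat) \<in> UT n \<Longrightarrow> Y \<in> UT n \<Longrightarrow> Z \<in> UT n \<Longrightarrow> affcomb X Y Z \<in> UT n"
  by (simp add: UT_iff affcomb_def)

lemma fibr_std_iff:
  "h \<in> fibr n (std_ord n) I x y \<longleftrightarrow> h \<in> UT n \<and> (\<forall>a\<in>{1..n} - I. \<forall>b\<in>I. h a b = 0)
     \<and> blk I h = x \<and> blk ({1..n} - I) h = y"
  by (auto simp: fibr_def parab_def UT_def)

lemma fibr_affcomb:
  "(X :: 'a::{field,finite} mat) \<in> fibr n (std_ord n) I x y \<Longrightarrow> Y \<in> fibr n (std_ord n) I x y \<Longrightarrow>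
    Z \<in> fibr n (std_ord n) I x y \<Longrightarrow> affcomb X Y Z \<in> fibr n (std_ord n) I x y"
  unfolding fibr_std_iff by (auto simp: UT_affcomb blk_affcomb) (simp add: affcomb_def)

lemma finite_fibr_std: "finite (fibr n (std_ord n) I x y :: 'a::{field,finite} mat set)"
  by (rule finite_subset[OF _ finite_UT]) (auto simp: fibr_std_iff)

lemma canoinv_image_Diff:
  assumes "finite K" "J \<subseteq> {1..card K}"
  shows "canoinv K ` ({1..card K} - J) = K - canoinv K ` J"
  using inj_on_image_set_diff[OF bij_betw_imp_inj_on[OF canoinv_bij_betw[OF assms(1)]] _ assms(2)]
    bij_betw_imp_surj_on[OF canoinv_bij_betw[OF assms(1)]] by (metis Diff_subset)

text \<open>Membership of a block of \<open>h\<close> in a fibre, rewritten as a condition on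
  \<open>h\<close> itself; this makes nested blocks comparable.\<close>

lemma blk_fibr_iff:
  fixes h :: "'a::{field,finite} mat"
  assumes K: "K \<subseteq> {1..n}" and m: "card K = m" and J: "J \<subseteq> {1..m}" and h: "h \<in> UT n"
  shows "blk K h \<in> fibr m (std_ord m) J a b \<longleftrightarrow>
    (\<forall>r\<in>K - canoinv K ` J. \<forall>s\<in>canoinv K ` J. h r s = 0) \<and>
    blk (canoinv K ` J) h = a \<and> blk (K - canoinv K ` J) h = b"
proof -
  have fK: "finite K" using K finite_subset by blast
  have J': "J \<subseteq> {1..card K}" using J m by simp
  note D = canoinv_image_Diff[OF fK J', unfolded m]
  have "(\<forall>r\<in>{1..m} - J. \<forall>s\<in>J. blk K h r s = 0) \<longleftrightarrow>
      (\<forall>r\<in>{1..m} - J. \<forall>s\<in>J. h (canoinv K r) (canoinv K s) = 0)"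
    using J by (auto simp: blk_def m subset_iff)
  also have "\<dots> \<longleftrightarrow> (\<forall>r\<in>K - canoinv K ` J. \<forall>s\<in>canoinv K ` J. h r s = 0)"
    unfolding D[symmetric] by simp
  finally have z: "(\<forall>r\<in>{1..m} - J. \<forall>s\<in>J. blk K h r s = 0) \<longleftrightarrow>
      (\<forall>r\<in>K - canoinv K ` J. \<forall>s\<in>canoinv K ` J. h r s = 0)" .
  have b: "blk ({1..m} - J) (blk K h) = blk (K - canoinv K ` J) h"
    using blk_blk[OF fK, of "{1..m} - J" h] by (simp add: D m)
  show ?thesis
    unfolding fibr_std_iff z b blk_blk[OF fK J'] using blk_UT[OF K h] by (simp add: m)
qed

text \<open>\<open>A\<close> and \<open>K\<close> are meant as a flag with \<open>A\<close> inside
  \<open>K\<close>: the matrices are block triangular along \<open>A\<close>, \<open>K - A\<close>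
  and the complement of \<open>K\<close>, with prescribed diagonal blocks. Both iterated coproducts
  are sums over flags of averages over these sets.\<close>

definition trip :: "nat \<Rightarrow> nat set \<Rightarrow> nat set \<Rightarrow> 'a::field mat \<Rightarrow> 'a mat \<Rightarrow> 'a mat \<Rightarrow> 'a mat set" where
  "trip n A K a b c = {h\<in>UT n. (\<forall>r\<in>{1..n} - K. \<forall>s\<in>K. h r s = 0) \<and> (\<forall>r\<in>K - A. \<forall>s\<in>A. h r s = 0) \<and>
     blk A h = a \<and> blk (K - A) h = b \<and> blk ({1..n} - K) h = c}"

lemma trip_affcomb:
  "(X :: 'a::{field,finite} mat) \<in> trip n A K a b c \<Longrightarrow> Y \<in> trip n A K a b c \<Longrightarrow>
    Z \<in> trip n A K a b c \<Longrightarrow> affcomb X Y Z \<in> trip n A K a b c"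
  unfolding trip_def by (auto simp: UT_affcomb blk_affcomb) (simp_all add: affcomb_def)

lemma finite_trip: "finite (trip n A K a b c :: 'a::{field,finite} mat set)"
  by (rule finite_subset[OF _ finite_UT]) (auto simp: trip_def)

lemma avg_trip:
  fixes f :: "'a::{field,finite} mat \<Rightarrow> complex"
  assumes image: "blk K ` trip n A B a b c = P"
    and fib: "\<And>g. g \<in> P \<Longrightarrow> {h\<in>trip n A B a b c. blk K h = g} = Q g"
  shows "avg (trip n A B a b c) f = avg P (\<lambda>g. avg (Q g) f)"
proof -
  have "avg (trip n A B a b c) f =
      avg (blk K ` trip n A B a b c) (\<lambda>g. avg {h\<in>trip n A B a b c. blk K h = g} f)"
    by (rule avg_fibres_affine[OF finite_trip trip_affcomb]) (auto simp: blk_affcomb)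
  also have "\<dots> = avg P (\<lambda>g. avg (Q g) f)"
    by (rule avg_cong[OF image]) (simp add: fib)
  finally show ?thesis .
qed

lemma emb_zero: "a \<in> {1..n} - I \<Longrightarrow> b \<in> I \<Longrightarrow> emb n I x y a b = 0"
  "a \<in> I \<Longrightarrow> b \<in> {1..n} - I \<Longrightarrow> emb n I x y a b = 0"
  by (auto simp: emb_def)

text \<open>The set \<open>trip\<close> is fibred over its \<open>K\<close>-block. That block ranges
  over the matrices with diagonal blocks \<open>a\<close> and \<open>b\<close>, each attained with a
  block diagonal lift by \<open>emb\<close>, and the fibre over it is again a
  \<open>fibr\<close>.\<close>

lemma avg_trip_left:
  fixes f :: "'a::{field,finite} mat \<Rightarrow> complex"
  assumes K: "K \<subseteq> {1..n}" "card K = m" and J: "J \<subseteq> {1..m}" and c: "c \<in> UT (n - m)"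
  shows "avg (trip n (canoinv K ` J) K a b c) f =
    avg (fibr m (std_ord m) J a b) (\<lambda>g. avg (fibr n (std_ord n) K g c) f)"
proof -
  have mem: "h \<in> trip n (canoinv K ` J) K a b c \<longleftrightarrow> h \<in> UT n \<and> (\<forall>r\<in>{1..n} - K. \<forall>s\<in>K. h r s = 0) \<and>
      blk K h \<in> fibr m (std_ord m) J a b \<and> blk ({1..n} - K) h = c" for h :: "'a mat"
    unfolding trip_def using blk_fibr_iff[OF K J, of h a b] by auto
  show ?thesis
  proof (rule avg_trip)
    show "blk K ` trip n (canoinv K ` J) K a b c = fibr m (std_ord m) J a b"
    proof (intro equalityI subsetI)
      fix g assume "g \<in> blk K ` trip n (canoinv K ` J) K a b c"
      then show "g \<in> fibr m (std_ord m) J a b" using mem by auto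
    next
      fix g assume g: "g \<in> fibr m (std_ord m) J a b"
      then have gU: "g \<in> UT m" by (simp add: fibr_std_iff)
      have "emb n K g c \<in> trip n (canoinv K ` J) K a b c"
        using emb_UT[OF K(1), of g c] K gU c g
        by (simp add: emb_zero(1) mem blk_emb1[OF K(1)] blk_emb2[OF K(1)] UT_supp)
      moreover have "blk K (emb n K g c) = g"
        using UT_supp[OF gU] K by (simp add: blk_emb1[OF K(1)])
      ultimately show "g \<in> blk K ` trip n (canoinv K ` J) K a b c" by (metis image_eqI)
    qed
    show "{h\<in>trip n (canoinv K ` J) K a b c. blk K h = g} = fibr n (std_ord n) K g c"
      if "g \<in> fibr m (std_ord m) J a b" for g
      using that by (intro set_eqI, unfold mem_Collect_eq mem fibr_std_iff[of _ n]) blast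
  qed
qed

text \<open>The mirror image: \<open>trip\<close> is fibred over the block on the complement of
  \<open>A\<close>, and the larger member of the flag is \<open>A\<close> together with the subset
  encoded by \<open>J\<close>.\<close>

lemma avg_trip_right:
  fixes f :: "'a::{field,finite} mat \<Rightarrow> complex"
  assumes A: "A \<subseteq> {1..n}" "n - card A = m" and J: "J \<subseteq> {1..m}" and a: "a \<in> UT (card A)"
  shows "avg (trip n A (A \<union> canoinv ({1..n} - A) ` J) a b c) f =
    avg (fibr m (std_ord m) J b c) (\<lambda>g. avg (fibr n (std_ord n) A a g) f)"
proof -
  let ?A' = "{1..n} - A" and ?B = "canoinv ({1..n} - A) ` J"
  have A': "?A' \<subseteq> {1..n}" "card ?A' = m" using card_compl[OF A(1)] A(2) by auto
  have "?B \<subseteq> ?A'" using canoinv_in[of ?A'] J A' by auto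
  then have 1: "A \<union> ?B - A = ?B" "{1..n} - (A \<union> ?B) = ?A' - ?B" by auto
  \<comment> \<open>The vanishing conditions along the flag are regrouped: those towards columns in
    \<open>A\<close> come first, the rest concerns the complement of \<open>A\<close>.\<close>
  have z: "(\<forall>r\<in>?A' - ?B. \<forall>s\<in>A \<union> ?B. h r s = 0) \<and> (\<forall>r\<in>?B. \<forall>s\<in>A. h r s = 0) \<longleftrightarrow>
     (\<forall>r\<in>?A'. \<forall>s\<in>A. h r s = 0) \<and> (\<forall>r\<in>?A' - ?B. \<forall>s\<in>?B. h r s = 0)" for h :: "'a mat"
    using \<open>?B \<subseteq> ?A'\<close> by blast
  have mem: "h \<in> trip n A (A \<union> ?B) a b c \<longleftrightarrow> h \<in> UT n \<and> (\<forall>r\<in>?A'. \<forall>s\<in>A. h r s = 0) \<and>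
      blk A h = a \<and> blk ?A' h \<in> fibr m (std_ord m) J b c" for h :: "'a mat"
  proof -
    have taut: "U \<and> P1 \<and> P2 \<and> X \<and> Y \<and> Z \<longleftrightarrow> U \<and> Q1 \<and> X \<and> F"
      if "P1 \<and> P2 \<longleftrightarrow> Q1 \<and> Q2" "U \<Longrightarrow> F \<longleftrightarrow> Q2 \<and> Y \<and> Z" for U P1 P2 Q1 Q2 X Y Z F
      using that by blast
    show ?thesis
      unfolding trip_def 1 mem_Collect_eq by (rule taut[OF z blk_fibr_iff[OF A' J]])
  qed
  show ?thesis
  proof (rule avg_trip)
    show "blk ?A' ` trip n A (A \<union> ?B) a b c = fibr m (std_ord m) J b c"
    proof (intro equalityI subsetI)
      fix g assume "g \<in> blk ?A' ` trip n A (A \<union> ?B) a b c"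
      then show "g \<in> fibr m (std_ord m) J b c" using mem by auto
    next
      fix g assume g: "g \<in> fibr m (std_ord m) J b c"
      then have gU: "g \<in> UT (n - card A)" using A by (simp add: fibr_std_iff)
      have "emb n A a g \<in> trip n A (A \<union> ?B) a b c"
        using emb_UT[OF A(1) a gU] g
        by (simp add: emb_zero(1) mem blk_emb1[OF A(1) UT_supp[OF a]] blk_emb2[OF A(1) UT_supp[OF gU]])
      moreover have "blk ?A' (emb n A a g) = g" by (rule blk_emb2[OF A(1) UT_supp[OF gU]])
      ultimately show "g \<in> blk ?A' ` trip n A (A \<union> ?B) a b c" by (metis image_eqI)
    qed
    show "{h\<in>trip n A (A \<union> ?B) a b c. blk ?A' h = g} = fibr n (std_ord n) A a g"
      if "g \<in> fibr m (std_ord m) J b c" for g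
      using that by (intro set_eqI, unfold mem_Collect_eq mem fibr_std_iff[of _ n]) blast
  qed
qed

lemma canoinv_image_bij_betw:
  assumes "finite K"
  shows "bij_betw (\<lambda>J. canoinv K ` J) {J. J \<subseteq> {1..card K} \<and> card J = i} {A. A \<subseteq> K \<and> card A = i}"
proof (rule bij_betw_byWitness[where f'="\<lambda>A. cano K ` A"])
  note b = canoinv_bij_betw[OF assms]
  have inj: "inj_on (canoinv K) J" if "J \<subseteq> {1..card K}" for J
    using bij_betw_imp_inj_on[OF b] inj_on_subset that by blast
  have inj': "inj_on (cano K) A" if "A \<subseteq> K" for A
    using that canoinv_cano[OF assms] by (intro inj_on_inverseI[where g="canoinv K"]) auto
  show "\<forall>J\<in>{J. J \<subseteq> {1..card K} \<and> card J = i}. cano K ` canoinv K ` J = J"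
    using cano_canoinv[OF assms] by (auto simp: image_image subset_iff image_iff)
  show "\<forall>A\<in>{A. A \<subseteq> K \<and> card A = i}. canoinv K ` cano K ` A = A"
    using canoinv_cano[OF assms] by (auto simp: image_image subset_iff image_iff)
  show "(\<lambda>J. canoinv K ` J) ` {J. J \<subseteq> {1..card K} \<and> card J = i} \<subseteq> {A. A \<subseteq> K \<and> card A = i}"
    using canoinv_in[OF assms] inj by (auto simp: card_image)
  show "(\<lambda>A. cano K ` A) ` {A. A \<subseteq> K \<and> card A = i} \<subseteq> {J. J \<subseteq> {1..card K} \<and> card J = i}"
    using cano_in[OF assms] inj' by (fastforce simp: card_image)
qed

lemma union_bij_betw:
  assumes "A \<subseteq> {1..n::nat}"
  shows "bij_betw (\<lambda>B. A \<union> B) {B. B \<subseteq> {1..n} - A \<and> card B = j}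
    {K. A \<subseteq> K \<and> K \<subseteq> {1..n} \<and> card K = card A + j}"
proof (rule bij_betw_byWitness[where f'="\<lambda>K. K - A"])
  have fin: "finite A" using assms finite_subset by blast
  have "card (A \<union> B) = card A + card B" if "B \<subseteq> {1..n} - A" for B
  proof (rule card_Un_disjoint[OF fin])
    show "finite B" using that by (rule finite_subset) simp
    show "A \<inter> B = {}" using that by auto
  qed
  then show "(\<lambda>B. A \<union> B) ` {B. B \<subseteq> {1..n} - A \<and> card B = j} \<subseteq> {K. A \<subseteq> K \<and> K \<subseteq> {1..n} \<and> card K = card A + j}"
    using assms by auto
  show "(\<lambda>K. K - A) ` {K. A \<subseteq> K \<and> K \<subseteq> {1..n} \<and> card K = card A + j} \<subseteq> {B. B \<subseteq> {1..n} - A \<and> card B = j}"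
    using fin by (auto simp: card_Diff_subset)
qed auto

text \<open>Both sides enumerate flags \<open>A\<close> inside \<open>K\<close> of sizes
  \<open>i\<close> and \<open>i + j\<close>: the left side chooses \<open>K\<close> first and then
  \<open>A\<close> within it, the right side \<open>A\<close> first and then \<open>K - A\<close> in
  the complement.\<close>

lemma DeltaUT_coassoc:
  fixes f :: "'a::{field,finite} mat \<Rightarrow> complex"
  shows "lft_D (DeltaUT i j) (DeltaUT (i+j) k f) = rgt_D (DeltaUT j k) (DeltaUT i (j+k) f)"
proof (rule ext, clarify)
  fix a b c :: "'a mat"
  show "lft_D (DeltaUT i j) (DeltaUT (i+j) k f) (a,b,c) = rgt_D (DeltaUT j k) (DeltaUT i (j+k) f) (a,b,c)"
  proof (cases "a \<in> UT i \<and> b \<in> UT j \<and> c \<in> UT k")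
    case False
    then show ?thesis
      by (auto simp: lft_D_def rgt_D_def DeltaUT_apply avg_def)
  next
    case True
    define n where "n = i + j + k"
    define KK where "KK = {K. K \<subseteq> {1..n} \<and> card K = i+j}"
    define AA where "AA = {A. A \<subseteq> {1..n} \<and> card A = i}"
    have fin: "finite KK" "finite AA"
      by (auto simp: KK_def AA_def intro: finite_subset[OF _ finite_Pow_iff[THEN iffD2]])
    let ?t = "\<lambda>A K. avg (trip n A K a b c) f"
    have "lft_D (DeltaUT i j) (DeltaUT (i+j) k f) (a,b,c) =
        (\<Sum>J\<in>{J. J \<subseteq> {1..i+j} \<and> card J = i}. avg (fibr (i+j) (std_ord (i+j)) J a b)
          (\<lambda>g. \<Sum>K\<in>KK. avg (fibr n (std_ord n) K g c) f))"
      using True by (auto simp: lft_D_def DeltaUT_apply n_def KK_def fibr_std_iff intro!: sum.cong avg_cong)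
    also have "\<dots> = (\<Sum>J\<in>{J. J \<subseteq> {1..i+j} \<and> card J = i}. \<Sum>K\<in>KK. ?t (canoinv K ` J) K)"
      unfolding avg_sum
      by (intro sum.cong refl, rule avg_trip_left[symmetric]) (use True in \<open>auto simp: KK_def n_def\<close>)
    also have "\<dots> = (\<Sum>K\<in>KK. \<Sum>J\<in>{J. J \<subseteq> {1..i+j} \<and> card J = i}. ?t (canoinv K ` J) K)"
      by (rule sum.swap)
    also have "\<dots> = (\<Sum>K\<in>KK. \<Sum>A\<in>{A\<in>AA. A \<subseteq> K}. ?t A K)"
    proof (rule sum.cong[OF refl])
      fix K assume "K \<in> KK"
      then have K: "K \<subseteq> {1..n}" "card K = i+j" by (auto simp: KK_def)
      then have "finite K" using finite_subset by blast
      have AK: "{A\<in>AA. A \<subseteq> K} = {A. A \<subseteq> K \<and> card A = i}" using K by (auto simp: AA_def)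
      show "(\<Sum>J\<in>{J. J \<subseteq> {1..i+j} \<and> card J = i}. ?t (canoinv K ` J) K) = (\<Sum>A\<in>{A\<in>AA. A \<subseteq> K}. ?t A K)"
        unfolding AK
        using sum.reindex_bij_betw[OF canoinv_image_bij_betw[OF \<open>finite K\<close>], of "\<lambda>A. ?t A K" i] K by simp
    qed
    \<comment> \<open>Double counting of flags.\<close>
    also have "\<dots> = (\<Sum>A\<in>AA. \<Sum>K\<in>{K\<in>KK. A \<subseteq> K}. ?t A K)"
      by (rule sum.swap_restrict[OF fin])
    also have "\<dots> = (\<Sum>A\<in>AA. \<Sum>J\<in>{J. J \<subseteq> {1..j+k} \<and> card J = j}. ?t A (A \<union> canoinv ({1..n} - A) ` J))"
    proof (rule sum.cong[OF refl])
      fix A assume "A \<in> AA"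
      then have A: "A \<subseteq> {1..n}" "card A = i" by (auto simp: AA_def)
      have AK: "{K\<in>KK. A \<subseteq> K} = {K. A \<subseteq> K \<and> K \<subseteq> {1..n} \<and> card K = card A + j}"
        using A by (auto simp: KK_def)
      have c: "card ({1..n} - A) = j+k" using card_compl[OF A(1)] A(2) by (simp add: n_def)
      have f: "finite ({1..n} - A)" by simp
      show "(\<Sum>K\<in>{K\<in>KK. A \<subseteq> K}. ?t A K) =
          (\<Sum>J\<in>{J. J \<subseteq> {1..j+k} \<and> card J = j}. ?t A (A \<union> canoinv ({1..n} - A) ` J))"
        unfolding AK
        using sum.reindex_bij_betw[OF union_bij_betw[OF A(1)], of "\<lambda>K. ?t A K" j]
          sum.reindex_bij_betw[OF canoinv_image_bij_betw[OF f], of "\<lambda>B. ?t A (A \<union> B)" j] c by simp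
    qed
    also have "\<dots> = (\<Sum>J\<in>{J. J \<subseteq> {1..j+k} \<and> card J = j}. \<Sum>A\<in>AA. ?t A (A \<union> canoinv ({1..n} - A) ` J))"
      by (rule sum.swap)
    also have "\<dots> = (\<Sum>J\<in>{J. J \<subseteq> {1..j+k} \<and> card J = j}. avg (fibr (j+k) (std_ord (j+k)) J b c)
          (\<lambda>g. \<Sum>A\<in>AA. avg (fibr n (std_ord n) A a g) f))"
      unfolding avg_sum
      by (intro sum.cong refl, rule avg_trip_right) (use True in \<open>auto simp: AA_def n_def\<close>)
    also have "\<dots> = rgt_D (DeltaUT j k) (DeltaUT i (j+k) f) (a,b,c)"
      using True by (auto simp: rgt_D_def DeltaUT_apply n_def AA_def fibr_std_iff add.assoc intro!: sum.cong avg_cong)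
    finally show ?thesis .
  qed
qed

section \<open>Compatibility of product and coproduct\<close>

lemma avg_swap: "avg A (\<lambda>a. avg B (\<lambda>b. f a b)) = avg B (\<lambda>b. avg A (\<lambda>a. f a b))"
  unfolding avg_def by (simp add: sum_divide_distrib[symmetric] sum.swap[of _ A B] mult.commute)

lemma plus_interval: "(+) (i::nat) ` {a..b} = {i+a..i+b}"
  by (simp add: add.commute)

lemma card_plus_image: "card ((+) (i::nat) ` J) = card J"
  by (simp add: card_image)

text \<open>All of \<open>K1\<close> precedes the shifted \<open>K2\<close>, so the concatenation of
  the two enumerations is increasing and \<open>canoinv_unique\<close> applies.\<close>

lemma canoinv_Un:
  fixes K1 K2 :: "nat set"
  assumes K1: "K1 \<subseteq> {1..i}" and K2: "K2 \<subseteq> {1..j}"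
  defines "K \<equiv> K1 \<union> (+) i ` K2"
  shows "r \<in> {1..card K1} \<Longrightarrow> canoinv K r = canoinv K1 r"
    and "r \<in> {1..card K2} \<Longrightarrow> canoinv K (card K1 + r) = i + canoinv K2 r"
    and "card K = card K1 + card K2"
proof -
  define a where "a = card K1"
  define b where "b = card K2"
  define f where "f r = (if r \<le> a then canoinv K1 r else i + canoinv K2 (r - a))" for r
  have fin: "finite K1" "finite K2" using K1 K2 finite_subset by blast+
  have "K1 \<inter> (+) i ` K2 = {}" using K1 K2 by fastforce
  then show "card K = card K1 + card K2"
    unfolding K_def using fin by (simp add: card_Un_disjoint card_plus_image)
  have c1: "canoinv K1 r \<le> i" if "1 \<le> r" "r \<le> a" for r
    using canoinv_in[OF fin(1), of r] that K1 by (auto simp: a_def)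
  have c2: "1 \<le> canoinv K2 r" if "1 \<le> r" "r \<le> b" for r
    using canoinv_in[OF fin(2), of r] that K2 by (auto simp: b_def)
  have mono: "f r < f s" if rs: "r < s" "1 \<le> r" "s \<le> a + b" for r s
  proof -
    consider "s \<le> a" | "r \<le> a" "a < s" | "a < r" by linarith
    then show ?thesis
    proof cases
      case 1
      then show ?thesis using canoinv_less[OF fin(1), of r s] rs by (simp add: f_def a_def)
    next
      case 2
      then have "canoinv K1 r \<le> i" "1 \<le> canoinv K2 (s - a)" using c1[of r] c2[of "s - a"] rs by auto
      then show ?thesis using 2 by (simp add: f_def)
    next
      case 3
      then have "canoinv K2 (r - a) < canoinv K2 (s - a)"
        using rs by (intro canoinv_less[OF fin(2)]) (auto simp: b_def)
      then show ?thesis using 3 rs by (simp add: f_def)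
    qed
  qed
  have s1: "canoinv K1 ` {1..a} = K1" and s2: "canoinv K2 ` {1..b} = K2"
    using bij_betw_imp_surj_on[OF canoinv_bij_betw] fin by (auto simp: a_def b_def)
  have "{1..a+b} = {1..a} \<union> (+) a ` {1..b}" by (auto simp: image_iff)
  moreover have "f ` {1..a} = K1" using s1 by (auto simp: f_def image_iff)
  moreover have "f ` ((+) a ` {1..b}) = (+) i ` canoinv K2 ` {1..b}"
    unfolding image_image by (rule image_cong) (auto simp: f_def)
  ultimately have img: "f ` {1..a+b} = K" by (simp add: image_Un s2 K_def)
  note u = canoinv_unique[of "a+b" f K, OF mono img]
  show "r \<in> {1..card K1} \<Longrightarrow> canoinv K r = canoinv K1 r" using u[of r] by (simp add: f_def a_def)
  show "r \<in> {1..card K2} \<Longrightarrow> canoinv K (card K1 + r) = i + canoinv K2 r"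
    using u[of "a + r"] by (simp add: f_def a_def b_def)
qed

lemma blk_blk_Un:
  fixes K1 K2 :: "nat set"
  assumes K1: "K1 \<subseteq> {1..i}" and K2: "K2 \<subseteq> {1..j}"
  defines "K \<equiv> K1 \<union> (+) i ` K2"
  shows "blk {1..card K1} (blk K h) = blk K1 h"
    and "blk {card K1 + 1..card K1 + card K2} (blk K h) = blk ((+) i ` K2) h"
proof -
  have fin: "finite K1" "finite K2" using K1 K2 finite_subset by blast+
  then have fK: "finite K" by (simp add: K_def)
  note c = canoinv_Un[OF K1 K2, folded K_def]
  have "canoinv K ` {1..card K1} = canoinv K1 ` {1..card K1}" by (rule image_cong) (simp_all add: c)
  then have 1: "canoinv K ` {1..card K1} = K1"
    using bij_betw_imp_surj_on[OF canoinv_bij_betw[OF fin(1)]] by simp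
  have "{card K1 + 1..card K1 + card K2} = (+) (card K1) ` {1..card K2}"
    by (simp add: plus_interval)
  then have "canoinv K ` {card K1 + 1..card K1 + card K2} = (\<lambda>r. canoinv K (card K1 + r)) ` {1..card K2}"
    by (simp only: image_image)
  also have "\<dots> = (\<lambda>r. i + canoinv K2 r) ` {1..card K2}"
    by (rule image_cong) (simp_all only: c(2))
  also have "\<dots> = (+) i ` canoinv K2 ` {1..card K2}" by (simp add: image_image)
  also have "\<dots> = (+) i ` K2"
    using bij_betw_imp_surj_on[OF canoinv_bij_betw[OF fin(2)]] by simp
  finally have 2: "canoinv K ` {card K1 + 1..card K1 + card K2} = (+) i ` K2" .
  show "blk {1..card K1} (blk K h) = blk K1 h"
    by (subst blk_blk[OF fK]) (simp_all only: 1, simp add: c(3))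
  show "blk {card K1 + 1..card K1 + card K2} (blk K h) = blk ((+) i ` K2) h"
    by (subst blk_blk[OF fK]) (simp_all only: 2, simp add: c(3))
qed

lemma canoinv_interval_image:
  "K1 \<subseteq> {1..i} \<Longrightarrow> canoinv {1..i} ` K1 = K1"
  "K2 \<subseteq> {1..j} \<Longrightarrow> canoinv {i+1..i+j} ` K2 = (+) i ` K2"
proof -
  assume "K1 \<subseteq> {1..i}"
  then have "canoinv {1..i} ` K1 = (\<lambda>x. x) ` K1"
    by (intro image_cong refl) (use canoinv_from_1 in blast)
  then show "canoinv {1..i} ` K1 = K1" by simp
next
  assume "K2 \<subseteq> {1..j}"
  then show "canoinv {i+1..i+j} ` K2 = (+) i ` K2"
    by (intro image_cong refl) (use canoinv_atLeastAtMost in blast)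
qed

text \<open>This is the geometric content of the bialgebra axiom. The diagonal blocks of the cut at
  \<open>i\<close> satisfy separate conditions, one for \<open>K1\<close> and one for
  \<open>K2\<close>; the remaining conditions concern the upper right block of the cut, and there
  they can always be met whatever the diagonal blocks are.\<close>

lemma fibr_split_image:
  fixes X Y :: "'a::{field,finite} mat"
  assumes K1: "K1 \<subseteq> {1..i}" and K2: "K2 \<subseteq> {1..j}"
  defines "a \<equiv> card K1" and "b \<equiv> card K2" and "K \<equiv> K1 \<union> (+) i ` K2"
  assumes X: "X \<in> UT (a+b)" and Y: "Y \<in> UT ((i-a)+(j-b))"
  shows "(\<lambda>h. (blk {1..i} h, blk {i+1..i+j} h)) ` fibr (i+j) (std_ord (i+j)) K X Y =
    fibr i (std_ord i) K1 (blk {1..a} X) (blk {1..i-a} Y) \<times>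
    fibr j (std_ord j) K2 (blk {a+1..a+b} X) (blk {i-a+1..(i-a)+(j-b)} Y)"
    (is "_ ` ?F = ?F1 \<times> ?F2")
proof -
  define n where "n = i + j"
  let ?S = "{1..i}" and ?T = "{i+1..i+j}"
  define L1 where "L1 = ?S - K1"
  define L2 where "L2 = {1..j} - K2"
  define K' where "K' = L1 \<union> (+) i ` L2"
  have TK2: "?T - (+) i ` K2 = (+) i ` L2"
  proof -
    have T: "?T = (+) i ` {1..j}" by (simp add: add.commute)
    show ?thesis unfolding L2_def T by (rule image_set_diff[symmetric]) simp
  qed
  have L: "L1 \<subseteq> {1..i}" "L2 \<subseteq> {1..j}" by (auto simp: L1_def L2_def)
  have cL: "card L1 = i - a" "card L2 = j - b"
    using card_compl[OF K1] card_compl[OF K2] by (auto simp: L1_def L2_def a_def b_def)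
  have iK2: "(+) i ` K2 \<subseteq> ?T" "(+) i ` L2 \<subseteq> ?T" using K2 L(2) by auto
  have Kn: "K \<subseteq> {1..n}" using K1 iK2 by (auto simp: K_def n_def)
  have K': "{1..n} - K = K'"
  proof -
    have "{1..n} - K = (?S - K1) \<union> (?T - (+) i ` K2)"
      using K1 iK2 by (auto simp: K_def n_def)
    then show ?thesis unfolding TK2 by (simp add: K'_def L1_def)
  qed
  have cK: "card K = a + b" using canoinv_Un(3)[OF K1 K2] by (simp add: K_def a_def b_def)
  have ncK: "n - card K = (i-a)+(j-b)"
    using canoinv_Un(3)[OF L] card_compl[OF Kn] by (simp add: K' K'_def cL)
  note bK = blk_blk_Un[OF K1 K2, folded K_def a_def b_def]
  note bK' = blk_blk_Un[OF L, folded K'_def, unfolded cL]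
  have S: "?S \<subseteq> {1..n}" "card ?S = i" and T: "?T \<subseteq> {1..n}" "card ?T = j" and nS: "{1..n} - ?S = ?T"
    by (auto simp: n_def)
  have m1: "blk ?S h \<in> fibr i (std_ord i) K1 p r \<longleftrightarrow>
      (\<forall>x\<in>L1. \<forall>y\<in>K1. h x y = 0) \<and> blk K1 h = p \<and> blk L1 h = r" if "h \<in> UT n" for h :: "'a mat" and p r
    using blk_fibr_iff[OF S K1 that] by (simp only: canoinv_interval_image(1)[OF K1] L1_def)
  have m2: "blk ?T h \<in> fibr j (std_ord j) K2 q s \<longleftrightarrow>
      (\<forall>x\<in>(+) i ` L2. \<forall>y\<in>(+) i ` K2. h x y = 0) \<and> blk ((+) i ` K2) h = q \<and> blk ((+) i ` L2) h = s"
    if "h \<in> UT n" for h :: "'a mat" and q s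
    using blk_fibr_iff[OF T K2 that] by (simp only: canoinv_interval_image(2)[OF K2] TK2)
  have fibK: "h \<in> ?F \<longleftrightarrow> h \<in> UT n \<and> (\<forall>x\<in>K'. \<forall>y\<in>K. h x y = 0) \<and> blk K h = X \<and> blk K' h = Y" for h
    unfolding fibr_std_iff n_def[symmetric] K' ..
  show ?thesis
  proof (intro equalityI subsetI)
    fix p assume "p \<in> (\<lambda>h. (blk ?S h, blk ?T h)) ` ?F"
    then obtain h where h: "h \<in> UT n" "\<forall>x\<in>K'. \<forall>y\<in>K. h x y = 0" "blk K h = X" "blk K' h = Y"
      and p: "p = (blk ?S h, blk ?T h)" using fibK by auto
    have "blk ?S h \<in> ?F1"
      unfolding m1[OF h(1)] using h(2) bK(1)[of h] bK'(1)[of h] unfolding h(3,4) by (simp add: K_def K'_def)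
    moreover have "blk ?T h \<in> ?F2"
      unfolding m2[OF h(1)] using h(2) bK(2)[of h] bK'(2)[of h] unfolding h(3,4) by (simp add: K_def K'_def)
    ultimately show "p \<in> ?F1 \<times> ?F2" by (simp add: p)
  next
    fix p assume "p \<in> ?F1 \<times> ?F2"
    then obtain h1 h2 where h1: "h1 \<in> ?F1" and h2: "h2 \<in> ?F2" and p: "p = (h1, h2)" by auto
    then have U: "h1 \<in> UT (card ?S)" "h2 \<in> UT (n - card ?S)" by (auto simp: fibr_std_iff n_def)
    define M where "M = emb n K X Y"
    define N where "N = emb n ?S h1 h2"
    \<comment> \<open>The diagonal blocks of the cut are taken from \<open>h1\<close> and
      \<open>h2\<close>. On the upper right block the entries of \<open>M\<close> are right: they
      are those of \<open>X\<close> on pairs in \<open>K\<close>, those of \<open>Y\<close> on pairs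
      in \<open>K'\<close>, and 0 on mixed pairs.\<close>
    define h where "h = (\<lambda>x y. if x \<in> ?S \<and> y \<in> ?T then M x y else N x y)"
    have XU: "X \<in> UT (card K)" and YU: "Y \<in> UT (n - card K)" using X Y by (simp_all only: ncK, simp only: cK)
    have MU: "M \<in> UT n" unfolding M_def by (rule emb_UT[OF Kn XU YU])
    have NU: "N \<in> UT n" unfolding N_def by (rule emb_UT[OF S(1) U])
    have hU: "h \<in> UT n" using MU NU by (auto simp: h_def UT_iff)
    have MX: "blk K M = X" "blk K' M = Y"
      using blk_emb1[OF Kn UT_supp[OF XU]] blk_emb2[OF Kn UT_supp[OF YU]] by (simp_all only: M_def K')
    have Mz: "M x y = 0" if "x \<in> K \<and> y \<in> K' \<or> x \<in> K' \<and> y \<in> K" for x y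
      using that emb_zero[where n=n and I=K] unfolding M_def K'[symmetric] by blast
    have NS: "blk ?S N = h1" and NT: "blk ?T N = h2"
      using blk_emb1[OF S(1) UT_supp[OF U(1)]] blk_emb2[OF S(1) UT_supp[OF U(2)]]
      by (simp_all only: N_def nS)
    have hS: "blk ?S h = h1"
      unfolding NS[symmetric] by (subst blk_eq_iff) (auto simp: h_def)
    have hT: "blk ?T h = h2"
      unfolding NT[symmetric] by (subst blk_eq_iff) (auto simp: h_def)
    note c1 = h1[folded hS, unfolded m1[OF hU]] and c2 = h2[folded hT, unfolded m2[OF hU]]
    have fin: "finite K1" "finite ((+) i ` K2)" "finite L1" "finite ((+) i ` L2)" "finite K" "finite K'"
      using finite_subset[OF K1] finite_subset[OF iK2(1)] finite_subset[OF L(1)] finite_subset[OF iK2(2)]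
      by (auto simp: K_def K'_def)
    have e: "h x y = M x y" if xy: "x \<in> K1 \<and> y \<in> K1 \<or> x \<in> (+) i ` K2 \<and> y \<in> (+) i ` K2
       \<or> x \<in> L1 \<and> y \<in> L1 \<or> x \<in> (+) i ` L2 \<and> y \<in> (+) i ` L2" for x y
    proof -
      have "blk K1 h = blk K1 M" "blk ((+) i ` K2) h = blk ((+) i ` K2) M"
        using c1 c2 bK[of M] by (simp_all add: MX)
      moreover have "blk L1 h = blk L1 M" "blk ((+) i ` L2) h = blk ((+) i ` L2) M"
        using c1 c2 bK'[of M] by (simp_all add: MX)
      ultimately show ?thesis using xy unfolding blk_eq_iff[OF fin(1)] blk_eq_iff[OF fin(2)]
        blk_eq_iff[OF fin(3)] blk_eq_iff[OF fin(4)] by blast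
    qed
    have e2: "h x y = M x y" if "x \<in> ?S" "y \<in> ?T" for x y using that by (simp add: h_def)
    have e3: "h x y = M x y" if "x \<in> ?T" "y \<in> ?S" for x y
      using UT_lower[OF hU, of y x] UT_lower[OF MU, of y x] that by auto
    have "h x y = M x y" if "x \<in> K" "y \<in> K" for x y
      using that e[of x y] e2[of x y] e3[of x y] K1 iK2 unfolding K_def by blast
    then have 1: "blk K h = X" unfolding MX(1)[symmetric] blk_eq_iff[OF fin(5)] by blast
    have "h x y = M x y" if "x \<in> K'" "y \<in> K'" for x y
      using that e[of x y] e2[of x y] e3[of x y] L iK2 unfolding K'_def by blast
    then have 2: "blk K' h = Y" unfolding MX(2)[symmetric] blk_eq_iff[OF fin(6)] by blast
    \<comment> \<open>Within a diagonal block of the cut the entry vanishes by the conditions on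
      \<open>h1\<close> and \<open>h2\<close>; elsewhere \<open>h\<close> agrees with
      \<open>M\<close>, which vanishes on mixed pairs.\<close>
    have 3: "h x y = 0" if xy: "x \<in> K'" "y \<in> K" for x y
    proof -
      have "x \<in> L1 \<and> y \<in> K1 \<or> x \<in> (+) i ` L2 \<and> y \<in> (+) i ` K2 \<or> x \<in> ?S \<and> y \<in> ?T \<or> x \<in> ?T \<and> y \<in> ?S"
        using xy K1 L iK2 unfolding K_def K'_def by blast
      then show ?thesis using c1 c2 e2[of x y] e3[of x y] Mz[of x y] xy by metis
    qed
    have "h \<in> ?F" unfolding fibK using hU 1 2 3 by blast
    then show "p \<in> (\<lambda>h. (blk ?S h, blk ?T h)) ` ?F" using hS hT p by force
  qed
qed

text \<open>The product depends on \<open>h\<close> through its two diagonal blocks alone, so the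
  average is pushed forward to the pairs of blocks; these form a product set, over which averaging
  is iterated.\<close>

lemma avg_fibr_split:
  fixes X Y :: "'a::{field,finite} mat"
  assumes K1: "K1 \<subseteq> {1..i}" and K2: "K2 \<subseteq> {1..j}"
    and X: "X \<in> UT (card K1 + card K2)" and Y: "Y \<in> UT ((i - card K1) + (j - card K2))"
  shows "avg (fibr (i+j) (std_ord (i+j)) (K1 \<union> (+) i ` K2) X Y) (muUT i j F) =
    avg (fibr j (std_ord j) K2 (blk {card K1 + 1..card K1 + card K2} X)
        (blk {i - card K1 + 1..(i - card K1) + (j - card K2)} Y)) (\<lambda>y.
      avg (fibr i (std_ord i) K1 (blk {1..card K1} X) (blk {1..i - card K1} Y)) (\<lambda>x. F (x, y)))"
proof -
  let ?H = "fibr (i+j) (std_ord (i+j)) (K1 \<union> (+) i ` K2) X Y"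
  let ?\<pi> = "\<lambda>h. (blk {1..i} h, blk {i+1..i+j} h)"
  have "avg ?H (muUT i j F) = avg ?H (\<lambda>h. F (?\<pi> h))"
    by (rule avg_cong) (auto simp: muUT_apply fibr_std_iff)
  also have "\<dots> = avg (?\<pi> ` ?H) F"
    by (rule avg_pushforward[OF finite_fibr_std fibr_affcomb]) (auto simp: blk_affcomb)
  also note fibr_split_image[OF K1 K2 X Y]
  finally show ?thesis unfolding avg_Times by (subst avg_swap)
qed

text \<open>Here \<open>a\<close> counts the elements of \<open>K\<close> up to \<open>i\<close>.
  The order of the inner sums matches the nesting of the two coproducts in the bialgebra
  axiom.\<close>

lemma sum_subsets_split:
  fixes G :: "nat set \<Rightarrow> complex"
  shows "(\<Sum>K\<in>{K. K \<subseteq> {1..i+j} \<and> card K = k}. G K) =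
    (\<Sum>a\<in>{a. a \<le> i \<and> a \<le> k \<and> k - a \<le> j}. \<Sum>K2\<in>{K. K \<subseteq> {1..j} \<and> card K = k - a}.
      \<Sum>K1\<in>{K. K \<subseteq> {1..i} \<and> card K = a}. G (K1 \<union> (+) i ` K2))"
proof -
  have fin: "finite {K. K \<subseteq> {1..m::nat} \<and> card K = c}" for m c
    by (rule finite_subset[of _ "Pow {1..m}"]) auto
  have c1: "card K \<le> m" if "K \<subseteq> {1..m}" for K m
    using card_mono[OF finite_atLeastAtMost that] by simp
  have dec: "K \<inter> {1..i} \<union> (+) i ` {x\<in>{1..j}. i + x \<in> K} = K" if "K \<subseteq> {1..i+j}" for K
  proof (intro equalityI subsetI)
    fix x assume x: "x \<in> K"
    show "x \<in> K \<inter> {1..i} \<union> (+) i ` {x\<in>{1..j}. i + x \<in> K}"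
    proof (cases "x \<le> i")
      case True
      then show ?thesis using x that by auto
    next
      case False
      then have "x - i \<in> {x\<in>{1..j}. i + x \<in> K}" "x = i + (x - i)" using x that by auto
      then show ?thesis by blast
    qed
  qed auto
  have c2: "card (K1 \<union> (+) i ` K2) = card K1 + card K2" if "K1 \<subseteq> {1..i}" "K2 \<subseteq> {1..j}" for K1 K2
    by (rule canoinv_Un(3)[OF that])
  have dec2: "(K1 \<union> (+) i ` K2) \<inter> {1..i} = K1" "{x\<in>{1..j}. i + x \<in> K1 \<union> (+) i ` K2} = K2"
    "K1 \<union> (+) i ` K2 \<subseteq> {1..i+j}"
    if "K1 \<subseteq> {1..i}" "K2 \<subseteq> {1..j}" for K1 K2
    using that by auto
  let ?I = "SIGMA a:{a. a \<le> i \<and> a \<le> k \<and> k - a \<le> j}. {K. K \<subseteq> {1..j} \<and> card K = k - a} \<times> {K. K \<subseteq> {1..i} \<and> card K = a}"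
  have "(\<Sum>K\<in>{K. K \<subseteq> {1..i+j} \<and> card K = k}. G K) = (\<Sum>(a,K2,K1)\<in>?I. G (K1 \<union> (+) i ` K2))"
  proof (rule sum.reindex_bij_witness[where i="\<lambda>(a,K2,K1). K1 \<union> (+) i ` K2"
        and j="\<lambda>K. (card (K \<inter> {1..i}), {x\<in>{1..j}. i + x \<in> K}, K \<inter> {1..i})"])
    fix K assume K: "K \<in> {K. K \<subseteq> {1..i+j} \<and> card K = k}"
    then have d: "K \<inter> {1..i} \<union> (+) i ` {x\<in>{1..j}. i + x \<in> K} = K" using dec by blast
    show "(\<lambda>(a,K2,K1). K1 \<union> (+) i ` K2) (card (K \<inter> {1..i}), {x\<in>{1..j}. i + x \<in> K}, K \<inter> {1..i}) = K"
      using d by simp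
    show "(\<lambda>(a,K2,K1). G (K1 \<union> (+) i ` K2)) (card (K \<inter> {1..i}), {x\<in>{1..j}. i + x \<in> K}, K \<inter> {1..i}) = G K"
      using d by simp
    have "k = card (K \<inter> {1..i}) + card {x\<in>{1..j}. i + x \<in> K}"
    proof -
      have "K \<inter> {1..i} \<subseteq> {1..i}" "{x\<in>{1..j}. i + x \<in> K} \<subseteq> {1..j}" by blast+
      from c2[OF this] show ?thesis using K unfolding d by simp
    qed
    moreover have "card (K \<inter> {1..i}) \<le> i" "card {x\<in>{1..j}. i + x \<in> K} \<le> j"
      by (rule c1, blast)+
    ultimately show "(card (K \<inter> {1..i}), {x\<in>{1..j}. i + x \<in> K}, K \<inter> {1..i}) \<in> ?I" by auto
  next
    fix p assume "p \<in> ?I"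
    then obtain a K1 K2 where p: "p = (a, K2, K1)" and a: "a \<le> k" "card K1 = a" "card K2 = k - a"
      and K: "K1 \<subseteq> {1..i}" "K2 \<subseteq> {1..j}" by auto
    show "(\<lambda>K. (card (K \<inter> {1..i}), {x\<in>{1..j}. i + x \<in> K}, K \<inter> {1..i})) ((\<lambda>(a,K2,K1). K1 \<union> (+) i ` K2) p) = p"
      unfolding p prod.case dec2[OF K] a(2) ..
    show "(\<lambda>(a,K2,K1). K1 \<union> (+) i ` K2) p \<in> {K. K \<subseteq> {1..i+j} \<and> card K = k}"
      unfolding p prod.case using dec2(3)[OF K] c2[OF K] a by simp
  qed
  also have "\<dots> = (\<Sum>a\<in>{a. a \<le> i \<and> a \<le> k \<and> k - a \<le> j}.
     \<Sum>(K2,K1)\<in>{K. K \<subseteq> {1..j} \<and> card K = k - a} \<times> {K. K \<subseteq> {1..i} \<and> card K = a}. G (K1 \<union> (+) i ` K2))"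
    by (rule sum.Sigma[symmetric]) (auto intro: fin)
  finally show ?thesis by (simp add: sum.cartesian_product)
qed

text \<open>Each index set \<open>K\<close> of the coproduct is a subset of the first
  \<open>i\<close> positions together with a shifted subset of the last \<open>j\<close>. By
  \<open>avg_fibr_split\<close> its summand is a nested average, and summing over subsets of fixed
  sizes gives the nested coproducts evaluated at the diagonal blocks of \<open>X\<close> and
  \<open>Y\<close>.\<close>

lemma DeltaUT_muUT:
  fixes F :: "'a::{field,finite} mat \<times> 'a mat \<Rightarrow> complex"
  assumes n: "i + j = k + l"
  shows "DeltaUT k l (muUT i j F) = (\<lambda>(X,Y). \<Sum>a\<in>{a. a \<le> i \<and> a \<le> k \<and> k - a \<le> j}.
     muUT (i - a) (j - (k - a)) (\<lambda>(r,s). muUT a (k - a) (\<lambda>(p,q).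
       DeltaUT (k - a) (j - (k - a)) (\<lambda>y. DeltaUT a (i - a) (\<lambda>x. F (x,y)) (p,r)) (q,s)) X) Y)"
proof (rule ext, clarify)
  fix X Y :: "'a mat"
  \<comment> \<open>These equations between truncated differences hold on the index set of the sum;
    they identify the degrees occurring on the two sides.\<close>
  have kl: "a + (k - a) = k" "i - a + (j - (k - a)) = l" "a + (i - a) = i" "k - a + (j - (k - a)) = j"
    if "a \<in> {a. a \<le> i \<and> a \<le> k \<and> k - a \<le> j}" for a using that n by auto
  let ?A = "{a. a \<le> i \<and> a \<le> k \<and> k - a \<le> j}"
  show "DeltaUT k l (muUT i j F) (X,Y) = (\<Sum>a\<in>?A.
     muUT (i - a) (j - (k - a)) (\<lambda>(r,s). muUT a (k - a) (\<lambda>(p,q).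
       DeltaUT (k - a) (j - (k - a)) (\<lambda>y. DeltaUT a (i - a) (\<lambda>x. F (x,y)) (p,r)) (q,s)) X) Y)"
  proof (cases "X \<in> UT k \<and> Y \<in> UT l")
    case False
    then have "DeltaUT k l (muUT i j F) (X,Y) = 0" by (auto simp: DeltaUT_apply)
    also have "0 = (\<Sum>a\<in>?A.
     muUT (i - a) (j - (k - a)) (\<lambda>(r,s). muUT a (k - a) (\<lambda>(p,q).
       DeltaUT (k - a) (j - (k - a)) (\<lambda>y. DeltaUT a (i - a) (\<lambda>x. F (x,y)) (p,r)) (q,s)) X) Y)"
    proof (rule sum.neutral[symmetric], rule ballI)
      fix a assume a: "a \<in> ?A"
      show "muUT (i - a) (j - (k - a)) (\<lambda>(r,s). muUT a (k - a) (\<lambda>(p,q).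
       DeltaUT (k - a) (j - (k - a)) (\<lambda>y. DeltaUT a (i - a) (\<lambda>x. F (x,y)) (p,r)) (q,s)) X) Y = 0"
        unfolding muUT_apply kl[OF a] prod.case using False by (simp only: split: if_split) blast
    qed
    finally show ?thesis .
  next
    case True
    have "DeltaUT k l (muUT i j F) (X,Y) = (\<Sum>K\<in>{K. K \<subseteq> {1..i+j} \<and> card K = k}.
        avg (fibr (i+j) (std_ord (i+j)) K X Y) (muUT i j F))"
      using True by (simp add: DeltaUT_apply n)
    also have "\<dots> = (\<Sum>a\<in>?A. \<Sum>K2\<in>{K. K \<subseteq> {1..j} \<and> card K = k - a}. \<Sum>K1\<in>{K. K \<subseteq> {1..i} \<and> card K = a}.
        avg (fibr (i+j) (std_ord (i+j)) (K1 \<union> (+) i ` K2) X Y) (muUT i j F))"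
      by (rule sum_subsets_split)
    also have "\<dots> = (\<Sum>a\<in>?A. \<Sum>K2\<in>{K. K \<subseteq> {1..j} \<and> card K = k - a}. \<Sum>K1\<in>{K. K \<subseteq> {1..i} \<and> card K = a}.
       avg (fibr j (std_ord j) K2 (blk {a + 1..a + (k-a)} X)
        (blk {i - a + 1..(i - a) + (j - (k-a))} Y)) (\<lambda>y.
      avg (fibr i (std_ord i) K1 (blk {1..a} X) (blk {1..i - a} Y)) (\<lambda>x. F (x, y))))"
    proof (intro sum.cong refl)
      fix a K1 K2
      assume a: "a \<in> ?A" and "K2 \<in> {K. K \<subseteq> {1..j} \<and> card K = k - a}" "K1 \<in> {K. K \<subseteq> {1..i} \<and> card K = a}"
      then have K: "K1 \<subseteq> {1..i}" "K2 \<subseteq> {1..j}" and c: "card K1 = a" "card K2 = k - a" by auto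
      show "avg (fibr (i+j) (std_ord (i+j)) (K1 \<union> (+) i ` K2) X Y) (muUT i j F) =
        avg (fibr j (std_ord j) K2 (blk {a + 1..a + (k-a)} X)
          (blk {i - a + 1..(i - a) + (j - (k-a))} Y)) (\<lambda>y.
        avg (fibr i (std_ord i) K1 (blk {1..a} X) (blk {1..i - a} Y)) (\<lambda>x. F (x, y)))"
        using avg_fibr_split[OF K, of X Y F, unfolded c kl(1,2)[OF a]] True unfolding kl(1,2)[OF a] by blast
    qed
    also have "\<dots> = (\<Sum>a\<in>?A. DeltaUT (k - a) (j - (k - a))
        (\<lambda>y. DeltaUT a (i - a) (\<lambda>x. F (x,y)) (blk {1..a} X, blk {1..i - a} Y))
        (blk {a + 1..a + (k-a)} X, blk {i - a + 1..(i - a) + (j - (k-a))} Y))"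
    proof (rule sum.cong[OF refl])
      fix a assume a: "a \<in> ?A"
      have UX: "X \<in> UT (a + (k-a))" and UY: "Y \<in> UT ((i-a) + (j-(k-a)))"
        using True by (simp_all only: kl[OF a])
      show "(\<Sum>K2\<in>{K. K \<subseteq> {1..j} \<and> card K = k - a}. \<Sum>K1\<in>{K. K \<subseteq> {1..i} \<and> card K = a}.
         avg (fibr j (std_ord j) K2 (blk {a + 1..a + (k-a)} X)
          (blk {i - a + 1..(i - a) + (j - (k-a))} Y)) (\<lambda>y.
        avg (fibr i (std_ord i) K1 (blk {1..a} X) (blk {1..i - a} Y)) (\<lambda>x. F (x, y)))) =
        DeltaUT (k - a) (j - (k - a))
        (\<lambda>y. DeltaUT a (i - a) (\<lambda>x. F (x,y)) (blk {1..a} X, blk {1..i - a} Y))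
        (blk {a + 1..a + (k-a)} X, blk {i - a + 1..(i - a) + (j - (k-a))} Y)"
        by (simp only: DeltaUT_apply blk_UT_split[OF UX] blk_UT_split[OF UY] kl(3,4)[OF a] avg_sum simp_thms if_True)
    qed
    also have "\<dots> = (\<Sum>a\<in>?A.
     muUT (i - a) (j - (k - a)) (\<lambda>(r,s). muUT a (k - a) (\<lambda>(p,q).
       DeltaUT (k - a) (j - (k - a)) (\<lambda>y. DeltaUT a (i - a) (\<lambda>x. F (x,y)) (p,r)) (q,s)) X) Y)"
      by (rule sum.cong[OF refl]) (simp only: muUT_apply kl True prod.case if_True)
    finally show ?thesis .
  qed
qed

section \<open>The Hopf algebra of class functions\<close>

lemma fibr_empty:
  assumes y: "(y :: 'a::{field,finite} mat) \<in> UT n"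
  shows "fibr n (std_ord n) {} (idm {}) y = {y}"
proof -
  have "blk {1..n} h = h" if "h \<in> UT n" for h :: "'a mat" by (rule blk_full[OF UT_supp[OF that]])
  then show ?thesis using y by (auto simp: fibr_std_iff blk_empty)
qed

lemma fibr_full:
  assumes x: "(x :: 'a::{field,finite} mat) \<in> UT n"
  shows "fibr n (std_ord n) {1..n} x (idm {}) = {x}"
proof -
  have "blk {1..n} h = h" if "h \<in> UT n" for h :: "'a mat" by (rule blk_full[OF UT_supp[OF that]])
  then show ?thesis using x by (auto simp: fibr_std_iff blk_empty)
qed

lemma uUT_iff: "uUT (x :: 'a::{field,finite} mat) = (if x = idm {} then 1 else 0)"
  by (simp add: uUT_def UT_0)

lemma cfUT_zero: "f \<in> cfUT n \<Longrightarrow> x \<notin> UT n \<Longrightarrow> f x = 0"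
  by (simp add: cfUT_iff)

lemma DeltaUT_0_left:
  assumes f: "(f :: 'a::{field,finite} mat \<Rightarrow> complex) \<in> cfUT n"
  shows "DeltaUT 0 n f = (\<lambda>(x,y). uUT x * f y)"
proof -
  have "{I. I \<subseteq> {1..0+n} \<and> card I = 0} = {{}}" by (auto dest: finite_subset)
  then show ?thesis
    using cfUT_zero[OF f] by (intro ext, clarify) (simp add: DeltaUT_apply UT_0 uUT_iff fibr_empty)
qed

lemma DeltaUT_0_right:
  assumes f: "(f :: 'a::{field,finite} mat \<Rightarrow> complex) \<in> cfUT n"
  shows "DeltaUT n 0 f = (\<lambda>(x,y). f x * uUT y)"
proof -
  have "{I. I \<subseteq> {1..n+0} \<and> card I = n} = {{1..n}}"
    using card_subset_eq[of "{1..n}"] by auto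
  then show ?thesis
    using cfUT_zero[OF f] by (intro ext, clarify) (simp add: DeltaUT_apply UT_0 uUT_iff fibr_full)
qed

lemma muUT_unit_left:
  assumes f: "(f :: 'a::{field,finite} mat \<Rightarrow> complex) \<in> cfUT n"
  shows "muUT 0 n (\<lambda>(x,y). uUT x * f y) = f"
  using cfUT_zero[OF f] by (simp add: muUT_apply blk_empty uUT_iff blk_full UT_supp fun_eq_iff)

lemma muUT_unit_right:
  assumes f: "(f :: 'a::{field,finite} mat \<Rightarrow> complex) \<in> cfUT n"
  shows "muUT n 0 (\<lambda>(x,y). f x * uUT y) = f"
  using cfUT_zero[OF f] by (simp add: muUT_apply blk_empty uUT_iff blk_full UT_supp fun_eq_iff)

lemma muUT_assoc:
  fixes F :: "'a::{field,finite} mat \<times> 'a mat \<times> 'a mat \<Rightarrow> complex"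
  shows "muUT (i+j) k (lft_mu (muUT i j) F) = muUT i (j+k) (rgt_mu (muUT j k) F)"
proof
  fix g :: "'a mat"
  show "muUT (i+j) k (lft_mu (muUT i j) F) g = muUT i (j+k) (rgt_mu (muUT j k) F) g"
  proof (cases "g \<in> UT (i+j+k)")
    case True
    then have 1: "blk {1..i+j} g \<in> UT (i+j)" and 2: "blk {i+1..i+(j+k)} g \<in> UT (j+k)"
      using blk_UT_split(1)[of g "i+j" k] blk_UT_split(2)[of g i "j+k"] by (simp_all add: add.assoc)
    have e1: "blk {1..i} (blk {1..i+j} g) = blk {1..i} g"
      by (subst blk_blk) (simp_all add: canoinv_interval_image(1))
    have e2: "blk {i+1..i+j} (blk {1..i+j} g) = blk {i+1..i+j} g"
      by (subst blk_blk) (simp_all add: canoinv_interval_image(1))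
    have e3: "blk {1..j} (blk {i+1..i+(j+k)} g) = blk {i+1..i+j} g"
      by (subst blk_blk) (auto simp: canoinv_interval_image(2) plus_interval simp del: image_add_atLeastAtMost)
    have e4: "blk {j+1..j+k} (blk {i+1..i+(j+k)} g) = blk {i+j+1..i+j+k} g"
      by (subst blk_blk) (auto simp: canoinv_interval_image(2) plus_interval add.assoc simp del: image_add_atLeastAtMost)
    show ?thesis
      using True 1 2 by (simp add: muUT_apply lft_mu_def rgt_mu_def e1 e2 e3 e4 add.assoc)
  qed (simp add: muUT_apply add.assoc)
qed

lemma lin_muUT: "lin_on V (muUT i j :: _ \<Rightarrow> 'a::{field,finite} mat \<Rightarrow> complex)"
  by (simp add: lin_on_def muUT_apply fun_eq_iff)

lemma lin_DeltaUT: "lin_on V (DeltaUT k l :: ('a::{field,finite} mat \<Rightarrow> complex) \<Rightarrow> _)"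
  by (simp add: lin_on_def DeltaUT_apply fun_eq_iff avg_lincomb sum.distrib sum_distrib_left)

lemma uUT_cfUT: "(uUT :: 'a::{field,finite} mat \<Rightarrow> complex) \<in> cfUT 0"
  by (auto simp: cfUT_iff UT_0 uUT_iff mmul_def idm_def fun_eq_iff)

lemma cfUT_0: "(f :: 'a::{field,finite} mat \<Rightarrow> complex) \<in> cfUT 0 \<Longrightarrow> f = (\<lambda>x. epsUT f * uUT x)"
  by (rule ext) (use cfUT_zero[of f 0] in \<open>auto simp: UT_0 uUT_iff epsUT_def\<close>)

theorem cfUT_hopf:
  "graded_connected_hopf (cfUT :: nat \<Rightarrow> ('a::{field,finite} mat \<Rightarrow> complex) set)
     muUT DeltaUT uUT epsUT"
proof -
  let ?cf = "cfUT :: nat \<Rightarrow> ('a mat \<Rightarrow> complex) set"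
  let ?S = "antip muUT DeltaUT :: nat \<Rightarrow> ('a mat \<Rightarrow> complex) \<Rightarrow> _"
  have eps_u: "epsUT (\<lambda>x. uUT (x :: 'a mat) * c) = c" "epsUT (\<lambda>x. c * uUT (x :: 'a mat)) = c" for c
    by (simp_all add: epsUT_def uUT_iff)
  have S_lin: "lin_on UNIV (?S n)" for n
    by (rule lin_antip[OF subsp_cfUT lin_muUT lin_DeltaUT muUT_cfUT DeltaUT_cfUT muUT_assoc
      DeltaUT_coassoc muUT_unit_left muUT_unit_right DeltaUT_0_left DeltaUT_0_right])
  have S_cf: "?S n f \<in> ?cf n" if "f \<in> ?cf n" for n f
    by (rule antip_A[OF subsp_cfUT lin_muUT lin_DeltaUT muUT_cfUT DeltaUT_cfUT muUT_assoc
      DeltaUT_coassoc muUT_unit_left muUT_unit_right DeltaUT_0_left DeltaUT_0_right that])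
  have S_left: "(\<Sum>k\<le>n. muUT k (n-k) (tmap (?S k) (\<lambda>g. g) (DeltaUT k (n-k) f)) z) = 0"
    if "f \<in> ?cf n" "n \<noteq> 0" for f n z
    by (rule antip_left[OF subsp_cfUT lin_muUT lin_DeltaUT muUT_cfUT DeltaUT_cfUT muUT_assoc
      DeltaUT_coassoc muUT_unit_left muUT_unit_right DeltaUT_0_left DeltaUT_0_right that])
  have S_right: "(\<Sum>k\<le>n. muUT k (n-k) (tmap (\<lambda>g. g) (?S (n-k)) (DeltaUT k (n-k) f)) z) = 0"
    if "f \<in> ?cf n" "n \<noteq> 0" for f n z
    by (rule antip_right[OF subsp_cfUT lin_muUT lin_DeltaUT muUT_cfUT DeltaUT_cfUT muUT_assoc
      DeltaUT_coassoc muUT_unit_left muUT_unit_right DeltaUT_0_left DeltaUT_0_right that])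
  have S0: "muUT 0 0 (tmap (\<lambda>g. g) (\<lambda>g. g) (DeltaUT 0 0 f)) = (\<lambda>z. epsUT f * uUT z)" if "f \<in> ?cf 0" for f
    using muUT_unit_left[OF that] cfUT_0[OF that] by (simp add: DeltaUT_0_left[OF that] tmap_def)
  have id: "?S 0 = (\<lambda>f. f)" by (simp add: antip.simps fun_eq_iff)
  have anti: "\<exists>S. \<forall>n. lin_on (?cf n) (S n) \<and> (\<forall>f\<in>?cf n. S n f \<in> ?cf n) \<and>
        (\<forall>f\<in>?cf n.
          (\<lambda>z. \<Sum>k\<le>n. muUT k (n-k) (tmap (S k) (\<lambda>g. g) (DeltaUT k (n-k) f)) z)
             = (\<lambda>z. (if n = 0 then epsUT f else 0) * uUT z) \<and>
          (\<lambda>z. \<Sum>k\<le>n. muUT k (n-k) (tmap (\<lambda>g. g) (S (n-k)) (DeltaUT k (n-k) f)) z)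
             = (\<lambda>z. (if n = 0 then epsUT f else 0) * uUT z))"
  proof (rule exI[of _ ?S], intro allI conjI ballI)
    fix n
    show "lin_on (?cf n) (?S n)" using S_lin[of n] by (simp add: lin_on_def)
    fix f :: "'a mat \<Rightarrow> complex" assume f: "f \<in> cfUT n"
    show "?S n f \<in> cfUT n" by (rule S_cf[OF f])
    show "(\<lambda>z. \<Sum>k\<le>n. muUT k (n-k) (tmap (?S k) (\<lambda>g. g) (DeltaUT k (n-k) f)) z)
             = (\<lambda>z. (if n = 0 then epsUT f else 0) * uUT z)"
      using S_left[OF f] S0 f by (cases "n = 0") (auto simp: id)
    show "(\<lambda>z. \<Sum>k\<le>n. muUT k (n-k) (tmap (\<lambda>g. g) (?S (n-k)) (DeltaUT k (n-k) f)) z)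
             = (\<lambda>z. (if n = 0 then epsUT f else 0) * uUT z)"
      using S_right[OF f] S0 f by (cases "n = 0") (auto simp: id)
  qed
  have counit: "(\<lambda>y. epsUT (\<lambda>x. DeltaUT 0 n f (x,y))) = f \<and> (\<lambda>x. epsUT (\<lambda>y. DeltaUT n 0 f (x,y))) = f"
    if "f \<in> ?cf n" for f n
    by (simp add: DeltaUT_0_left[OF that] DeltaUT_0_right[OF that] eps_u)
  have span: "\<exists>c. f = (\<lambda>x. c * uUT x)" if "f \<in> ?cf 0" for f using cfUT_0[OF that] by blast
  have eps: "lin_on (?cf 0) (\<lambda>f. (\<lambda>_::unit. epsUT f))" "epsUT (uUT :: 'a mat \<Rightarrow> complex) = 1"
    by (simp_all add: lin_on_def epsUT_def uUT_iff)
  have u0: "uUT \<noteq> (\<lambda>x :: 'a mat. 0)" by (auto simp: uUT_iff fun_eq_iff intro!: exI[of _ "idm {}"])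
  have eps_mu: "epsUT (muUT 0 0 F) = epsUT (\<lambda>y. epsUT (\<lambda>x. F (x,y)))" for F :: "'a mat \<times> 'a mat \<Rightarrow> complex"
    by (simp add: epsUT_def muUT_apply UT_0 blk_empty)
  show ?thesis
    unfolding graded_connected_hopf_def
    using anti counit u0 eps_mu span eps
    by (intro conjI allI ballI impI)
      (simp_all add: subsp_cfUT lin_muUT lin_DeltaUT muUT_cfUT DeltaUT_cfUT muUT_assoc DeltaUT_coassoc
        muUT_unit_left muUT_unit_right DeltaUT_muUT DeltaUT_0_left uUT_cfUT)
qed

section \<open>Rank permutations of total orders\<close>

text \<open>The rank of \<open>a\<close> in \<tau>, counted from 1. Being the identity elsewhere
  makes it a permutation of \<open>{1..n}\<close> in the sense of \<open>permutes\<close>, hence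
  admissible in \<open>relK\<close>.\<close>

definition ranking :: "nat \<Rightarrow> (nat \<times> nat) set \<Rightarrow> nat \<Rightarrow> nat" where
  "ranking n \<tau> a = (if a \<in> {1..n} then card {b. b = a \<or> (b,a) \<in> \<tau>} else a)"

text \<open>The action on matrices inside \<open>act\<close>; for a permutation of the index set it
  is conjugation by a permutation matrix.\<close>

definition pullback :: "(nat \<Rightarrow> nat) \<Rightarrow> 'a mat \<Rightarrow> 'a mat" where
  "pullback \<sigma> X = (\<lambda>i j. X (\<sigma> i) (\<sigma> j))"

lemma finite_sord: "finite {\<tau>. sord {1..n} \<tau>}"
  by (rule finite_subset[of _ "Pow ({1..n} \<times> {1..n})"]) (auto simp: sord_def)

lemma ranking_outside: "a \<notin> {1..n} \<Longrightarrow> ranking n \<tau> a = a"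
  unfolding ranking_def by (rule if_not_P)

text \<open>A self-map of \<open>{1..n}\<close> increasing from \<tau> to the usual order is
  injective, hence bijective, so it maps the elements up to \<open>a\<close> onto
  \<open>{1..\<sigma> a}\<close>. Ranks of relabelled, joined and restricted orders are all
  identified in this way.\<close>

lemma ranking_unique:
  assumes \<tau>: "sord {1..n} \<tau>"
    and \<sigma>: "\<And>a. a \<in> {1..n} \<Longrightarrow> \<sigma> a \<in> {1..n}"
    and mono: "\<And>a b. (a,b) \<in> \<tau> \<Longrightarrow> \<sigma> a < \<sigma> b"
    and a: "a \<in> {1..n}"
  shows "ranking n \<tau> a = \<sigma> a"
proof -
  have lt: "(b,c) \<in> \<tau> \<longleftrightarrow> \<sigma> b < \<sigma> c" if "b \<in> {1..n}" "c \<in> {1..n}" for b c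
    using sordD(4)[OF \<tau> that] mono[of b c] mono[of c b] by (cases "b = c") (auto dest: sordD(3)[OF \<tau>, THEN notE])
  have inj: "inj_on \<sigma> {1..n}"
    using sordD(4)[OF \<tau>] mono by (intro inj_onI) (metis less_irrefl)
  then have surj: "\<sigma> ` {1..n} = {1..n}"
    by (intro endo_inj_surj) (use \<sigma> in auto)
  have "{b. b = a \<or> (b,a) \<in> \<tau>} = {b\<in>{1..n}. \<sigma> b \<le> \<sigma> a}"
  proof (intro set_eqI iffI)
    fix b assume b: "b \<in> {b. b = a \<or> (b,a) \<in> \<tau>}"
    then have "b \<in> {1..n}" using a sordD(1)[OF \<tau>] by auto
    then show "b \<in> {b\<in>{1..n}. \<sigma> b \<le> \<sigma> a}" using b lt[of b a] a by auto
  next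
    fix b assume b: "b \<in> {b\<in>{1..n}. \<sigma> b \<le> \<sigma> a}"
    then have "b = a \<or> \<sigma> b < \<sigma> a" using inj a by (metis (lifting) inj_onD le_neq_implies_less mem_Collect_eq)
    then show "b \<in> {b. b = a \<or> (b,a) \<in> \<tau>}" using b lt[of b a] a by auto
  qed
  moreover have "\<sigma> ` {b\<in>{1..n}. \<sigma> b \<le> \<sigma> a} = {1..\<sigma> a}"
  proof (intro equalityI subsetI)
    fix x assume x: "x \<in> {1..\<sigma> a}"
    then have "x \<in> {1..n}" using \<sigma>[OF a] by auto
    then obtain b where "b \<in> {1..n}" "x = \<sigma> b" using surj by (metis imageE)
    then show "x \<in> \<sigma> ` {b\<in>{1..n}. \<sigma> b \<le> \<sigma> a}" using x by auto
  qed (use \<sigma> in auto)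
  moreover have "card (\<sigma> ` {b\<in>{1..n}. \<sigma> b \<le> \<sigma> a}) = card {b\<in>{1..n}. \<sigma> b \<le> \<sigma> a}"
    by (rule card_image, rule inj_on_subset[OF inj]) auto
  ultimately have "card {b. b = a \<or> (b,a) \<in> \<tau>} = \<sigma> a" by simp
  then show ?thesis using a by (simp add: ranking_def)
qed

lemma ranking_less:
  assumes \<tau>: "sord {1..n} \<tau>" and ab: "(a,b) \<in> \<tau>"
  shows "ranking n \<tau> a < ranking n \<tau> b"
proof -
  have n: "a \<in> {1..n}" "b \<in> {1..n}" using ab sordD(1)[OF \<tau>] by auto
  have "{c. c = b \<or> (c,b) \<in> \<tau>} \<subseteq> {1..n}" using n sordD(1)[OF \<tau>] by auto
  then have "finite {c. c = b \<or> (c,b) \<in> \<tau>}" by (rule finite_subset) simp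
  moreover have "{c. c = a \<or> (c,a) \<in> \<tau>} \<subseteq> {c. c = b \<or> (c,b) \<in> \<tau>}"
    using ab sordD(5)[OF \<tau>] by blast
  moreover have "b \<notin> {c. c = a \<or> (c,a) \<in> \<tau>}" using ab sordD(3,6)[OF \<tau>] by auto
  ultimately have "card {c. c = a \<or> (c,a) \<in> \<tau>} < card {c. c = b \<or> (c,b) \<in> \<tau>}"
    by (intro psubset_card_mono) auto
  then show ?thesis using n by (simp add: ranking_def)
qed

lemma ranking_in:
  assumes \<tau>: "sord {1..n} \<tau>" and a: "a \<in> {1..n}"
  shows "ranking n \<tau> a \<in> {1..n}"
proof -
  have sub: "{b. b = a \<or> (b,a) \<in> \<tau>} \<subseteq> {1..n}" using a sordD(1)[OF \<tau>] by auto
  then have "finite {b. b = a \<or> (b,a) \<in> \<tau>}" by (rule finite_subset) simp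
  then have "card {b. b = a \<or> (b,a) \<in> \<tau>} \<noteq> 0" by auto
  moreover have "card {b. b = a \<or> (b,a) \<in> \<tau>} \<le> n" using card_mono[OF _ sub] by simp
  ultimately show ?thesis using a by (simp add: ranking_def)
qed

lemma ranking_permutes:
  assumes \<tau>: "sord {1..n} \<tau>"
  shows "ranking n \<tau> permutes {1..n}"
proof (rule bij_imp_permutes)
  have "inj_on (ranking n \<tau>) {1..n}"
    using sordD(4)[OF \<tau>] ranking_less[OF \<tau>] by (intro inj_onI) (metis less_irrefl)
  moreover have "ranking n \<tau> ` {1..n} \<subseteq> {1..n}" using ranking_in[OF \<tau>] by blast
  ultimately show "bij_betw (ranking n \<tau>) {1..n} {1..n}"
    using endo_inj_surj[of "{1..n}" "ranking n \<tau>"] by (simp add: bij_betw_def)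
qed (rule ranking_outside)

lemma ranking_iff:
  assumes \<tau>: "sord {1..n} \<tau>"
  shows "(ranking n \<tau> a, ranking n \<tau> b) \<in> std_ord n \<longleftrightarrow> (a,b) \<in> \<tau>"
proof -
  have "ranking n \<tau> a \<in> {1..n} \<longleftrightarrow> a \<in> {1..n}" for a
    using permutes_in_image[OF ranking_permutes[OF \<tau>]] .
  then have "(ranking n \<tau> a, ranking n \<tau> b) \<in> std_ord n \<longleftrightarrow>
      a \<in> {1..n} \<and> b \<in> {1..n} \<and> ranking n \<tau> a < ranking n \<tau> b"
    unfolding std_ord_def by blast
  also have "\<dots> \<longleftrightarrow> (a,b) \<in> \<tau>"
    using sordD(1)[OF \<tau>] sordD(4)[OF \<tau>, of a b] ranking_less[OF \<tau>, of a b] ranking_less[OF \<tau>, of b a]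
    by (metis less_asym less_irrefl mem_Sigma_iff subsetD)
  finally show ?thesis .
qed

lemma ranking_std: "ranking n (std_ord n) = (\<lambda>a. a)"
proof
  show "ranking n (std_ord n) a = a" for a
  proof (cases "a \<in> {1..n}")
    case True
    then show ?thesis
      by (intro ranking_unique[OF sord_std_ord, where \<sigma>="\<lambda>a. a"]) (auto simp: std_ord_def)
  qed (rule ranking_outside)
qed

lemma sord_vimage:
  assumes "\<sigma> permutes {1..n}" "sord {1..n} \<tau>"
  shows "sord {1..n} {(a,b). (\<sigma> a, \<sigma> b) \<in> \<tau>}"
proof -
  have i: "\<sigma> a \<in> {1..n} \<longleftrightarrow> a \<in> {1..n}" for a using permutes_in_image[OF assms(1)] .
  have e: "\<sigma> a = \<sigma> b \<longleftrightarrow> a = b" for a b using permutes_inj[OF assms(1)] by (simp add: inj_eq)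
  show ?thesis
    unfolding sord_def strict_linear_order_on_def
  proof (intro conjI)
    show "trans {(a,b). (\<sigma> a, \<sigma> b) \<in> \<tau>}" by (rule transI) (auto intro: sordD(5)[OF assms(2)])
    show "irrefl {(a,b). (\<sigma> a, \<sigma> b) \<in> \<tau>}" using sordD(3)[OF assms(2)] by (simp add: irrefl_def)
    show "total_on {1..n} {(a,b). (\<sigma> a, \<sigma> b) \<in> \<tau>}"
      by (rule total_onI) (use sordD(4)[OF assms(2)] i e in simp)
    show "{(a,b). (\<sigma> a, \<sigma> b) \<in> \<tau>} \<subseteq> {1..n} \<times> {1..n}"
    proof (rule subrelI)
      fix a b assume "(a,b) \<in> {(a,b). (\<sigma> a, \<sigma> b) \<in> \<tau>}"
      then have "\<sigma> a \<in> {1..n} \<and> \<sigma> b \<in> {1..n}" using sordD(1)[OF assms(2)] by blast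
      then show "(a,b) \<in> {1..n} \<times> {1..n}" unfolding i by simp
    qed
  qed
qed

lemma ranking_vimage:
  assumes \<sigma>: "\<sigma> permutes {1..n}" and \<tau>: "sord {1..n} \<tau>"
  shows "ranking n {(a,b). (\<sigma> a, \<sigma> b) \<in> \<tau>} a = ranking n \<tau> (\<sigma> a)"
proof (cases "a \<in> {1..n}")
  case True
  show ?thesis
    by (rule ranking_unique[OF sord_vimage[OF assms], where \<sigma>="\<lambda>a. ranking n \<tau> (\<sigma> a)"])
      (use True ranking_less[OF \<tau>] ranking_in[OF \<tau>] permutes_in_image[OF \<sigma>] in auto)
next
  case False
  then show ?thesis using ranking_outside[OF False] permutes_not_in[OF \<sigma> False] by simp
qed

section \<open>Relabelling of matrices\<close>

lemma pullback_pullback: "pullback \<sigma> (pullback \<rho> X) = pullback (\<lambda>a. \<rho> (\<sigma> a)) X"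
  by (simp add: pullback_def)

lemma inj_pullback:
  assumes "\<sigma> permutes S"
  shows "pullback \<sigma> X = pullback \<sigma> Y \<longleftrightarrow> X = Y"
proof
  assume eq: "pullback \<sigma> X = pullback \<sigma> Y"
  have "X a b = Y a b" for a b
    using fun_cong[OF fun_cong[OF eq], of "inv \<sigma> a" "inv \<sigma> b"] permutes_inverses[OF assms]
    by (simp add: pullback_def)
  then show "X = Y" by (simp add: fun_eq_iff)
qed simp

lemma bij_pullback:
  assumes "\<sigma> permutes S"
  shows "bij (pullback \<sigma>)"
proof (rule bijI)
  show "inj (pullback \<sigma>)" using inj_pullback[OF assms] by (auto intro: injI)
  have "pullback \<sigma> (pullback (inv \<sigma>) X) = X" for X
    using permutes_inverses[OF assms] by (simp add: pullback_def)
  then show "surj (pullback \<sigma>)" by (metis surjI)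
qed

lemma pullback_idm:
  assumes "\<sigma> permutes S"
  shows "pullback \<sigma> (idm S) = idm S"
  using permutes_in_image[OF assms] permutes_inj[OF assms]
  by (auto simp: pullback_def idm_def fun_eq_iff dest: injD)

lemma pullback_mmul:
  assumes "\<sigma> permutes S"
  shows "pullback \<sigma> (mmul S X Y) = mmul S (pullback \<sigma> X) (pullback \<sigma> Y)"
proof (intro ext)
  fix i j
  show "pullback \<sigma> (mmul S X Y) i j = mmul S (pullback \<sigma> X) (pullback \<sigma> Y) i j"
    using sum.permute[OF assms, of "\<lambda>k. X (\<sigma> i) k * Y k (\<sigma> j)"]
    by (simp add: pullback_def mmul_def comp_def)
qed

lemma pullback_UTo:
  assumes \<sigma>: "\<sigma> permutes {1..n}" and \<tau>: "sord {1..n} \<tau>" and \<tau>': "sord {1..n} \<tau>'"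
    and rel: "\<And>a b. (a,b) \<in> \<tau> \<longleftrightarrow> (\<sigma> a, \<sigma> b) \<in> \<tau>'"
  shows "pullback \<sigma> (X :: 'a::{field,finite} mat) \<in> UTo {1..n} \<tau> \<longleftrightarrow> X \<in> UTo {1..n} \<tau>'"
proof -
  have "pullback \<sigma> X \<in> UTo {1..n} \<tau> \<longleftrightarrow>
      (\<forall>i j. (i,j) \<notin> \<tau> \<longrightarrow> pullback \<sigma> X i j = pullback \<sigma> (idm {1..n}) i j)"
    by (simp only: UTo_iff'[OF \<tau>] pullback_idm[OF \<sigma>])
  also have "\<dots> \<longleftrightarrow> (\<forall>i j. (\<sigma> i, \<sigma> j) \<notin> \<tau>' \<longrightarrow> X (\<sigma> i) (\<sigma> j) = idm {1..n} (\<sigma> i) (\<sigma> j))"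
    by (simp only: rel pullback_def)
  also have "\<dots> \<longleftrightarrow> (\<forall>i j. (i,j) \<notin> \<tau>' \<longrightarrow> X i j = idm {1..n} i j)"
    using permutes_surj[OF \<sigma>] by (metis surjD)
  finally show ?thesis unfolding UTo_iff'[OF \<tau>'] .
qed

lemma pullback_ranking_UTo:
  assumes "sord {1..n} \<tau>"
  shows "pullback (ranking n \<tau>) (X :: 'a::{field,finite} mat) \<in> UTo {1..n} \<tau> \<longleftrightarrow> X \<in> UT n"
  unfolding UT_def
  by (rule pullback_UTo[OF ranking_permutes[OF assms] assms sord_std_ord]) (simp add: ranking_iff[OF assms])

section \<open>The isomorphism with the Fock functor\<close>

lemma act_apply: "act \<sigma> v (\<tau>, Y) = v ({(a,b). (\<sigma> a, \<sigma> b) \<in> \<tau>}, pullback \<sigma> Y)"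
  by (simp add: act_def pullback_def)

text \<open>\<open>pullback (ranking n \<tau>)\<close> carries the standard unitriangular group
  isomorphically to that of \<tau>, so each component becomes a function on the standard
  group.\<close>

definition straighten :: "nat \<Rightarrow> ('a::field omat \<Rightarrow> complex) \<Rightarrow> ('a mat \<Rightarrow> complex)" where
  "straighten n v = (\<lambda>X. \<Sum>\<tau>\<in>{\<tau>. sord {1..n} \<tau>}. v (\<tau>, pullback (ranking n \<tau>) X))"

lemma RspD:
  assumes "v \<in> Rsp n"
  shows "\<not> sord {1..n} \<tau> \<Longrightarrow> v (\<tau>, X) = 0" "sord {1..n} \<tau> \<Longrightarrow> cf_of (UTo {1..n} \<tau>) {1..n} (\<lambda>X. v (\<tau>, X))"
  using assms by (auto simp: Rsp_def)

lemma lin_straighten: "lin_on V (straighten n)"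
  by (simp add: lin_on_def straighten_def sum.distrib sum_distrib_left)

lemma straighten_cfUT:
  fixes v :: "'a::{field,finite} omat \<Rightarrow> complex"
  assumes v: "v \<in> Rsp n"
  shows "straighten n v \<in> cfUT n"
proof -
  have "(\<lambda>X. v (\<tau>, pullback (ranking n \<tau>) X)) \<in> cfUT n" if \<tau>: "sord {1..n} \<tau>" for \<tau>
  proof -
    note p = ranking_permutes[OF \<tau>] and U = pullback_ranking_UTo[OF \<tau>, where 'a='a]
    note c = RspD(2)[OF v \<tau>, unfolded cf_of_def]
    show ?thesis
      unfolding cfUT_iff
    proof (intro conjI allI ballI impI)
      fix X :: "'a mat" assume "X \<notin> UT n"
      then show "v (\<tau>, pullback (ranking n \<tau>) X) = 0" using c U by blast
    next
      fix g h h' :: "'a mat"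
      assume g: "g \<in> UT n" "h \<in> UT n" "h' \<in> UT n" "mmul {1..n} h h' = idm {1..n}"
      have "mmul {1..n} (pullback (ranking n \<tau>) h) (pullback (ranking n \<tau>) h') = idm {1..n}"
        unfolding pullback_mmul[OF p, symmetric] g(4) by (rule pullback_idm[OF p])
      then show "v (\<tau>, pullback (ranking n \<tau>) (mmul {1..n} (mmul {1..n} h g) h')) =
          v (\<tau>, pullback (ranking n \<tau>) g)"
        unfolding pullback_mmul[OF p] using c g(1-3) U by blast
    qed
  qed
  then have "(\<lambda>X. \<Sum>\<tau>\<in>{\<tau>. sord {1..n} \<tau>}. 1 * v (\<tau>, pullback (ranking n \<tau>) X)) \<in> cfUT n"
    by (intro subsp_sum[OF subsp_cfUT finite_sord]) auto
  then show ?thesis by (simp add: straighten_def)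
qed

lemma straighten_surj:
  assumes f: "(f :: 'a::{field,finite} mat \<Rightarrow> complex) \<in> cfUT n"
  shows "\<exists>v\<in>Rsp n. straighten n v = f"
proof
  let ?v = "\<lambda>(\<tau>,X). if \<tau> = std_ord n then f X else 0"
  have "cf_of (UTo {1..n} (std_ord n)) {1..n} f" using f by (simp add: cfUT_def UT_def)
  moreover have "cf_of G S (\<lambda>X. 0)" for G S by (simp add: cf_of_def)
  ultimately have "cf_of (UTo {1..n} \<tau>) {1..n} (\<lambda>X. ?v (\<tau>, X))" for \<tau>
    by (cases "\<tau> = std_ord n") simp_all
  then show "?v \<in> Rsp n" by (auto simp: Rsp_def sord_std_ord)
  show "straighten n ?v = f"
  proof
    fix X
    have "straighten n ?v X = (\<Sum>\<tau>\<in>{\<tau>. sord {1..n} \<tau>}. if \<tau> = std_ord n then f (pullback (ranking n \<tau>) X) else 0)"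
      by (simp add: straighten_def)
    also have "\<dots> = f (pullback (ranking n (std_ord n)) X)"
      using finite_sord by (simp add: sord_std_ord)
    finally show "straighten n ?v X = f X" by (simp add: ranking_std pullback_def)
  qed
qed

text \<open>Relabelling the order by \<sigma> composes its ranking with \<sigma>, which cancels the
  relabelling of the matrix; the summands are merely permuted.\<close>

lemma straighten_act:
  assumes \<sigma>: "\<sigma> permutes {1..n}"
  shows "straighten n (act \<sigma> v) = straighten n v"
proof
  fix X
  let ?g = "\<lambda>\<tau>. {(a,b). (\<sigma> a, \<sigma> b) \<in> \<tau>}"
  let ?h = "\<lambda>\<tau>. {(a,b). (inv \<sigma> a, inv \<sigma> b) \<in> \<tau>}"
  note i = permutes_inverses[OF \<sigma>]
  have r: "(\<lambda>a. ranking n \<tau> (\<sigma> a)) = ranking n (?g \<tau>)" if "sord {1..n} \<tau>" for \<tau>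
    by (rule ext) (simp only: ranking_vimage[OF \<sigma> that])
  have "straighten n (act \<sigma> v) X =
      (\<Sum>\<tau>\<in>{\<tau>. sord {1..n} \<tau>}. v (?g \<tau>, pullback (ranking n (?g \<tau>)) X))"
    unfolding straighten_def act_apply pullback_pullback
    by (rule sum.cong) (simp_all only: r mem_Collect_eq)
  also have "\<dots> = (\<Sum>\<tau>\<in>{\<tau>. sord {1..n} \<tau>}. v (\<tau>, pullback (ranking n \<tau>) X))"
    by (rule sum.reindex_bij_witness[where i="?h" and j="?g"])
      (auto simp: i sord_vimage[OF \<sigma>] sord_vimage[OF permutes_inv[OF \<sigma>]])
  finally show "straighten n (act \<sigma> v) X = straighten n v X" by (simp add: straighten_def)
qed

lemma straighten_relK:
  assumes "w \<in> relK n"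
  shows "straighten n w = (\<lambda>X. 0)"
proof -
  obtain m :: nat and vs \<sigma>s where \<sigma>: "\<And>k. k < m \<Longrightarrow> \<sigma>s k permutes {1..n}"
    and w: "w = (\<lambda>p. \<Sum>k<m. vs k p - act (\<sigma>s k) (vs k) p)"
    using assms by (auto simp: relK_def)
  have "straighten n w X = (\<Sum>k<m. straighten n (vs k) X - straighten n (act (\<sigma>s k) (vs k)) X)" for X
    unfolding straighten_def w by (subst sum.swap) (simp add: sum_subtractf)
  then show ?thesis by (intro ext) (simp add: straighten_act[OF \<sigma>])
qed

text \<open>Modulo the relations every component is moved to the standard order, so that a vector becomes
  its straightening placed there.\<close>

lemma relK_straighten:
  fixes v :: "'a::{field,finite} omat \<Rightarrow> complex"
  assumes v: "v \<in> Rsp n" and z: "straighten n v = (\<lambda>X. 0)"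
  shows "v \<in> relK n"
proof -
  let ?O = "{\<tau>. sord {1..n} \<tau>}"
  define part where "part \<tau> = (\<lambda>(\<tau>',X). if \<tau>' = \<tau> then v (\<tau>',X) else 0)" for \<tau>
  have part_R: "part \<tau> \<in> Rsp n" for \<tau>
  proof -
    have "cf_of G S (\<lambda>X. 0)" for G :: "'a mat set" and S by (simp add: cf_of_def)
    then have "cf_of (UTo {1..n} \<tau>') {1..n} (\<lambda>X. part \<tau> (\<tau>', X))" if "sord {1..n} \<tau>'" for \<tau>'
      using RspD(2)[OF v that] by (cases "\<tau>' = \<tau>") (simp_all add: part_def)
    then show ?thesis using RspD(1)[OF v] by (simp add: Rsp_def) (simp add: part_def)
  qed
  have sum_part: "(\<Sum>\<tau>\<in>?O. part \<tau> (\<tau>',X)) = v (\<tau>',X)" for \<tau>' X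
    using finite_sord RspD(1)[OF v] by (simp add: part_def)
  \<comment> \<open>Relabelling by the rank permutation of \<tau> moves the \<tau>-component to the
    standard order.\<close>
  have act_part: "act (ranking n \<tau>) (part \<tau>) (\<tau>',X) =
      (if \<tau>' = std_ord n then v (\<tau>, pullback (ranking n \<tau>) X) else 0)" if \<tau>: "sord {1..n} \<tau>" for \<tau> \<tau>' X
  proof -
    note p = permutes_inverses[OF ranking_permutes[OF \<tau>]]
    have "{(a,b). (ranking n \<tau> a, ranking n \<tau> b) \<in> \<tau>'} = \<tau> \<longleftrightarrow> \<tau>' = std_ord n"
    proof
      assume eq: "{(a,b). (ranking n \<tau> a, ranking n \<tau> b) \<in> \<tau>'} = \<tau>"
      have "(x,y) \<in> \<tau>' \<longleftrightarrow> (x,y) \<in> std_ord n" for x y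
      proof -
        have "(inv (ranking n \<tau>) x, inv (ranking n \<tau>) y) \<in> {(a,b). (ranking n \<tau> a, ranking n \<tau> b) \<in> \<tau>'} \<longleftrightarrow>
            (inv (ranking n \<tau>) x, inv (ranking n \<tau>) y) \<in> \<tau>" using eq by simp
        then show ?thesis using p by (simp add: ranking_iff[OF \<tau>, symmetric])
      qed
      then show "\<tau>' = std_ord n" by auto
    qed (auto simp: ranking_iff[OF \<tau>])
    then show ?thesis by (auto simp: act_apply part_def)
  qed
  \<comment> \<open>The moved components add up to \<open>straighten n v\<close> in the standard
    summand, which is 0; subtracting them therefore leaves \<open>v\<close> unchanged.\<close>
  have "(\<Sum>\<tau>\<in>?O. act (ranking n \<tau>) (part \<tau>) (\<tau>',X)) = 0" for \<tau>' X
    using fun_cong[OF z, of X] by (cases "\<tau>' = std_ord n") (simp_all add: act_part straighten_def)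
  then have eq: "v p = (\<Sum>\<tau>\<in>?O. part \<tau> p - act (ranking n \<tau>) (part \<tau>) p)" for p
    by (cases p) (simp add: sum_subtractf sum_part)
  obtain b where "bij_betw b {0..<card ?O} ?O" using ex_bij_betw_nat_finite[OF finite_sord] by blast
  then have b: "bij_betw b {..<card ?O} ?O" by (simp add: lessThan_atLeast0)
  have "v = (\<lambda>p. \<Sum>k<card ?O. part (b k) p - act (ranking n (b k)) (part (b k)) p)"
    by (rule ext, rule trans[OF eq sum.reindex_bij_betw[OF b, symmetric]])
  moreover have "ranking n (b k) permutes {1..n}" if "k < card ?O" for k
    using bij_betwE[OF b] that by (intro ranking_permutes) auto
  ultimately show ?thesis
    unfolding relK_def mem_Collect_eq
    by (intro exI[of _ "card ?O"] exI[of _ "\<lambda>k. part (b k)"] exI[of _ "\<lambda>k. ranking n (b k)"] conjI allI impI part_R)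
qed

lemma sord_empty: "{\<tau>. sord {1..0} \<tau>} = {{}}"
  by (auto simp: sord_def strict_linear_order_on_def trans_def irrefl_def)

lemma straighten_0: "straighten 0 v X = v ({}, X)"
proof -
  have "ranking 0 \<tau> = (\<lambda>a. a)" for \<tau> by (simp add: ranking_def fun_eq_iff)
  then show ?thesis by (simp add: straighten_def sord_empty[simplified] pullback_def)
qed

subsection \<open>Products\<close>

text \<open>The ordinal sum that indexes the target summand in \<open>muK\<close>: the second order
  is shifted by \<open>i\<close> and placed above the first.\<close>

definition ojoin :: "nat \<Rightarrow> nat \<Rightarrow> (nat \<times> nat) set \<Rightarrow> (nat \<times> nat) set \<Rightarrow> (nat \<times> nat) set" where
  "ojoin i j \<tau>1 \<tau>2 = \<tau>1 \<union> relab (canoinv {i+1..i+j}) \<tau>2 \<union> {1..i} \<times> {i+1..i+j}"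

lemma ojoin_iff:
  assumes \<tau>1: "sord {1..i} \<tau>1" and \<tau>2: "sord {1..j} \<tau>2"
  shows "(a,b) \<in> ojoin i j \<tau>1 \<tau>2 \<longleftrightarrow> (a,b) \<in> \<tau>1 \<or> (i < a \<and> i < b \<and> (a - i, b - i) \<in> \<tau>2)
     \<or> (a \<in> {1..i} \<and> b \<in> {i+1..i+j})"
proof -
  have "(a,b) \<in> relab (canoinv {i+1..i+j}) \<tau>2 \<longleftrightarrow> (\<exists>c d. (c,d) \<in> \<tau>2 \<and> a = i + c \<and> b = i + d)"
  proof -
    have c: "canoinv {i+1..i+j} c = i + c" "canoinv {i+1..i+j} d = i + d" if "(c,d) \<in> \<tau>2" for c d
      using sordD(1)[OF \<tau>2] that by (auto intro: canoinv_atLeastAtMost)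
    have "relab (canoinv {i+1..i+j}) \<tau>2 = (\<lambda>(c,d). (i + c, i + d)) ` \<tau>2"
      unfolding relab_def by (rule image_cong[OF refl]) (use c in auto)
    then show ?thesis by auto
  qed
  also have "\<dots> \<longleftrightarrow> i < a \<and> i < b \<and> (a - i, b - i) \<in> \<tau>2"
  proof
    assume "\<exists>c d. (c,d) \<in> \<tau>2 \<and> a = i + c \<and> b = i + d"
    then obtain c d where "(c,d) \<in> \<tau>2" "a = i + c" "b = i + d" by blast
    then show "i < a \<and> i < b \<and> (a - i, b - i) \<in> \<tau>2" using sordD(1)[OF \<tau>2] by auto
  next
    assume "i < a \<and> i < b \<and> (a - i, b - i) \<in> \<tau>2"
    then show "\<exists>c d. (c,d) \<in> \<tau>2 \<and> a = i + c \<and> b = i + d"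
      by (intro exI[of _ "a - i"] exI[of _ "b - i"]) auto
  qed
  finally show ?thesis unfolding ojoin_def by auto
qed

lemma sord_ojoin:
  assumes \<tau>1: "sord {1..i} \<tau>1" and \<tau>2: "sord {1..j} \<tau>2"
  shows "sord {1..i+j} (ojoin i j \<tau>1 \<tau>2)"
proof -
  note J = ojoin_iff[OF assms]
  have s1: "a \<in> {1..i} \<and> b \<in> {1..i}" if "(a,b) \<in> \<tau>1" for a b using sordD(1)[OF \<tau>1] that by auto
  have s2: "a - i \<in> {1..j} \<and> b - i \<in> {1..j}" if "(a - i,b - i) \<in> \<tau>2" for a b using sordD(1)[OF \<tau>2] that by auto
  have "ojoin i j \<tau>1 \<tau>2 \<subseteq> {1..i+j} \<times> {1..i+j}"
  proof (rule subrelI)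
    fix a b assume "(a,b) \<in> ojoin i j \<tau>1 \<tau>2"
    then show "(a,b) \<in> {1..i+j} \<times> {1..i+j}" unfolding J using s1[of a b] s2[of a b] by auto
  qed
  moreover have "trans (ojoin i j \<tau>1 \<tau>2)"
  proof (rule transI)
    fix a b c assume "(a,b) \<in> ojoin i j \<tau>1 \<tau>2" "(b,c) \<in> ojoin i j \<tau>1 \<tau>2"
    then show "(a,c) \<in> ojoin i j \<tau>1 \<tau>2"
      unfolding J using s1[of a b] s1[of b c] s2[of a b] s2[of b c]
        sordD(5)[OF \<tau>1, of a b c] sordD(5)[OF \<tau>2, of "a-i" "b-i" "c-i"] by auto
  qed
  moreover have "irrefl (ojoin i j \<tau>1 \<tau>2)"
    unfolding irrefl_def J using sordD(3)[OF \<tau>1] sordD(3)[OF \<tau>2] by auto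
  moreover have "total_on {1..i+j} (ojoin i j \<tau>1 \<tau>2)"
  proof (rule total_onI)
    fix a b assume ab: "a \<in> {1..i+j}" "b \<in> {1..i+j}" "a \<noteq> b"
    show "(a,b) \<in> ojoin i j \<tau>1 \<tau>2 \<or> (b,a) \<in> ojoin i j \<tau>1 \<tau>2"
    proof (cases "a \<le> i"; cases "b \<le> i")
      assume "a \<le> i" "b \<le> i"
      then show ?thesis using sordD(4)[OF \<tau>1, of a b] ab by (auto simp: J)
    next
      assume "\<not> a \<le> i" "\<not> b \<le> i"
      then have "a - i \<in> {1..j}" "b - i \<in> {1..j}" "a - i \<noteq> b - i" using ab by auto
      then have "(a - i, b - i) \<in> \<tau>2 \<or> (b - i, a - i) \<in> \<tau>2" by (rule sordD(4)[OF \<tau>2])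
      then show ?thesis using \<open>\<not> a \<le> i\<close> \<open>\<not> b \<le> i\<close> by (auto simp: J)
    qed (use ab in \<open>auto simp: J\<close>)
  qed
  ultimately show ?thesis by (simp add: sord_def strict_linear_order_on_def)
qed

text \<open>The concatenated rankings, the second raised by \<open>i\<close>, are increasing for the
  ordinal sum, so \<open>ranking_unique\<close> applies.\<close>

lemma ranking_ojoin:
  assumes \<tau>1: "sord {1..i} \<tau>1" and \<tau>2: "sord {1..j} \<tau>2"
  shows "r \<in> {1..i} \<Longrightarrow> ranking (i+j) (ojoin i j \<tau>1 \<tau>2) r = ranking i \<tau>1 r"
    and "r \<in> {1..j} \<Longrightarrow> ranking (i+j) (ojoin i j \<tau>1 \<tau>2) (i + r) = i + ranking j \<tau>2 r"
proof -
  define \<sigma> where "\<sigma> a = (if a \<le> i then ranking i \<tau>1 a else i + ranking j \<tau>2 (a - i))" for a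
  have in1: "ranking i \<tau>1 a \<in> {1..i}" if "1 \<le> a" "a \<le> i" for a using ranking_in[OF \<tau>1] that by simp
  have in2: "ranking j \<tau>2 (a - i) \<in> {1..j}" if "i < a" "a \<le> i + j" for a
    by (rule ranking_in[OF \<tau>2]) (use that in auto)
  have u: "ranking (i+j) (ojoin i j \<tau>1 \<tau>2) a = \<sigma> a" if "a \<in> {1..i+j}" for a
  proof (rule ranking_unique[OF sord_ojoin[OF assms] _ _ that])
    show "\<sigma> a \<in> {1..i+j}" if "a \<in> {1..i+j}" for a
      using in1[of a] in2[of a] that by (auto simp: \<sigma>_def)
    fix a b assume "(a,b) \<in> ojoin i j \<tau>1 \<tau>2"
    then consider "(a,b) \<in> \<tau>1" | "i < a" "i < b" "(a - i, b - i) \<in> \<tau>2" | "a \<in> {1..i}" "b \<in> {i+1..i+j}"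
      unfolding ojoin_iff[OF assms] by blast
    then show "\<sigma> a < \<sigma> b"
    proof cases
      case 1
      then have "a \<le> i" "b \<le> i" using sordD(1)[OF \<tau>1] by auto
      then show ?thesis using ranking_less[OF \<tau>1 1] by (simp add: \<sigma>_def)
    next
      case 2
      then show ?thesis using ranking_less[OF \<tau>2 2(3)] by (simp add: \<sigma>_def)
    next
      case 3
      then show ?thesis using in1[of a] in2[of b] by (auto simp: \<sigma>_def)
    qed
  qed
  show "r \<in> {1..i} \<Longrightarrow> ranking (i+j) (ojoin i j \<tau>1 \<tau>2) r = ranking i \<tau>1 r"
    using u[of r] by (simp add: \<sigma>_def)
  show "r \<in> {1..j} \<Longrightarrow> ranking (i+j) (ojoin i j \<tau>1 \<tau>2) (i + r) = i + ranking j \<tau>2 r"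
    using u[of "i + r"] by (simp add: \<sigma>_def)
qed

text \<open>The second hypothesis says that \<rho> maps \<open>I\<close> to \<open>J\<close> and
  induces \<sigma> on ranks; relabelling then commutes with taking blocks.\<close>

lemma pullback_blk:
  assumes "\<sigma> permutes {1..card I}"
    and "\<And>r. r \<in> {1..card J} \<Longrightarrow> \<rho> (canoinv I r) = canoinv J (\<sigma> r)"
    and "card J = card I"
  shows "blk I (pullback \<rho> X) = pullback \<sigma> (blk J X)"
proof (intro ext)
  fix r s
  have "blk J X (\<sigma> r) (\<sigma> s) = (if r \<in> {1..card I} \<and> s \<in> {1..card I}
      then X (canoinv J (\<sigma> r)) (canoinv J (\<sigma> s)) else 0)"
    by (simp only: blk_def assms(3) permutes_in_image[OF assms(1)])
  then show "blk I (pullback \<rho> X) r s = pullback \<sigma> (blk J X) r s"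
    using assms(2)[unfolded assms(3)] by (simp add: blk_def[of I] pullback_def)
qed

lemma muK_apply:
  fixes F :: "'a::{field,finite} omat \<times> 'a omat \<Rightarrow> complex"
  assumes \<tau>: "sord {1..i+j} \<tau>"
  shows "muK i j F (\<tau>, X) = (if X \<in> UTo {1..i+j} \<tau> then
    \<Sum>(\<tau>1,\<tau>2)\<in>{(\<tau>1,\<tau>2). sord {1..i} \<tau>1 \<and> sord {1..j} \<tau>2 \<and> \<tau> = ojoin i j \<tau>1 \<tau>2}.
      F ((\<tau>1, blk {1..i} X), (\<tau>2, blk {i+1..i+j} X)) else 0)"
proof -
  let ?P = "{(\<tau>1,\<tau>2). sord {1..i} \<tau>1 \<and> sord {1..j} \<tau>2 \<and> \<tau> = ojoin i j \<tau>1 \<tau>2}"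
  let ?S = "{1..i}" and ?T = "{i+1..i+j}"
  have T: "{1..i+j} - ?S = ?T" and S: "?S \<subseteq> {1..i+j}" by auto
  have L: "{Z\<in>UTo {1..i+j} \<tau>. \<forall>a b. a \<noteq> b \<and> Z a b \<noteq> 0 \<longrightarrow> (a,b) \<in> ?S \<times> ?S \<union> ?T \<times> ?T} = levi (i+j) \<tau> ?S"
    and N: "{Z\<in>UTo {1..i+j} \<tau>. \<forall>a b. a \<noteq> b \<and> Z a b \<noteq> 0 \<longrightarrow> (a,b) \<in> ?S \<times> ?T} = radical (i+j) \<tau> ?S"
    unfolding levi_def radical_def T by simp_all
  have "Infl {1..i+j} (UTo {1..i+j} \<tau>) (levi (i+j) \<tau> ?S) (radical (i+j) \<tau> ?S)
      (\<lambda>l. F ((\<tau>1, blk ?S l), (\<tau>2, blk ?T l))) X =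
      (if X \<in> UTo {1..i+j} \<tau> then F ((\<tau>1, blk ?S X), (\<tau>2, blk ?T X)) else 0)"
    if "(\<tau>1,\<tau>2) \<in> ?P" for \<tau>1 \<tau>2
    using Infl_blocks[OF \<tau> S, where G="\<lambda>x y. F ((\<tau>1, x), (\<tau>2, y))" and
        \<psi>="\<lambda>l. F ((\<tau>1, blk ?S l), (\<tau>2, blk ?T l))" and g=X] that
    unfolding T by (auto simp: ojoin_def)
  then have "muK i j F (\<tau>, X) = (\<Sum>(\<tau>1,\<tau>2)\<in>?P. if X \<in> UTo {1..i+j} \<tau> then F ((\<tau>1, blk ?S X), (\<tau>2, blk ?T X)) else 0)"
    unfolding muK_def Let_def prod.case ojoin_def[symmetric] L N by (intro sum.cong refl) auto
  then show ?thesis by (simp split: if_split)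
qed

text \<open>The sum over orders \<tau> of the sums over pairs joining to \<tau> is the sum over all
  pairs. For a joined order the rank permutation preserves the cut at \<open>i\<close> and restricts
  to the two rank permutations, so it commutes with both blocks.\<close>

lemma straighten_muK:
  fixes F :: "'a::{field,finite} omat \<times> 'a omat \<Rightarrow> complex"
  shows "straighten (i+j) (muK i j F) = muUT i j (tmap (straighten i) (straighten j) F)"
proof
  fix X :: "'a mat"
  let ?S = "{1..i}" and ?T = "{i+1..i+j}"
  let ?O1 = "{\<tau>. sord {1..i} \<tau>}" and ?O2 = "{\<tau>. sord {1..j} \<tau>}" and ?O = "{\<tau>. sord {1..i+j} \<tau>}"
  show "straighten (i+j) (muK i j F) X = muUT i j (tmap (straighten i) (straighten j) F) X"
  proof (cases "X \<in> UT (i+j)")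
    case False
    then have "straighten (i+j) (muK i j F) X = 0"
      unfolding straighten_def by (intro sum.neutral) (simp add: muK_apply pullback_ranking_UTo)
    then show ?thesis using False by (simp add: muUT_apply)
  next
    case True
    define g where "g = (\<lambda>(\<tau>1,\<tau>2). F ((\<tau>1, pullback (ranking i \<tau>1) (blk ?S X)),
      (\<tau>2, pullback (ranking j \<tau>2) (blk ?T X))))"
    have "muK i j F (\<tau>, pullback (ranking (i+j) \<tau>) X) = (\<Sum>p\<in>{p\<in>?O1 \<times> ?O2. (\<lambda>(\<tau>1,\<tau>2). ojoin i j \<tau>1 \<tau>2) p = \<tau>}. g p)"
      if \<tau>: "\<tau> \<in> ?O" for \<tau>
    proof -
      have "{(\<tau>1,\<tau>2). sord {1..i} \<tau>1 \<and> sord {1..j} \<tau>2 \<and> \<tau> = ojoin i j \<tau>1 \<tau>2} =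
          {p\<in>?O1 \<times> ?O2. (\<lambda>(\<tau>1,\<tau>2). ojoin i j \<tau>1 \<tau>2) p = \<tau>}" by auto
      moreover have "F ((\<tau>1, blk ?S (pullback (ranking (i+j) \<tau>) X)), (\<tau>2, blk ?T (pullback (ranking (i+j) \<tau>) X))) = g (\<tau>1,\<tau>2)"
        if "sord {1..i} \<tau>1" "sord {1..j} \<tau>2" "\<tau> = ojoin i j \<tau>1 \<tau>2" for \<tau>1 \<tau>2
      proof -
        have "blk ?S (pullback (ranking (i+j) \<tau>) X) = pullback (ranking i \<tau>1) (blk ?S X)"
          using ranking_permutes[OF that(1)] ranking_in[OF that(1)] ranking_ojoin(1)[OF that(1,2)]
          by (intro pullback_blk) (simp_all add: that(3) canoinv_from_1)
        moreover have "blk ?T (pullback (ranking (i+j) \<tau>) X) = pullback (ranking j \<tau>2) (blk ?T X)"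
        proof (rule pullback_blk)
          show "ranking j \<tau>2 permutes {1..card ?T}" using ranking_permutes[OF that(2)] by simp
          show "ranking (i + j) \<tau> (canoinv ?T r) = canoinv ?T (ranking j \<tau>2 r)" if "r \<in> {1..card ?T}" for r
          proof -
            have r: "r \<in> {1..j}" using that by simp
            show ?thesis
              using ranking_ojoin(2)[OF \<open>sord {1..i} \<tau>1\<close> \<open>sord {1..j} \<tau>2\<close> r] ranking_in[OF \<open>sord {1..j} \<tau>2\<close> r]
              by (simp only: \<open>\<tau> = ojoin i j \<tau>1 \<tau>2\<close> canoinv_atLeastAtMost r)
          qed
        qed simp
        ultimately show ?thesis by (simp add: g_def)
      qed
      ultimately show ?thesis
        using \<tau> True by (simp add: muK_apply pullback_ranking_UTo) (intro sum.cong; auto)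
    qed
    then have "straighten (i+j) (muK i j F) X = (\<Sum>\<tau>\<in>?O. \<Sum>p\<in>{p\<in>?O1 \<times> ?O2. (\<lambda>(\<tau>1,\<tau>2). ojoin i j \<tau>1 \<tau>2) p = \<tau>}. g p)"
      by (simp add: straighten_def)
    also have "\<dots> = (\<Sum>p\<in>?O1 \<times> ?O2. g p)"
      by (rule sum.group) (use finite_sord sord_ojoin in auto)
    also have "\<dots> = (\<Sum>\<tau>1\<in>?O1. \<Sum>\<tau>2\<in>?O2. g (\<tau>1,\<tau>2))" by (simp add: sum.cartesian_product)
    also have "\<dots> = (\<Sum>\<tau>2\<in>?O2. \<Sum>\<tau>1\<in>?O1. g (\<tau>1,\<tau>2))" by (rule sum.swap)
    also have "\<dots> = muUT i j (tmap (straighten i) (straighten j) F) X"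
      using True by (simp add: muUT_apply tmap_def straighten_def g_def)
    finally show ?thesis .
  qed
qed

subsection \<open>Coproducts\<close>

lemma cano_less:
  assumes "finite I" "b \<in> I" "a < b"
  shows "cano I a < cano I b"
proof -
  have "b \<in> {k\<in>I. k \<le> b}" "b \<notin> {k\<in>I. k \<le> a}" using assms by auto
  moreover have "{k\<in>I. k \<le> a} \<subseteq> {k\<in>I. k \<le> b}" using assms(3) by auto
  ultimately have "{k\<in>I. k \<le> a} \<subset> {k\<in>I. k \<le> b}" by blast
  then show ?thesis unfolding cano_def using assms(1) by (intro psubset_card_mono) simp_all
qed

text \<open>Passing from a rank in \<open>I\<close> to the element, to its \<phi>-rank and to the
  rank of that among the image of \<open>I\<close> is increasing for the restricted order, so it is
  the ranking of that order.\<close>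

lemma ranking_ordr:
  assumes \<phi>: "sord {1..n} \<phi>" and I: "I \<subseteq> {1..n}" and r: "r \<in> {1..card I}"
  shows "ranking n \<phi> (canoinv I r) = canoinv (ranking n \<phi> ` I) (ranking (card I) (ordr I \<phi>) r)"
proof -
  let ?\<sigma> = "ranking n \<phi>" and ?J = "ranking n \<phi> ` I"
  have fin: "finite I" "finite ?J" using I finite_subset by blast+
  have card: "card ?J = card I"
    by (rule card_image) (rule inj_on_subset[OF permutes_inj[OF ranking_permutes[OF \<phi>]]], simp)
  have "ranking (card I) (ordr I \<phi>) r = cano ?J (?\<sigma> (canoinv I r))"
  proof (rule ranking_unique[OF sord_ordr[OF fin(1) \<phi> I] _ _ r])
    show "cano ?J (?\<sigma> (canoinv I a)) \<in> {1..card I}" if "a \<in> {1..card I}" for a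
      using cano_in[OF fin(2), of "?\<sigma> (canoinv I a)"] canoinv_in[OF fin(1) that] unfolding card by blast
    fix a b assume "(a,b) \<in> ordr I \<phi>"
    then show "cano ?J (?\<sigma> (canoinv I a)) < cano ?J (?\<sigma> (canoinv I b))"
      using canoinv_in[OF fin(1)] ranking_less[OF \<phi>] unfolding ordr_iff[OF fin(1)]
      by (intro cano_less[OF fin(2)]) blast+
  qed
  then show ?thesis using canoinv_cano[OF fin(2)] canoinv_in[OF fin(1) r] by simp
qed

lemma blk_pullback_ranking:
  assumes \<phi>: "sord {1..n} \<phi>" and I: "I \<subseteq> {1..n}"
  shows "blk I (pullback (ranking n \<phi>) h) = pullback (ranking (card I) (ordr I \<phi>)) (blk (ranking n \<phi> ` I) h)"
proof (rule pullback_blk)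
  have fin: "finite I" using I finite_subset by blast
  show "ranking (card I) (ordr I \<phi>) permutes {1..card I}"
    by (rule ranking_permutes[OF sord_ordr[OF fin \<phi> I]])
  show card: "card (ranking n \<phi> ` I) = card I"
    by (rule card_image) (rule inj_on_subset[OF permutes_inj[OF ranking_permutes[OF \<phi>]]], simp)
  show "ranking n \<phi> (canoinv I r) = canoinv (ranking n \<phi> ` I) (ranking (card I) (ordr I \<phi>) r)"
    if "r \<in> {1..card (ranking n \<phi> ` I)}" for r
    by (rule ranking_ordr[OF \<phi> I]) (use that card in simp)
qed

text \<open>Relabelling takes fibres for \<phi> and \<open>I\<close> to standard fibres for the
  image of \<open>I\<close> under the rank permutation; this turns averages for arbitrary orders
  into standard ones.\<close>

lemma fibr_pullback_iff:
  fixes h X Y :: "'a::{field,finite} mat"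
  assumes \<phi>: "sord {1..n} \<phi>" and I: "I \<subseteq> {1..n}"
  shows "pullback (ranking n \<phi>) h \<in> fibr n \<phi> I (pullback (ranking (card I) (ordr I \<phi>)) X)
      (pullback (ranking (n - card I) (ordr ({1..n} - I) \<phi>)) Y) \<longleftrightarrow>
    h \<in> fibr n (std_ord n) (ranking n \<phi> ` I) X Y"
proof -
  let ?\<sigma> = "ranking n \<phi>"
  have fin: "finite I" "finite ({1..n} - I)" using I finite_subset by blast+
  have c: "{1..n} - ?\<sigma> ` I = ?\<sigma> ` ({1..n} - I)"
    using image_set_diff[OF permutes_inj[OF ranking_permutes[OF \<phi>]]] permutes_image[OF ranking_permutes[OF \<phi>]] by metis
  have z: "(\<forall>a\<in>{1..n} - I. \<forall>b\<in>I. pullback ?\<sigma> h a b = 0) \<longleftrightarrow>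
      (\<forall>a\<in>?\<sigma> ` ({1..n} - I). \<forall>b\<in>?\<sigma> ` I. h a b = 0)"
    by (simp add: pullback_def)
  have p1: "ranking (card I) (ordr I \<phi>) permutes {1..card I}"
    by (rule ranking_permutes[OF sord_ordr[OF fin(1) \<phi> I]])
  have p2: "ranking (n - card I) (ordr ({1..n} - I) \<phi>) permutes {1..n - card I}"
    using ranking_permutes[OF sord_ordr[OF fin(2) \<phi> Diff_subset]] by (simp only: card_compl[OF I])
  have b1: "blk I (pullback ?\<sigma> h) = pullback (ranking (card I) (ordr I \<phi>)) (blk (?\<sigma> ` I) h)"
    by (rule blk_pullback_ranking[OF \<phi> I])
  have b2: "blk ({1..n} - I) (pullback ?\<sigma> h) =
      pullback (ranking (n - card I) (ordr ({1..n} - I) \<phi>)) (blk (?\<sigma> ` ({1..n} - I)) h)"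
    using blk_pullback_ranking[OF \<phi> Diff_subset, of I h] by (simp only: card_compl[OF I])
  show ?thesis
    unfolding fibr_std_iff unfolding fibr_def parab_def mem_Collect_eq c z b1 b2 inj_pullback[OF p1] inj_pullback[OF p2]
      pullback_ranking_UTo[OF \<phi>]
    by (simp only: conj_assoc)
qed

lemma avg_fibr_pullback:
  fixes X Y :: "'a::{field,finite} mat"
  assumes \<phi>: "sord {1..n} \<phi>" and I: "I \<subseteq> {1..n}"
  shows "avg (fibr n \<phi> I (pullback (ranking (card I) (ordr I \<phi>)) X)
      (pullback (ranking (n - card I) (ordr ({1..n} - I) \<phi>)) Y)) f =
    avg (fibr n (std_ord n) (ranking n \<phi> ` I) X Y) (\<lambda>h. f (pullback (ranking n \<phi>) h))"
    (is "avg ?A f = avg ?B _")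
proof (rule avg_bij_betw)
  have bij: "bij (pullback (ranking n \<phi>) :: 'a mat \<Rightarrow> _)" by (rule bij_pullback[OF ranking_permutes[OF \<phi>]])
  have "pullback (ranking n \<phi>) ` ?B = ?A"
  proof (intro equalityI subsetI)
    fix y assume y: "y \<in> ?A"
    obtain h where "y = pullback (ranking n \<phi>) h" using bij by (metis bij_pointE)
    then show "y \<in> pullback (ranking n \<phi>) ` ?B" using y fibr_pullback_iff[OF \<phi> I, of h X Y] by auto
  qed (use fibr_pullback_iff[OF \<phi> I] in auto)
  then show "bij_betw (pullback (ranking n \<phi>)) ?B ?A"
    using bij by (metis bij_betw_subset subset_UNIV)
qed

lemma DeltaMon_apply:
  fixes x y :: "'a::{field,finite} mat"
  assumes \<phi>: "sord {1..n} \<phi>" and I: "I \<subseteq> {1..n}"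
    and x: "x \<in> UTo {1..card I} (ordr I \<phi>)" and y: "y \<in> UTo {1..n - card I} (ordr ({1..n} - I) \<phi>)"
  shows "DeltaMon n \<phi> I ({1..n} - I) \<psi> (emb n I x y) = avg (fibr n \<phi> I x y) \<psi>"
proof -
  have N: "{Z\<in>UTo {1..n} \<phi>. \<forall>a b. a \<noteq> b \<and> Z a b \<noteq> 0 \<longrightarrow> (a,b) \<in> \<phi> \<inter> (I \<times> ({1..n} - I))} =
      (radical n \<phi> I :: 'a mat set)"
  proof -
    have "(a,b) \<in> \<phi>" if "Z \<in> UTo {1..n} \<phi>" "a \<noteq> b" "Z a b \<noteq> 0" for Z :: "'a mat" and a b
      using that UTo_neq_idm[OF \<phi> that(1), of a b] UTo_iff'[OF \<phi>, of Z] by blast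
    then show ?thesis unfolding radical_def by blast
  qed
  have "supp_in {1..card I} x" "supp_in {1..n - card I} y" using x y by (auto simp: UTo_def)
  then show ?thesis
    unfolding DeltaMon_def N levi_def[symmetric] parab_def[symmetric]
    using Defl_Restr[OF \<phi> I emb_levi[OF \<phi> I x y], of \<psi>] by (simp add: blk_emb1[OF I] blk_emb2[OF I])
qed

lemma sum_group_pairs:
  assumes "finite A" "finite B" "finite C" "\<And>x. x \<in> C \<Longrightarrow> f x \<in> A \<and> g x \<in> B"
  shows "(\<Sum>b\<in>B. \<Sum>a\<in>A. \<Sum>x\<in>{x\<in>C. f x = a \<and> g x = b}. h x) = (\<Sum>x\<in>C. h x)"
proof -
  have "(\<Sum>b\<in>B. \<Sum>a\<in>A. \<Sum>x\<in>{x\<in>C. f x = a \<and> g x = b}. h x) =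
      (\<Sum>b\<in>B. \<Sum>a\<in>A. \<Sum>x\<in>{x\<in>{x\<in>C. g x = b}. f x = a}. h x)"
    by (intro sum.cong refl) auto
  also have "\<dots> = (\<Sum>b\<in>B. \<Sum>x\<in>{x\<in>C. g x = b}. h x)"
    by (intro sum.cong refl sum.group) (use assms in auto)
  also have "\<dots> = (\<Sum>x\<in>C. h x)" by (rule sum.group) (use assms in auto)
  finally show ?thesis .
qed

lemma permutes_image_bij_betw:
  assumes p: "p permutes {1..n}"
  shows "bij_betw ((`) p) {I. I \<subseteq> {1..n} \<and> card I = k} {I. I \<subseteq> {1..n} \<and> card I = k}"
proof -
  have *: "p ` I \<subseteq> {1..n} \<and> card (p ` I) = card I" if "p permutes {1..n}" "I \<subseteq> {1..n}" for I p
    using that permutes_image[OF that(1)] card_image[OF inj_on_subset[OF permutes_inj[OF that(1)] subset_UNIV]]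
    by (metis image_mono)
  have inv: "inv p ` p ` I = I" "p ` inv p ` I = I" for I
    using permutes_inverses[OF p] by (auto simp: image_image)
  show ?thesis
  proof (rule bij_betw_byWitness[where f'="(`) (inv p)"])
    show "(`) p ` {I. I \<subseteq> {1..n} \<and> card I = k} \<subseteq> {I. I \<subseteq> {1..n} \<and> card I = k}"
      using *[OF p] by blast
    show "(`) (inv p) ` {I. I \<subseteq> {1..n} \<and> card I = k} \<subseteq> {I. I \<subseteq> {1..n} \<and> card I = k}"
      using *[OF permutes_inv[OF p]] by blast
  qed (simp_all add: inv)
qed

text \<open>Straightening the two factors sums over all pairs of orders, which removes the
  restriction on \<phi> in \<open>DeltaK\<close>. For each \<phi> the subset \<open>I\<close> is
  then replaced by its image under the rank permutation, and the sum over \<phi> moves inside the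
  standard average.\<close>

lemma straighten_DeltaK:
  fixes v :: "'a::{field,finite} omat \<Rightarrow> complex"
  shows "tmap (straighten k) (straighten l) (DeltaK k l v) = DeltaUT k l (straighten (k+l) v)"
proof (rule ext, clarify)
  fix X Y :: "'a mat"
  define n where "n = k + l"
  let ?O1 = "{\<tau>. sord {1..k} \<tau>}" and ?O2 = "{\<tau>. sord {1..l} \<tau>}" and ?O = "{\<tau>. sord {1..n} \<tau>}"
  let ?K = "{I. I \<subseteq> {1..n} \<and> card I = k}"
  let ?x = "\<lambda>\<tau>. pullback (ranking k \<tau>) X" and ?y = "\<lambda>\<tau>. pullback (ranking l \<tau>) Y"
  have D: "DeltaK k l v ((\<tau>1, x), (\<tau>2, y)) = (\<Sum>I\<in>?K. \<Sum>\<phi>\<in>{\<phi>\<in>?O. ordr I \<phi> = \<tau>1 \<and> ordr ({1..n} - I) \<phi> = \<tau>2}.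
      if x \<in> UTo {1..k} \<tau>1 \<and> y \<in> UTo {1..l} \<tau>2
      then DeltaMon n \<phi> I ({1..n} - I) (\<lambda>X. v (\<phi>, X)) (emb n I x y) else 0)" for \<tau>1 x \<tau>2 y
    unfolding DeltaK_def n_def ordr_def prod.case by (simp add: conj_assoc)
  have L: "tmap (straighten k) (straighten l) (DeltaK k l v) (X,Y) =
      (\<Sum>\<tau>2\<in>?O2. \<Sum>\<tau>1\<in>?O1. DeltaK k l v ((\<tau>1, ?x \<tau>1), (\<tau>2, ?y \<tau>2)))"
    by (simp add: tmap_def straighten_def)
  show "tmap (straighten k) (straighten l) (DeltaK k l v) (X,Y) = DeltaUT k l (straighten (k+l) v) (X,Y)"
  proof (cases "X \<in> UT k \<and> Y \<in> UT l")
    case False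
    have "DeltaK k l v ((\<tau>1, ?x \<tau>1), (\<tau>2, ?y \<tau>2)) = 0" if "\<tau>1 \<in> ?O1" "\<tau>2 \<in> ?O2" for \<tau>1 \<tau>2
      unfolding D using False that by (auto simp: pullback_ranking_UTo intro!: sum.neutral)
    then have "(\<Sum>\<tau>2\<in>?O2. \<Sum>\<tau>1\<in>?O1. DeltaK k l v ((\<tau>1, ?x \<tau>1), (\<tau>2, ?y \<tau>2))) = 0"
      by (intro sum.neutral ballI) blast
    then show ?thesis using False unfolding L by (auto simp: DeltaUT_apply)
  next
    case True
    let ?a = "\<lambda>I \<phi>. avg (fibr n \<phi> I (?x (ordr I \<phi>)) (?y (ordr ({1..n} - I) \<phi>))) (\<lambda>X. v (\<phi>, X))"
    have fK: "finite ?K" by (rule finite_subset[of _ "Pow {1..n}"]) auto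
    have so: "ordr I \<phi> \<in> ?O1 \<and> ordr ({1..n} - I) \<phi> \<in> ?O2" if "I \<in> ?K" "\<phi> \<in> ?O" for I \<phi>
    proof -
      have I: "I \<subseteq> {1..n}" "card I = k" "n - card I = l" using that by (auto simp: n_def)
      have "finite I" using I(1) finite_subset by blast
      then show ?thesis
        using sord_ordr[OF _ _ I(1), of \<phi>] sord_ordr[OF _ _ Diff_subset, of "{1..n}" I \<phi>] that I
        by (simp add: card_compl[OF I(1)])
    qed
    have "DeltaK k l v ((\<tau>1, ?x \<tau>1), (\<tau>2, ?y \<tau>2)) =
        (\<Sum>I\<in>?K. \<Sum>\<phi>\<in>{\<phi>\<in>?O. ordr I \<phi> = \<tau>1 \<and> ordr ({1..n} - I) \<phi> = \<tau>2}. ?a I \<phi>)"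
      if \<tau>: "\<tau>1 \<in> ?O1" "\<tau>2 \<in> ?O2" for \<tau>1 \<tau>2
      unfolding D
    proof (intro sum.cong refl)
      fix I \<phi> assume IK: "I \<in> ?K" and ph: "\<phi> \<in> {\<phi>\<in>?O. ordr I \<phi> = \<tau>1 \<and> ordr ({1..n} - I) \<phi> = \<tau>2}"
      have I: "I \<subseteq> {1..n}" "card I = k" "n - card I = l" using IK by (auto simp: n_def)
      have x: "?x \<tau>1 \<in> UTo {1..k} \<tau>1" and y: "?y \<tau>2 \<in> UTo {1..l} \<tau>2"
        using True \<tau> by (simp_all add: pullback_ranking_UTo)
      have "DeltaMon n \<phi> I ({1..n} - I) (\<lambda>X. v (\<phi>, X)) (emb n I (?x \<tau>1) (?y \<tau>2)) =
          avg (fibr n \<phi> I (?x \<tau>1) (?y \<tau>2)) (\<lambda>X. v (\<phi>, X))"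
        by (rule DeltaMon_apply) (use ph I x y in auto)
      then show "(if ?x \<tau>1 \<in> UTo {1..k} \<tau>1 \<and> ?y \<tau>2 \<in> UTo {1..l} \<tau>2
          then DeltaMon n \<phi> I ({1..n} - I) (\<lambda>X. v (\<phi>, X)) (emb n I (?x \<tau>1) (?y \<tau>2)) else 0) = ?a I \<phi>"
        using x y ph by simp
    qed
    then have "tmap (straighten k) (straighten l) (DeltaK k l v) (X,Y) =
      (\<Sum>\<tau>2\<in>?O2. \<Sum>\<tau>1\<in>?O1. \<Sum>I\<in>?K. \<Sum>\<phi>\<in>{\<phi>\<in>?O. ordr I \<phi> = \<tau>1 \<and> ordr ({1..n} - I) \<phi> = \<tau>2}. ?a I \<phi>)"
      unfolding L by (intro sum.cong refl) blast
    also have "\<dots> = (\<Sum>\<tau>2\<in>?O2. \<Sum>I\<in>?K. \<Sum>\<tau>1\<in>?O1. \<Sum>\<phi>\<in>{\<phi>\<in>?O. ordr I \<phi> = \<tau>1 \<and> ordr ({1..n} - I) \<phi> = \<tau>2}. ?a I \<phi>)"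
      by (intro sum.cong refl sum.swap)
    also have "\<dots> = (\<Sum>I\<in>?K. \<Sum>\<tau>2\<in>?O2. \<Sum>\<tau>1\<in>?O1. \<Sum>\<phi>\<in>{\<phi>\<in>?O. ordr I \<phi> = \<tau>1 \<and> ordr ({1..n} - I) \<phi> = \<tau>2}. ?a I \<phi>)"
      by (rule sum.swap)
    \<comment> \<open>For fixed \<open>I\<close> every \<phi> restricts to exactly one pair of
      orders, so grouping by that pair exhausts all \<phi>.\<close>
    also have "\<dots> = (\<Sum>I\<in>?K. \<Sum>\<phi>\<in>?O. ?a I \<phi>)"
      by (intro sum.cong refl sum_group_pairs finite_sord so)
    also have "\<dots> = (\<Sum>\<phi>\<in>?O. \<Sum>I\<in>?K. ?a I \<phi>)" by (rule sum.swap)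
    also have "\<dots> = (\<Sum>\<phi>\<in>?O. \<Sum>J\<in>?K. avg (fibr n (std_ord n) J X Y) (\<lambda>h. v (\<phi>, pullback (ranking n \<phi>) h)))"
    proof (rule sum.cong[OF refl])
      fix \<phi> assume ph: "\<phi> \<in> ?O"
      then have \<phi>: "sord {1..n} \<phi>" by simp
      have "(\<Sum>I\<in>?K. ?a I \<phi>) = (\<Sum>I\<in>?K. avg (fibr n (std_ord n) (ranking n \<phi> ` I) X Y) (\<lambda>h. v (\<phi>, pullback (ranking n \<phi>) h)))"
      proof (rule sum.cong[OF refl])
        fix I assume "I \<in> ?K"
        then have I: "I \<subseteq> {1..n}" "card I = k" "n - card I = l" by (auto simp: n_def)
        show "?a I \<phi> = avg (fibr n (std_ord n) (ranking n \<phi> ` I) X Y) (\<lambda>h. v (\<phi>, pullback (ranking n \<phi>) h))"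
          using avg_fibr_pullback[OF \<phi> I(1), of X Y "\<lambda>X. v (\<phi>, X)"] unfolding I(3) unfolding I(2) .
      qed
      \<comment> \<open>The rank permutation of \<phi> permutes the \<open>k\<close>-element subsets
        of \<open>{1..n}\<close>.\<close>
      also have "\<dots> = (\<Sum>J\<in>?K. avg (fibr n (std_ord n) J X Y) (\<lambda>h. v (\<phi>, pullback (ranking n \<phi>) h)))"
        by (rule sum.reindex_bij_betw[OF permutes_image_bij_betw[OF ranking_permutes[OF \<phi>]]])
      finally show "(\<Sum>I\<in>?K. ?a I \<phi>) = (\<Sum>J\<in>?K. avg (fibr n (std_ord n) J X Y) (\<lambda>h. v (\<phi>, pullback (ranking n \<phi>) h)))" .
    qed
    also have "\<dots> = (\<Sum>J\<in>?K. \<Sum>\<phi>\<in>?O. avg (fibr n (std_ord n) J X Y) (\<lambda>h. v (\<phi>, pullback (ranking n \<phi>) h)))"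
      by (rule sum.swap)
    also have "\<dots> = DeltaUT k l (straighten (k+l) v) (X,Y)"
      using True by (simp add: DeltaUT_apply straighten_def avg_sum n_def)
    finally show ?thesis .
  qed
qed

theorem straighten_fock_iso:
  "fock_iso (Rsp :: nat \<Rightarrow> ('a::{field,finite} omat \<Rightarrow> complex) set) relK muK DeltaK uK epsK
     (cfUT :: nat \<Rightarrow> ('a mat \<Rightarrow> complex) set) muUT DeltaUT uUT epsUT straighten"
  unfolding fock_iso_def
proof (intro conjI allI ballI)
  fix n
  show "lin_on (Rsp n) (straighten n)" by (rule lin_straighten)
  show "straighten n ` (Rsp n :: ('a omat \<Rightarrow> complex) set) = cfUT n"
  proof (intro equalityI subsetI)
    fix f :: "'a mat \<Rightarrow> complex" assume "f \<in> cfUT n"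
    then show "f \<in> straighten n ` Rsp n" using straighten_surj[of f n] by blast
  qed (use straighten_cfUT in blast)
next
  fix n and v :: "'a omat \<Rightarrow> complex" assume "v \<in> Rsp n"
  then show "straighten n v = (\<lambda>x. 0) \<longleftrightarrow> v \<in> relK n" using straighten_relK relK_straighten by blast
next
  show "straighten 0 uK = (uUT :: 'a mat \<Rightarrow> complex)"
    by (rule ext) (simp add: straighten_0 uK_def uUT_iff)
next
  fix v :: "'a omat \<Rightarrow> complex"
  show "epsUT (straighten 0 v) = epsK v" by (simp add: epsUT_def epsK_def straighten_0)
qed (simp_all add: straighten_muK straighten_DeltaK)

theorem theorem5p5:
  shows "graded_connected_hopf (cfUT :: nat \<Rightarrow> ('a::{field,finite} mat \<Rightarrow> complex) set)
           muUT DeltaUT uUT epsUT \<and>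
         (\<exists>\<Phi>. fock_iso (Rsp :: nat \<Rightarrow> ('a omat \<Rightarrow> complex) set) relK muK DeltaK uK epsK
                        (cfUT :: nat \<Rightarrow> ('a mat \<Rightarrow> complex) set) muUT DeltaUT uUT epsUT \<Phi>)"
  using cfUT_hopf straighten_fock_iso by blast

end
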